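(* Let $i\ge0$. For $n\ge 3i$, we have $H_i(U,\mathbb{Q})^{\mathrm{tl}}\subset H^A_i(\mathrm{IA}_n,\mathbb{Q})$ as subspaces of $H_i(U,\mathbb{Q})=\bigwedge^iU$.
   Context: $F_n$ is the free group of rank $n$, $\mathrm{IA}_n=\ker(\mathrm{Aut}(F_n)\to\mathrm{GL}(n,\mathbb{Z}))$, $H=H_1(F_n,\mathbb{Q})$, $H^*$ its dual, $U=\mathrm{Hom}(H,\bigwedge^2H)\cong(\bigwedge^2H)\otimes H^*$, and $H_i(U,\mathbb{Q})=\bigwedge^iU$. For a group $G$ with abelianization $\pi:G\to H_1(G,\mathbb{Z})$, $H^A_i(G,\mathbb{Q})=\mathrm{im}(\pi_*:H_i(G,\mathbb{Q})\to H_i(H_1(G,\mathbb{Z}),\mathbb{Q})\cong\bigwedge^iH_1(G,\mathbb{Q}))$. The Johnson homomorphism ($f\mapsto([x]\mapsto x^{-1}f(x)$ modulo the third term of the lower central series of $F_n$)) gives $H_1(\mathrm{IA}_n,\mathbb{Q})\cong U$, so $H^A_i(\mathrm{IA}_n,\mathbb{Q})$ is a $\mathrm{GL}(n,\mathbb{Q})$-subrepresentation of $\bigwedge^iU$. Traceless part: $T_{p,q}\subset H^{\otimes p}\otimes(H^* )^{\otimes q}$ is the intersection of the kernels of all contractions of one factor $H$ with one factor $H^*$. The traceless part $H_i(U,\mathbb{Q})^{\mathrm{tl}}$ is the subrepresentation of $H_i(U,\mathbb{Q})$ vanishing under all contraction maps; explicitly $H_i(U,\mathbb{Q})^{\mathrm{tl}}=\pi(T_{2i,i})$,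 where $\pi:H^{\otimes2i}\otimes(H^* )^{\otimes i}\to\bigwedge^iU$ is $$\Bigl(\bigotimes_{j=1}^i(a_j\otimes b_j)\Bigr)\otimes\Bigl(\bigotimes_{j=1}^ic_j^*\Bigr)\mapsto\bigwedge_{j=1}^i\bigl((a_j\wedge b_j)\otimes c_j^*\bigr).$$ *)

theory Defs
  imports
    "HOL-Algebra.Bij"
    "HOL-Algebra.Generated_Groups"
    "HOL-Library.Function_Algebras"
    "HOL-Library.Set_Algebras"
    "Jordan_Normal_Form.Determinant"
begin

section \<open>Rational vector spaces of functions\<close>

text \<open>Every rational vector space below is a subspace, or a quotient of a subspace, of some
  function space \<open>'a \<Rightarrow> rat\<close> with pointwise operations. A quotient \<open>V / W\<close> is a set of
  cosets \<open>v +o W\<close>.\<close>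

definition qscale :: "rat \<Rightarrow> ('a \<Rightarrow> rat) \<Rightarrow> 'a \<Rightarrow> rat"
  where "qscale r f = (\<lambda>x. r * f x)"

global_interpretation qvs: vector_space qscale
  by unfold_locales (auto simp: qscale_def fun_eq_iff algebra_simps)

definition delta :: "'a \<Rightarrow> 'a \<Rightarrow> rat"
  where "delta x = (\<lambda>y. if y = x then 1 else 0)"

text \<open>The linear extension of \<open>delta x \<mapsto> F x\<close>, applied to a finitely supported \<open>c\<close>.\<close>

definition lin_ext :: "('a \<Rightarrow> 'b \<Rightarrow> rat) \<Rightarrow> ('a \<Rightarrow> rat) \<Rightarrow> 'b \<Rightarrow> rat"
  where "lin_ext F c = (\<Sum>x | c x \<noteq> 0. qscale (c x) (F x))"


section \<open>Exterior powers of function spaces\<close>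

text \<open>For \<open>V\<close> a space of functions on \<open>B\<close>, the exterior power \<open>\<Lambda>\<^sup>k V\<close> is realised
  inside the functions on \<open>B\<^sup>k\<close> (lists of length \<open>k\<close>): the wedge of
  \<open>v\<^sub>1, \<dots>, v\<^sub>k\<close> is the antisymmetrised tensor
  \<open>\<Sum>\<^sub>p sgn(p) v\<^sub>p\<^sub>(\<^sub>1\<^sub>) \<otimes> \<dots> \<otimes> v\<^sub>p\<^sub>(\<^sub>k\<^sub>)\<close>, whose value at
  \<open>(b\<^sub>1, \<dots>, b\<^sub>k)\<close> is \<open>det (v\<^sub>j(b\<^sub>l))\<close>. In characteristic 0 this is a faithful
  model of the exterior power.\<close>

definition wedge :: "('b \<Rightarrow> rat) list \<Rightarrow> 'b list \<Rightarrow> rat"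
  where "wedge vs bs =
    (if length bs = length vs
     then det (mat (length vs) (length vs) (\<lambda>(j, l). (vs ! j) (bs ! l)))
     else 0)"

definition ext_power :: "nat \<Rightarrow> ('b \<Rightarrow> rat) set \<Rightarrow> ('b list \<Rightarrow> rat) set"
  where "ext_power k V = qvs.span {wedge vs | vs. length vs = k \<and> set vs \<subseteq> V}"

definition tensor :: "('a \<Rightarrow> rat) \<Rightarrow> ('b \<Rightarrow> rat) \<Rightarrow> 'a \<times> 'b \<Rightarrow> rat"
  where "tensor f g = (\<lambda>(x, y). f x * g y)"


section \<open>Rational group homology, via the inhomogeneous bar complex\<close>

definition bar_chains :: "('a, 'm) monoid_scheme \<Rightarrow> nat \<Rightarrow> ('a list \<Rightarrow> rat) set"
  where "bar_chains G k = qvs.span {delta gs | gs. length gs = k \<and> set gs \<subseteq> carrier G}"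

definition bar_face_sum :: "('a, 'm) monoid_scheme \<Rightarrow> 'a list \<Rightarrow> 'a list \<Rightarrow> rat"
  where "bar_face_sum G gs =
    (if gs = [] then 0
     else delta (tl gs)
       + (\<Sum>j\<in>{1..<length gs}. qscale ((-1) ^ j)
            (delta (take (j - 1) gs @ (gs ! (j - 1) \<otimes>\<^bsub>G\<^esub> gs ! j) # drop (j + 1) gs)))
       + qscale ((-1) ^ length gs) (delta (butlast gs)))"

definition bar_boundary :: "('a, 'm) monoid_scheme \<Rightarrow> ('a list \<Rightarrow> rat) \<Rightarrow> 'a list \<Rightarrow> rat"
  where "bar_boundary G = lin_ext (bar_face_sum G)"

definition bar_cycles :: "('a, 'm) monoid_scheme \<Rightarrow> nat \<Rightarrow> ('a list \<Rightarrow> rat) set"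
  where "bar_cycles G k = {z \<in> bar_chains G k. bar_boundary G z = 0}"

definition bar_boundaries :: "('a, 'm) monoid_scheme \<Rightarrow> nat \<Rightarrow> ('a list \<Rightarrow> rat) set"
  where "bar_boundaries G k = bar_boundary G ` bar_chains G (Suc k)"

definition grp_homology :: "('a, 'm) monoid_scheme \<Rightarrow> nat \<Rightarrow> ('a list \<Rightarrow> rat) set set"
  where "grp_homology G k = {z +o bar_boundaries G k | z. z \<in> bar_cycles G k}"

text \<open>The map on \<open>H\<^sub>k\<close> induced by a homomorphism \<open>f\<close> into \<open>K\<close>; adding
  \<open>bar_boundaries K k\<close> turns the image of a coset into the coset of the image.\<close>

definition grp_homology_map ::
    "('b, 'm) monoid_scheme \<Rightarrow> ('a \<Rightarrow> 'b) \<Rightarrow> nat \<Rightarrow> ('a list \<Rightarrow> rat) set \<Rightarrow> ('b list \<Rightarrow> rat) set"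
  where "grp_homology_map K f k C =
    lin_ext (\<lambda>gs. delta (map f gs)) ` C + bar_boundaries K k"


section \<open>Albanese homology of a group\<close>

definition abelianization :: "('a, 'm) monoid_scheme \<Rightarrow> 'a set monoid"
  where "abelianization G = G Mod (derived G (carrier G))"

definition to_abelianization :: "('a, 'm) monoid_scheme \<Rightarrow> 'a \<Rightarrow> 'a set"
  where "to_abelianization G g = derived G (carrier G) #>\<^bsub>G\<^esub> g"

text \<open>For an abelian group \<open>A\<close> (written multiplicatively), the space
  \<open>\<Lambda>\<^sup>k(A \<otimes> \<rat>)\<close> is presented by the symbols
  \<open>a\<^sub>1 \<and> \<dots> \<and> a\<^sub>k\<close> with \<open>a\<^sub>j \<in> A\<close>, that is, the basis elements
  \<open>delta [a\<^sub>1, \<dots>, a\<^sub>k]\<close> of \<open>bar_chains A k\<close>, modulo the relations saying that the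
  symbols are additive in each entry and alternating.\<close>

definition ext_relations :: "('a, 'm) monoid_scheme \<Rightarrow> nat \<Rightarrow> ('a list \<Rightarrow> rat) set"
  where "ext_relations A k = qvs.span
    ({delta (us @ [a \<otimes>\<^bsub>A\<^esub> b] @ vs) - delta (us @ [a] @ vs) - delta (us @ [b] @ vs) | us a b vs.
        length us + 1 + length vs = k \<and> set us \<union> {a, b} \<union> set vs \<subseteq> carrier A}
     \<union> {delta (us @ [a] @ vs @ [a] @ ws) | us a vs ws.
        length us + 1 + length vs + 1 + length ws = k \<and>
        set us \<union> {a} \<union> set vs \<union> set ws \<subseteq> carrier A})"

definition ext_power_ab :: "('a, 'm) monoid_scheme \<Rightarrow> nat \<Rightarrow> ('a list \<Rightarrow> rat) set set"
  where "ext_power_ab A k = {c +o ext_relations A k | c. c \<in> bar_chains A k}"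

text \<open>The canonical isomorphism \<open>H\<^sub>k(A; \<rat>) \<cong> \<Lambda>\<^sup>k(A \<otimes> \<rat>)\<close> for abelian \<open>A\<close> is the
  inverse of the Pontryagin product map
  \<open>a\<^sub>1 \<and> \<dots> \<and> a\<^sub>k \<mapsto> [\<Sum>\<^sub>p sgn(p) [a\<^sub>p\<^sub>(\<^sub>1\<^sub>) | \<dots> | a\<^sub>p\<^sub>(\<^sub>k\<^sub>)]]\<close>.
  On chains this inverse is
  \<open>[a\<^sub>1 | \<dots> | a\<^sub>k] \<mapsto> (1 / k!) a\<^sub>1 \<and> \<dots> \<and> a\<^sub>k\<close>; it maps boundaries into
  \<open>ext_relations A k\<close>.\<close>

definition homology_to_ext ::
    "('a, 'm) monoid_scheme \<Rightarrow> nat \<Rightarrow> ('a list \<Rightarrow> rat) set \<Rightarrow> ('a list \<Rightarrow> rat) set"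
  where "homology_to_ext A k C = qscale (1 / fact k) ` C + ext_relations A k"

definition albanese_homology :: "('a, 'm) monoid_scheme \<Rightarrow> nat \<Rightarrow> ('a set list \<Rightarrow> rat) set set"
  where "albanese_homology G k =
    (\<lambda>C. homology_to_ext (abelianization G) k
           (grp_homology_map (abelianization G) (to_abelianization G) k C)) ` grp_homology G k"


section \<open>Free groups and the groups \<open>IA\<^sub>n\<close>\<close>

text \<open>Letters are pairs \<open>(k, s)\<close> standing for \<open>x\<^sub>k\<close> if \<open>s\<close> and for the inverse of
  \<open>x\<^sub>k\<close> otherwise; elements of \<open>F\<^sub>n\<close> are the reduced words in \<open>x\<^sub>0, \<dots>, x\<^sub>n\<^sub>-\<^sub>1\<close>.\<close>

type_synonym word = "(nat \<times> bool) list"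

fun reduced :: "word \<Rightarrow> bool"
  where
    "reduced ((k, s) # (l, t) # w) \<longleftrightarrow> \<not> (k = l \<and> s \<noteq> t) \<and> reduced ((l, t) # w)"
  | "reduced w \<longleftrightarrow> True"

fun red_cons :: "nat \<times> bool \<Rightarrow> word \<Rightarrow> word"
  where
    "red_cons (k, s) ((l, t) # w) = (if k = l \<and> s \<noteq> t then w else (k, s) # (l, t) # w)"
  | "red_cons (k, s) [] = [(k, s)]"

definition free_grp :: "nat \<Rightarrow> word monoid"
  where "free_grp n =
    \<lparr>carrier = {w. reduced w \<and> fst ` set w \<subseteq> {..<n}},
     monoid.mult = (\<lambda>u v. foldr red_cons u v),
     one = []\<rparr>"

definition free_gen :: "nat \<Rightarrow> word"
  where "free_gen k = [(k, True)]"

definition exp_sum :: "nat \<Rightarrow> word \<Rightarrow> int"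
  where "exp_sum k w = (\<Sum>(l, s)\<leftarrow>w. if l = k then (if s then 1 else -1) else 0)"

text \<open>The action of an endomorphism of \<open>F\<^sub>n\<close> on \<open>H\<^sub>1(F\<^sub>n, \<int>) = \<int>\<^sup>n\<close>, in the basis given by
  the free generators.\<close>

definition abel_mat :: "nat \<Rightarrow> (word \<Rightarrow> word) \<Rightarrow> int mat"
  where "abel_mat n f = mat n n (\<lambda>(k, l). exp_sum k (f (free_gen l)))"

definition GL_int :: "nat \<Rightarrow> int mat monoid"
  where "GL_int n = units_of (ring_mat TYPE(int) n ())"

definition IA :: "nat \<Rightarrow> (word \<Rightarrow> word) monoid"
  where "IA n = (AutoGroup (free_grp n))
    \<lparr>carrier := kernel (AutoGroup (free_grp n)) (GL_int n) (abel_mat n)\<rparr>"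


section \<open>The space \<open>U\<close> and the Johnson homomorphism\<close>

text \<open>\<open>H = H\<^sub>1(F\<^sub>n, \<rat>) = \<rat>\<^sup>n\<close> has the classes of the free generators as its basis, and
  \<open>H\<^sup>*\<close> is identified with \<open>\<rat>\<^sup>n\<close> through the dual basis; in both cases the \<open>k\<close>-th
  basis vector is \<open>delta k\<close> with \<open>k < n\<close>.\<close>

definition H_space :: "nat \<Rightarrow> (nat \<Rightarrow> rat) set"
  where "H_space n = qvs.span (delta ` {..<n})"

definition H_dual :: "nat \<Rightarrow> (nat \<Rightarrow> rat) set"
  where "H_dual n = qvs.span (delta ` {..<n})"

definition H_class :: "word \<Rightarrow> nat \<Rightarrow> rat"
  where "H_class w = (\<lambda>k. of_int (exp_sum k w))"

text \<open>\<open>U = Hom(H, \<Lambda>\<^sup>2 H)\<close> is taken in the form \<open>\<Lambda>\<^sup>2 H \<otimes> H\<^sup>*\<close>, and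
  \<open>H\<^sub>i(U, \<rat>)\<close> in the form \<open>\<Lambda>\<^sup>i U\<close>.\<close>

definition U_space :: "nat \<Rightarrow> (nat list \<times> nat \<Rightarrow> rat) set"
  where "U_space n = qvs.span {tensor \<omega> c | \<omega> c. \<omega> \<in> ext_power 2 (H_space n) \<and> c \<in> H_dual n}"

definition homology_U :: "nat \<Rightarrow> nat \<Rightarrow> ((nat list \<times> nat) list \<Rightarrow> rat) set"
  where "homology_U n i = ext_power i (U_space n)"

definition lcs2 :: "nat \<Rightarrow> word set"
  where "lcs2 n = derived (free_grp n) (carrier (free_grp n))"

definition lcs3 :: "nat \<Rightarrow> word set"
  where "lcs3 n = generate (free_grp n)
    {x \<otimes>\<^bsub>free_grp n\<^esub> y \<otimes>\<^bsub>free_grp n\<^esub> inv\<^bsub>free_grp n\<^esub> x \<otimes>\<^bsub>free_grp n\<^esub> inv\<^bsub>free_grp n\<^esub> y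
      | x y. x \<in> carrier (free_grp n) \<and> y \<in> lcs2 n}"

text \<open>The projection of the second term \<open>\<Gamma>\<^sub>2\<close> of the lower central series of \<open>F\<^sub>n\<close> onto
  \<open>\<Gamma>\<^sub>2 / \<Gamma>\<^sub>3\<close>, followed by the usual embedding of \<open>\<Gamma>\<^sub>2 / \<Gamma>\<^sub>3\<close> into
  \<open>\<Lambda>\<^sup>2 H\<close> as the lattice \<open>\<Lambda>\<^sup>2 H\<^sub>1(F\<^sub>n, \<int>)\<close>, under which the class of a commutator
  of \<open>x\<close> and \<open>y\<close> is \<open>[x] \<and> [y]\<close>.\<close>

definition gr2 :: "nat \<Rightarrow> word \<Rightarrow> nat list \<Rightarrow> rat"
  where "gr2 n = (THE \<phi>. \<phi> \<in> lcs2 n \<rightarrow>\<^sub>E ext_power 2 (H_space n) \<and>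
    (\<forall>u\<in>lcs2 n. \<forall>v\<in>lcs2 n. \<phi> (u \<otimes>\<^bsub>free_grp n\<^esub> v) = \<phi> u + \<phi> v) \<and>
    (\<forall>u\<in>lcs3 n. \<phi> u = 0) \<and>
    (\<forall>x\<in>carrier (free_grp n). \<forall>y\<in>carrier (free_grp n).
      \<phi> (x \<otimes>\<^bsub>free_grp n\<^esub> y \<otimes>\<^bsub>free_grp n\<^esub> inv\<^bsub>free_grp n\<^esub> x \<otimes>\<^bsub>free_grp n\<^esub> inv\<^bsub>free_grp n\<^esub> y)
        = wedge [H_class x, H_class y]))"

text \<open>The homomorphism \<open>[x] \<mapsto> x\<^sup>-\<^sup>1 f(x)\<close> in \<open>Hom(H, \<Lambda>\<^sup>2 H)\<close>, regarded as the
  element \<open>\<Sum>\<^sub>k (x\<^sub>k\<^sup>-\<^sup>1 f(x\<^sub>k)) \<otimes> e\<^sub>k\<^sup>*\<close> of \<open>\<Lambda>\<^sup>2 H \<otimes> H\<^sup>*\<close>.\<close>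

definition johnson :: "nat \<Rightarrow> (word \<Rightarrow> word) \<Rightarrow> nat list \<times> nat \<Rightarrow> rat"
  where "johnson n f = (\<Sum>k<n. tensor
    (gr2 n (inv\<^bsub>free_grp n\<^esub> (free_gen k) \<otimes>\<^bsub>free_grp n\<^esub> f (free_gen k))) (delta k))"

text \<open>The maps \<open>H\<^sub>1(IA\<^sub>n, \<int>) \<rightarrow> U\<close> and
  \<open>\<Lambda>\<^sup>i H\<^sub>1(IA\<^sub>n, \<rat>) \<rightarrow> \<Lambda>\<^sup>i U\<close> induced by \<open>johnson n\<close>, defined on cosets;
  \<open>johnson n\<close>, respectively the displayed map on chains, is constant on each coset.\<close>

definition johnson_ab :: "nat \<Rightarrow> (word \<Rightarrow> word) set \<Rightarrow> nat list \<times> nat \<Rightarrow> rat"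
  where "johnson_ab n X = the_elem (johnson n ` X)"

definition johnson_ext ::
    "nat \<Rightarrow> ((word \<Rightarrow> word) set list \<Rightarrow> rat) set \<Rightarrow> (nat list \<times> nat) list \<Rightarrow> rat"
  where "johnson_ext n C = the_elem (lin_ext (\<lambda>Xs. wedge (map (johnson_ab n) Xs)) ` C)"

text \<open>\<open>H\<^sup>A\<^sub>i(IA\<^sub>n, \<rat>)\<close> as a subspace of \<open>\<Lambda>\<^sup>i U\<close>\<close>

definition albanese_IA :: "nat \<Rightarrow> nat \<Rightarrow> ((nat list \<times> nat) list \<Rightarrow> rat) set"
  where "albanese_IA n i = johnson_ext n ` albanese_homology (IA n) i"


section \<open>The traceless part\<close>

text \<open>\<open>H\<^sup>\<otimes>\<^sup>p \<otimes> (H\<^sup>*)\<^sup>\<otimes>\<^sup>q\<close>, in coordinates: the value at \<open>(I, J)\<close> is the coefficient of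
  \<open>e\<^bsub>I ! 0\<^esub> \<otimes> \<dots> \<otimes> e\<^bsub>I ! (p - 1)\<^esub> \<otimes> e\<^sup>*\<^bsub>J ! 0\<^esub> \<otimes> \<dots> \<otimes> e\<^sup>*\<^bsub>J ! (q - 1)\<^esub>\<close>.\<close>

definition mixed_tensors :: "nat \<Rightarrow> nat \<Rightarrow> nat \<Rightarrow> (nat list \<times> nat list \<Rightarrow> rat) set"
  where "mixed_tensors n p q = qvs.span
    {delta (I, J) | I J. length I = p \<and> length J = q \<and> set I \<subseteq> {..<n} \<and> set J \<subseteq> {..<n}}"

text \<open>Contraction of the \<open>k\<close>-th factor \<open>H\<close> with the \<open>l\<close>-th factor \<open>H\<^sup>*\<close>, counting from 0.\<close>

definition contraction ::
    "nat \<Rightarrow> nat \<Rightarrow> nat \<Rightarrow> (nat list \<times> nat list \<Rightarrow> rat) \<Rightarrow> nat list \<times> nat list \<Rightarrow> rat"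
  where "contraction n k l t =
    (\<lambda>(I, J). \<Sum>m<n. t (take k I @ m # drop k I, take l J @ m # drop l J))"

definition traceless_tensors :: "nat \<Rightarrow> nat \<Rightarrow> nat \<Rightarrow> (nat list \<times> nat list \<Rightarrow> rat) set"
  where "traceless_tensors n p q =
    {t \<in> mixed_tensors n p q. \<forall>k<p. \<forall>l<q. contraction n k l t = 0}"

definition tensors_to_ext :: "nat \<Rightarrow> (nat list \<times> nat list \<Rightarrow> rat) \<Rightarrow> (nat list \<times> nat) list \<Rightarrow> rat"
  where "tensors_to_ext i = lin_ext (\<lambda>(I, J). wedge (map (\<lambda>j.
    tensor (wedge [delta (I ! (2 * j)), delta (I ! (2 * j + 1))]) (delta (J ! j))) [0..<i]))"

definition traceless_U :: "nat \<Rightarrow> nat \<Rightarrow> ((nat list \<times> nat) list \<Rightarrow> rat) set"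
  where "traceless_U n i = tensors_to_ext i ` traceless_tensors n (2 * i) i"

lemma mixed_tensors_support:
  assumes "t \<in> mixed_tensors n p q" and "t (I, J) \<noteq> 0"
  shows "length I = p \<and> length J = q \<and> set I \<subseteq> {..<n} \<and> set J \<subseteq> {..<n}"
proof -
  let ?S = "{t :: nat list \<times> nat list \<Rightarrow> rat. \<forall>I J. t (I, J) \<noteq> 0 \<longrightarrow>
    length I = p \<and> length J = q \<and> set I \<subseteq> {..<n} \<and> set J \<subseteq> {..<n}}"
  have "qvs.subspace ?S"
    unfolding qvs.subspace_def
  proof (intro conjI ballI allI)
    fix s u assume su: "s \<in> ?S" "u \<in> ?S"
    have "s (I, J) \<noteq> 0 \<or> u (I, J) \<noteq> 0" if "(s + u) (I, J) \<noteq> 0" for I J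
      using that by auto
    with su show "s + u \<in> ?S" by blast
  qed (simp_all add: qscale_def, blast)
  moreover have "{delta (I, J) | I J. length I = p \<and> length J = q \<and> set I \<subseteq> {..<n} \<and> set J \<subseteq> {..<n}} \<subseteq> ?S"
    by (auto simp: delta_def split: if_splits)
  ultimately have "mixed_tensors n p q \<subseteq> ?S"
    unfolding mixed_tensors_def by (intro qvs.span_minimal)
  with assms show ?thesis by blast
qed

lemma traceless_U_subset: "traceless_U n i \<subseteq> homology_U n i"
proof -
  have basis: "tensor (wedge [delta a, delta b]) (delta c) \<in> U_space n"
    if "a < n" "b < n" "c < n" for a b c
  proof -
    have "delta a \<in> H_space n" "delta b \<in> H_space n" "delta c \<in> H_dual n"
      using that by (auto simp: H_space_def H_dual_def intro: qvs.span_base)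
    then have "wedge [delta a, delta b] \<in> ext_power 2 (H_space n)"
      unfolding ext_power_def by (intro qvs.span_base CollectI exI[of _ "[delta a, delta b]"]) auto
    then show ?thesis
      using \<open>delta c \<in> H_dual n\<close> unfolding U_space_def by (blast intro: qvs.span_base)
  qed
  have "tensors_to_ext i t \<in> homology_U n i" if t: "t \<in> mixed_tensors n (2 * i) i" for t
    unfolding tensors_to_ext_def lin_ext_def homology_U_def ext_power_def
  proof (intro qvs.span_sum qvs.span_scale, clarsimp)
    fix I J assume "t (I, J) \<noteq> 0"
    from mixed_tensors_support[OF t this]
    have IJ: "length I = 2 * i" "length J = i" "set I \<subseteq> {..<n}" "set J \<subseteq> {..<n}" by auto
    have "I ! (2 * j) < n" "I ! (2 * j + 1) < n" "J ! j < n" if "j < i" for j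
    proof -
      have "2 * j < length I" "2 * j + 1 < length I" "j < length J" using that IJ by auto
      then show "I ! (2 * j) < n" "I ! (2 * j + 1) < n" "J ! j < n"
        using IJ nth_mem by blast+
    qed
    then show "wedge (map (\<lambda>j. tensor (wedge [delta (I ! (2 * j)), delta (I ! Suc (2 * j))]) (delta (J ! j))) [0..<i])
      \<in> qvs.span {wedge vs |vs. length vs = i \<and> set vs \<subseteq> U_space n}"
      using basis by (intro qvs.span_base CollectI exI conjI[rotated] refl) auto
  qed
  then show ?thesis
    by (auto simp: traceless_U_def traceless_tensors_def)
qed

end

(* A traceless tensor of type (2i, i) with n >= 3i is a combination of decomposable tensors
   v_1 ... v_2i xi_1 ... xi_i, where the v_k are members of some basis of H coming from an
   automorphism g of F_n, the xi_l are members of the dual basis, and the two index sets are disjoint.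
   Such a tensor is the image of an abelian cycle: the conjugates by g of the automorphisms
   x_c -> x_c [x_a, x_b] commute because the c's are distinct from each other and from all a's and b's,
   and the Johnson homomorphism sends them to (v_a /\ v_b) (x) xi_c. For the spanning statement, the
   orthogonal complement of these decomposable tensors inside the traceless ones is a gl_n-module;
   it vanishes by descending induction on the weight, where the trace condition at a matched pair of
   indices expresses n times a coefficient through at most 3i - 2 coefficients of the same weight. *)
theory Submission
  imports Defs
begin

section \<open>Traceless tensors\<close>

text \<open>Automorphisms of F_n supply only integral changes of basis, so the set of decomposable
  tensors is visibly stable under integral elementary matrices, not under gl_n. The pairing of a
  tensor with the curve 1 + s E applied to a decomposable one is a polynomial in s; if it vanishes
  at every natural s, so does its derivative at 0. This is how the orthogonal complement acquires
  the operators of gl_n. Orthogonality refers to the standard form on coefficients, positive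
  definite over the rationals, so a zero complement means that the decomposable tensors span.

  Besides the count against the trace condition, the bound n >= 3i provides room: an index list of
  length 3i with a repeated entry misses some value below n, to which one of the equal indices can
  be moved.

  On the group side, the projection onto the second graded piece is a definite description; the
  degree two part of the Magnus expansion is the explicit function that satisfies it.\<close>

lemma sum_pointwise: "(\<Sum>x\<in>A. f x) y = (\<Sum>x\<in>A. f x y)"
  by (induction A rule: infinite_finite_induct) auto

section \<open>Index lists, the operators of gl_n on coefficients, and heights\<close>

definition index_lists :: "nat \<Rightarrow> nat \<Rightarrow> nat list set"
  where "index_lists n N = {K. length K = N \<and> set K \<subseteq> {..<n}}"

lemma finite_index_lists: "finite (index_lists n N)"
  unfolding index_lists_def using finite_lists_length_eq[of "{..<n}" N] by (simp add: conj_commute)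

lemma index_lists_update: "K \<in> index_lists n N \<Longrightarrow> m < n \<Longrightarrow> K[k := m] \<in> index_lists n N"
  unfolding index_lists_def using set_update_subset_insert[of K k m] by auto

lemma index_lists_nth: "K \<in> index_lists n N \<Longrightarrow> k < N \<Longrightarrow> K ! k < n"
  unfolding index_lists_def using nth_mem by blast

lemma index_lists_fresh:
  assumes "K \<in> index_lists n N" "N \<le> n" "\<not> distinct K"
  obtains m where "m < n" "m \<notin> set K"
proof -
  have "card (set K) < N"
    using assms card_length[of K] card_distinct[of K] unfolding index_lists_def by fastforce
  then have "\<not> {..<n} \<subseteq> set K"
    using card_mono[of "set K" "{..<n}"] assms(2) by auto
  then show thesis using that by auto
qed

text \<open>Mixed tensors are functions of a single index list, whose first \<open>p\<close> entries belong to the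
  factors \<open>H\<close> and the remaining ones to the factors \<open>H\<^sup>*\<close>. The operator \<open>lie p a b\<close> is the action of
  the matrix unit \<open>E\<^bsub>ab\<^esub>\<close> of \<open>gl\<^sub>n\<close>.\<close>

definition lie :: "nat \<Rightarrow> nat \<Rightarrow> nat \<Rightarrow> (nat list \<Rightarrow> rat) \<Rightarrow> nat list \<Rightarrow> rat"
  where "lie p a b t K = (\<Sum>k<length K.
    if k < p then (if K ! k = a then t (K[k := b]) else 0)
    else (if K ! k = b then - t (K[k := a]) else 0))"

text \<open>The weight of the basis tensor at \<open>K\<close>, paired with the diagonal matrix with
  entries 0, ..., n - 1; dual factors count negatively. Giving one new value to both members of a
  matched pair therefore leaves the height unchanged.\<close>

definition height :: "nat \<Rightarrow> nat list \<Rightarrow> int"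
  where "height p K = (\<Sum>k<length K. if k < p then int (K ! k) else - int (K ! k))"

lemma height_update:
  assumes "k < length K"
  shows "height p (K[k := m]) = height p K + (if k < p then int m - int (K ! k) else int (K ! k) - int m)"
proof -
  have "height p (K[k := m]) - height p K
      = (\<Sum>j<length K. if j = k then (if k < p then int m - int (K ! k) else int (K ! k) - int m) else 0)"
    unfolding height_def length_list_update sum_subtractf[symmetric]
    by (rule sum.cong) (auto simp: nth_list_update)
  also have "\<dots> = (if k < p then int m - int (K ! k) else int (K ! k) - int m)"
    using assms by (subst sum.delta) auto
  finally show ?thesis by simp
qed

text \<open>The ceiling for the descending induction in \<open>vanish\<close>.\<close>

lemma height_le: 
  assumes "K \<in> index_lists n N"
  shows "height p K \<le> int n * int N"
proof -
  have "height p K \<le> (\<Sum>k<length K. int n)"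
    unfolding height_def
  proof (rule sum_mono)
    fix k assume "k \<in> {..<length K}"
    then have "K ! k < n" using assms index_lists_nth[of K n N k] by (auto simp: index_lists_def)
    then show "(if k < p then int (K ! k) else - int (K ! k)) \<le> int n" by auto
  qed
  also have "\<dots> = int n * int N" using assms by (simp add: index_lists_def)
  finally show ?thesis .
qed

section \<open>Vanishing of a gl_n-stable space of traceless tensors\<close>

text \<open>Meant for the orthogonal complement of the decomposable tensors inside the traceless
  ones; \<open>vanish_distinct\<close> then records orthogonality to the products of standard basis
  vectors.\<close>

locale traceless_module =
  fixes n p q :: nat and X :: "(nat list \<Rightarrow> rat) set"
  assumes dim: "p + q \<le> n"
    and lie_closed: "\<And>t a b. \<lbrakk>t \<in> X; a < n; b < n; a \<noteq> b\<rbrakk> \<Longrightarrow> lie p a b t \<in> X"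
    and traceless: "\<And>t K k l. \<lbrakk>t \<in> X; K \<in> index_lists n (p + q); k < p; p \<le> l; l < p + q\<rbrakk>
      \<Longrightarrow> (\<Sum>m<n. t (K[k := m, l := m])) = 0"
    and vanish_distinct: "\<And>t K. \<lbrakk>t \<in> X; K \<in> index_lists n (p + q); distinct (drop p K);
      set (take p K) \<inter> set (drop p K) = {}\<rbrakk> \<Longrightarrow> t K = 0"
begin

lemma vanish_disjoint:
  assumes "t \<in> X" "K \<in> index_lists n (p + q)" "set (take p K) \<inter> set (drop p K) = {}"
  shows "t K = 0"
  using assms
proof (induction "p + q - card (set K)" arbitrary: t K rule: less_induct)
  case less
  note K = less.prems(2)
  have len: "length K = p + q" using K by (simp add: index_lists_def)
  show ?case
  proof (cases "distinct (drop p K)")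
    case True
    then show ?thesis using vanish_distinct less.prems by blast
  next
    case False
    then obtain i j where ij: "i < q" "j < q" "i \<noteq> j" "K ! (p + i) = K ! (p + j)"
      using len by (auto simp: distinct_conv_nth)
    let ?l = "p + i" and ?c = "K ! (p + i)"
    have nd: "\<not> distinct K" using False distinct_drop by blast
    obtain m where m: "m < n" "m \<notin> set K" using index_lists_fresh[OF K dim nd] by blast
    let ?K = "K[?l := m]"
    have c: "?c < n" using index_lists_nth[OF K] ij by simp
    have cm: "?c \<noteq> m" using m ij len by (metis nat_add_left_cancel_less nth_mem)
    have cin: "?c \<in> set (drop p K)" using ij len by (metis add_diff_cancel_left' in_set_conv_nth le_add1 length_drop nth_drop len)
    have cI: "K ! k \<noteq> ?c" if "k < p" for k
    proof -
      have "K ! k \<in> set (take p K)" using that len by (auto simp: in_set_conv_nth intro!: exI[of _ k])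
      then show ?thesis using cin less.prems(3) by auto
    qed
    have KK: "?K \<in> index_lists n (p + q)" using index_lists_update[OF K m(1)] .
    \<comment> \<open>The other occurrence of \<open>?c\<close>, at \<open>p + j\<close>, survives
      the update, so no old value is lost.\<close>
    have set': "set ?K = insert m (set K)"
    proof -
      have "K ! (p + j) \<in> set ?K" using ij len nth_mem[of "p+j" ?K] by simp
      then have "?c \<in> set ?K" using ij by simp
      moreover have "set K \<subseteq> insert ?c (set ?K)"
        using set_update_subset_insert[of ?K ?l ?c] by simp
      ultimately have "set K \<subseteq> set ?K" by auto
      moreover have "m \<in> set ?K" using ij len by (simp add: set_update_memI)
      ultimately show ?thesis using set_update_subset_insert[of K ?l m] by auto
    qed
    have card: "card (set ?K) = Suc (card (set K))" using set' m by simp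
    moreover have "card (set ?K) \<le> p + q" using card_length[of ?K] len by simp
    ultimately have dec: "p + q - card (set ?K) < p + q - card (set K)" by linarith
    have tk: "take p ?K = take p K" by simp
    have "set (drop p ?K) \<subseteq> insert m (set (drop p K))"
      by (simp add: drop_update_swap set_update_subset_insert)
    moreover have "m \<notin> set (take p K)" using m by (meson in_set_takeD)
    ultimately have disj: "set (take p ?K) \<inter> set (drop p ?K) = {}" using less.prems(3) tk by auto
    have "lie p ?c m t ?K = 0"
      using less.hyps[OF dec lie_closed[OF less.prems(1) c m(1) cm] KK disj] .
    moreover have "lie p ?c m t ?K = (\<Sum>k<p + q. if k = ?l then - t K else 0)"
      unfolding lie_def using len
    proof (intro sum.cong)
      fix k assume k: "k \<in> {..<p+q}"
      have "K ! k \<noteq> m" using k m len by (metis lessThan_iff nth_mem)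
      moreover have "K[?l := ?c] = K" by (rule list_update_id)
      ultimately show "(if k < p then if ?K ! k = ?c then t (?K[k := m]) else 0 else if ?K ! k = m then - t (?K[k := ?c]) else 0)
        = (if k = ?l then - t K else 0)"
        using k cI[of k] ij len by (auto simp: nth_list_update)
    qed simp
    ultimately show ?thesis using ij by (simp add: sum.delta)
  qed
qed

text \<open>With a single occurrence of \<open>c\<close> in each block, moving one member of the
  pair leaves exactly one place where the action can move its partner.\<close>

definition simply_matched :: "nat \<Rightarrow> nat list \<Rightarrow> bool"
  where "simply_matched c K \<longleftrightarrow> (\<exists>k l. k < p \<and> p \<le> l \<and> l < p + q \<and>
    (\<forall>j<p+q. K ! j = c \<longleftrightarrow> j = k \<or> j = l))"

text \<open>Moving one member of the pair to \<open>m\<close>, in the direction that raises the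
  height, gives a list at which E_mc t or E_cm t vanishes by \<open>IH\<close>. This expresses the
  coefficient with both members moved to \<open>m\<close> as t K plus error terms. Summing over
  \<open>m\<close> turns the trace condition into a bound on n times t K.\<close>

lemma vanish_step_matched:
  assumes IH: "\<And>t K. \<lbrakk>t \<in> X; K \<in> index_lists n (p + q); height p K > v\<rbrakk> \<Longrightarrow> t K = 0"
    and t: "t \<in> X" and K0: "K0 \<in> index_lists n (p + q)" "height p K0 = v" "simply_matched c K0"
  shows "t K0 = 0"
proof -
  let ?S = "{K \<in> index_lists n (p + q). height p K = v \<and> simply_matched c K}"
  have fin: "finite ?S" using finite_index_lists by simp
  \<comment> \<open>The error terms are coefficients at other lists of \<open>?S\<close>, so a
    single coefficient cannot be bounded alone; the one of largest absolute value can.\<close>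
  define M where "M = Max ((\<lambda>K. \<bar>t K\<bar>) ` ?S)"
  have le: "\<bar>t K\<bar> \<le> M" if "K \<in> ?S" for K unfolding M_def using fin that by (intro Max_ge) auto
  have "M \<in> (\<lambda>K. \<bar>t K\<bar>) ` ?S" unfolding M_def using fin K0 by (intro Max_in) auto
  then obtain K where KS: "K \<in> ?S" and KM: "\<bar>t K\<bar> = M" by auto
  have K: "K \<in> index_lists n (p + q)" and hK: "height p K = v" using KS by auto
  have len: "length K = p + q" using K by (simp add: index_lists_def)
  obtain k l where kl: "k < p" "p \<le> l" "l < p + q"
    and occ: "\<And>j. j < p + q \<Longrightarrow> K ! j = c \<longleftrightarrow> j = k \<or> j = l"
    using KS unfolding simply_matched_def by auto
  have Kk: "K ! k = c" "K ! l = c" using occ kl by auto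
  have c: "c < n" using index_lists_nth[OF K, of k] kl Kk by simp
  \<comment> \<open>Error terms: another entry equal to \<open>m\<close>, in the same block as the
    member that was moved, trades places with \<open>c\<close>. For \<open>m = c\<close> there are
    none.\<close>
  define w where "w m j = (if m > c \<and> j < p \<and> K ! j = m then t (K[k := m, j := c])
      else if m < c \<and> p \<le> j \<and> K ! j = m then t (K[l := m, j := c]) else 0)" for m j
  have swap: "t (K[k := m, l := m]) = t K + (\<Sum>j<p + q. w m j)" if m: "m < n" for m
  proof (cases m c rule: linorder_cases)
    case equal
    then have "K[k := m, l := m] = K" using Kk by (metis list_update_id)
    then show ?thesis using equal by (simp add: w_def)
  next
    case greater
    let ?K = "K[k := m]"
    have KK: "?K \<in> index_lists n (p + q)" using index_lists_update[OF K m] .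
    have "height p ?K > v" using height_update[of k K p m] len kl hK Kk greater by simp
    then have "0 = lie p m c t ?K" using IH[OF lie_closed[OF t m c] KK] greater by simp
    also have "\<dots> = (\<Sum>j<p + q. (if j = k then t K else 0) - (if j = l then t (K[k := m, l := m]) else 0) + w m j)"
      unfolding lie_def using len
    proof (intro sum.cong)
      fix j assume j: "j \<in> {..<p+q}"
      have ne: "K ! j = m \<Longrightarrow> j \<noteq> k \<and> j \<noteq> l" using Kk greater by auto
      have id: "K[k := c] = K" using Kk by (metis list_update_id)
      show "(if j < p then if ?K ! j = m then t (?K[j := c]) else 0 else if ?K ! j = c then - t (?K[j := m]) else 0)
        = (if j = k then t K else 0) - (if j = l then t (K[k := m, l := m]) else 0) + w m j"
        using j occ[of j] kl len ne greater id unfolding w_def by (auto simp: nth_list_update)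
    qed simp
    also have "\<dots> = t K - t (K[k := m, l := m]) + (\<Sum>j<p + q. w m j)"
      using kl by (simp add: sum.distrib sum_subtractf sum.delta)
    finally show ?thesis by simp
  next
    case less
    let ?K = "K[l := m]"
    have KK: "?K \<in> index_lists n (p + q)" using index_lists_update[OF K m] .
    have "height p ?K > v" using height_update[of l K p m] len kl hK Kk less by simp
    then have "0 = lie p c m t ?K" using IH[OF lie_closed[OF t c m] KK] less by simp
    also have "\<dots> = (\<Sum>j<p + q. (if j = k then t (K[k := m, l := m]) else 0) - (if j = l then t K else 0) - w m j)"
      unfolding lie_def using len
    proof (intro sum.cong)
      fix j assume j: "j \<in> {..<p+q}"
      have ne: "K ! j = m \<Longrightarrow> j \<noteq> k \<and> j \<noteq> l" using Kk less by auto
      have id: "K[l := c] = K" using Kk by (metis list_update_id)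
      have sw: "K[l := m, k := m] = K[k := m, l := m]" using kl by (simp add: list_update_swap)
      show "(if j < p then if ?K ! j = c then t (?K[j := m]) else 0 else if ?K ! j = m then - t (?K[j := c]) else 0)
        = (if j = k then t (K[k := m, l := m]) else 0) - (if j = l then t K else 0) - w m j"
        using j occ[of j] kl len ne less id sw unfolding w_def by (auto simp: nth_list_update)
    qed simp
    also have "\<dots> = t (K[k := m, l := m]) - t K - (\<Sum>j<p + q. w m j)"
      using kl by (simp add: sum.distrib sum_subtractf sum.delta)
    finally show ?thesis by simp
  qed
  \<comment> \<open>Trading two entries of one block preserves the height and keeps \<open>c\<close>
    simply matched, so the list stays in \<open>?S\<close>. The positions \<open>k\<close> and
    \<open>l\<close> hold \<open>c\<close> itself and have no error term, whence the 2 in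
    \<open>p + q - 2\<close>.\<close>
  have bound: "\<bar>w (K ! j) j\<bar> \<le> (if j = k \<or> j = l then 0 else M)" if j: "j < p + q" for j
  proof (cases "j = k \<or> j = l")
    case True
    then show ?thesis using Kk by (auto simp: w_def)
  next
    case False
    have Kjn: "K ! j < n" using index_lists_nth[OF K j] .
    have M0: "0 \<le> M" using KM by (metis abs_ge_zero)
    have inS: "K[i := K ! j, j := c] \<in> ?S" if i: "i = k \<and> j < p \<or> i = l \<and> p \<le> j" for i
    proof -
      have ij: "i \<noteq> j" "i < p + q" using i kl False by auto
      have "height p (K[i := K ! j, j := c]) = v"
        using height_update[of i K p "K ! j"] height_update[of j "K[i := K ! j]" p c] len kl j hK ij i Kk
        by auto
      moreover have "simply_matched c (K[i := K ! j, j := c])"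
        unfolding simply_matched_def
      proof (intro exI conjI allI impI)
        show "(if i = k then j else k) < p" "p \<le> (if i = k then l else j)" "(if i = k then l else j) < p + q"
          using i kl j by auto
        fix j' assume "j' < p + q"
        then show "(K[i := K ! j, j := c] ! j' = c) = (j' = (if i = k then j else k) \<or> j' = (if i = k then l else j))"
          using occ[of j'] occ[of j] i j len ij False kl by (auto simp: nth_list_update)
      qed
      ultimately show ?thesis using index_lists_update[OF index_lists_update[OF K Kjn] c] by simp
    qed
    show ?thesis using False le[OF inS[of k]] le[OF inS[of l]] M0 unfolding w_def by auto
  qed
  have "0 = (\<Sum>m<n. t (K[k := m, l := m]))" using traceless[OF t K kl] by simp
  also have "\<dots> = (\<Sum>m<n. t K + (\<Sum>j<p + q. w m j))" by (rule sum.cong) (use swap in auto)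
  also have "\<dots> = of_nat n * t K + (\<Sum>m<n. \<Sum>j<p + q. w m j)" by (simp add: sum.distrib)
  also have "(\<Sum>m<n. \<Sum>j<p + q. w m j) = (\<Sum>j<p + q. \<Sum>m<n. w m j)" by (rule sum.swap)
  \<comment> \<open>For fixed \<open>j\<close> only \<open>m = K ! j\<close> contributes, so each
    position accounts for at most one error term.\<close>
  also have "\<dots> = (\<Sum>j<p + q. w (K ! j) j)"
  proof (rule sum.cong)
    fix j assume j: "j \<in> {..<p + q}"
    have "(\<Sum>m<n. w m j) = (\<Sum>m<n. if m = K ! j then w (K ! j) j else 0)"
      by (rule sum.cong) (auto simp: w_def)
    then show "(\<Sum>m<n. w m j) = w (K ! j) j"
      using index_lists_nth[OF K] j by simp
  qed simp
  finally have eq: "of_nat n * t K = - (\<Sum>j<p + q. w (K ! j) j)" by simp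
  have "of_nat n * M = \<bar>of_nat n * t K\<bar>" using KM by (simp add: abs_mult)
  also have "\<dots> = \<bar>\<Sum>j<p + q. w (K ! j) j\<bar>" using eq by simp
  also have "\<dots> \<le> (\<Sum>j<p + q. \<bar>w (K ! j) j\<bar>)" by (rule sum_abs)
  also have "\<dots> \<le> (\<Sum>j<p + q. if j = k \<or> j = l then 0 else M)"
    by (rule sum_mono) (use bound in auto)
  also have "\<dots> = (\<Sum>j\<in>{..<p + q} - {k, l}. M)"
    by (rule sum.mono_neutral_cong_right) auto
  also have "\<dots> = of_nat (p + q - 2) * M"
    using kl by (subst sum_constant, subst card_Diff_subset) (auto simp: numeral_2_eq_2)
  finally have "of_nat n * M \<le> of_nat (p + q - 2) * M" .
  moreover have "p + q - 2 < n" using dim kl by linarith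
  ultimately have "M \<le> 0"
    by (meson linorder_not_less mult_less_cancel_right_pos of_nat_less_iff)
  then show ?thesis using le[of K0] K0 by simp
qed

lemma vanish:
  assumes "t \<in> X" "K \<in> index_lists n (p + q)"
  shows "t K = 0"
  using assms
proof (induction "nat (int n * int (p + q) - height p K)" arbitrary: t K rule: less_induct)
  case less
  note t = less.prems(1) and K = less.prems(2)
  have len: "length K = p + q" using K by (simp add: index_lists_def)
  let ?v = "height p K"
  have IH: "t' K' = 0" if "t' \<in> X" "K' \<in> index_lists n (p + q)" "height p K' > ?v" for t' K'
  proof -
    have "nat (int n * int (p + q) - height p K') < nat (int n * int (p + q) - height p K)"
      using that height_le[OF that(2), of p] by linarith
    then show ?thesis using less.hyps[OF _ that(1,2)] by blast
  qed
  show ?case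
  proof (cases "set (take p K) \<inter> set (drop p K) = {}")
    case True
    then show ?thesis using vanish_disjoint t K by blast
  next
    case False
    then obtain k i where ki: "k < p" "i < q" "K ! k = K ! (p + i)"
      using len by (auto simp: in_set_conv_nth disjoint_iff)
    define l where "l = p + i"
    define c where "c = K ! k"
    have kl: "k < p" "p \<le> l" "l < p + q" "K ! k = c" "K ! l = c" using ki by (auto simp: l_def c_def)
    have "\<not> distinct K" using kl len nth_eq_iff_index_eq[of K k l] by auto
    then obtain m where m: "m < n" "m \<notin> set K" using index_lists_fresh[OF K dim] by blast
    have c: "c < n" using index_lists_nth[OF K, of k] kl by simp
    have mj: "K ! j \<noteq> m" if "j < p + q" for j using m that len by (metis nth_mem)
    have cm: "m \<noteq> c" using mj[of k] kl by simp
    have zero: "t (K[k' := m, l' := m]) = 0"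
      if "k' < p" "p \<le> l'" "l' < p + q" "K ! k' = c" "K ! l' = c" for k' l'
    proof (rule vanish_step_matched[where v = ?v and c = m])
      show "t' K' = 0" if "t' \<in> X" "K' \<in> index_lists n (p + q)" "?v < height p K'" for t' K'
        using IH that by blast
      show "t \<in> X" by fact
      show "K[k' := m, l' := m] \<in> index_lists n (p + q)" using index_lists_update K m by blast
      show "height p (K[k' := m, l' := m]) = ?v"
        using height_update[of k' K p m] height_update[of l' "K[k' := m]" p m] that len by simp
      show "simply_matched m (K[k' := m, l' := m])"
        unfolding simply_matched_def using that mj len
        by (intro exI[of _ k'] exI[of _ l']) (auto simp: nth_list_update)
    qed
    show ?thesis
    \<comment> \<open>The member to be moved is the one for which \<open>m\<close> raises the
      height.\<close>
    proof (cases "m > c")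
      case True
      let ?K = "K[k := m]"
      have "height p ?K > ?v" using height_update[of k K p m] len kl True by simp
      then have "0 = lie p m c t ?K"
        using IH[OF lie_closed[OF t m(1) c cm] index_lists_update[OF K m(1)]] by simp
      also have "\<dots> = (\<Sum>j<p + q. if j = k then t K else 0)"
        unfolding lie_def using len
      proof (intro sum.cong)
        fix j assume j: "j \<in> {..<p+q}"
        have id: "K[k := c] = K" using kl by (metis list_update_id)
        show "(if j < p then if ?K ! j = m then t (?K[j := c]) else 0 else if ?K ! j = c then - t (?K[j := m]) else 0)
          = (if j = k then t K else 0)"
          using j mj[of j] kl len id zero[of k j] by (auto simp: nth_list_update)
      qed simp
      finally show ?thesis using kl by simp
    next
      case False
      let ?K = "K[l := m]"
      have "height p ?K > ?v" using height_update[of l K p m] len kl False cm by simp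
      then have "0 = lie p c m t ?K"
        using IH[OF lie_closed[OF t c m(1)] index_lists_update[OF K m(1)]] cm by simp
      also have "\<dots> = (\<Sum>j<p + q. if j = l then - t K else 0)"
        unfolding lie_def using len
      proof (intro sum.cong)
        fix j assume j: "j \<in> {..<p+q}"
        have id: "K[l := c] = K" using kl by (metis list_update_id)
        have "j < p \<Longrightarrow> K[l := m, j := m] = K[j := m, l := m]" using kl by (simp add: list_update_swap)
        then show "(if j < p then if ?K ! j = c then t (?K[j := m]) else 0 else if ?K ! j = m then - t (?K[j := c]) else 0)
          = (if j = l then - t K else 0)"
          using j mj[of j] kl len id zero[of j l] by (auto simp: nth_list_update)
      qed simp
      finally show ?thesis using kl by simp
    qed
  qed
qed

end


section \<open>Orthogonal projection and the spanning theorem for decomposable tensors\<close>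

definition decomposable :: "nat \<Rightarrow> (nat \<Rightarrow> rat) list \<Rightarrow> nat list \<Rightarrow> rat"
  where "decomposable n vs K =
    (if K \<in> index_lists n (length vs) then \<Prod>k<length vs. (vs ! k) (K ! k) else 0)"

text \<open>Gram-Schmidt without normalisation: \<open>b - u\<close>, the part of the new vector
  orthogonal to the old ones, corrects the projection already found.\<close>

lemma orthogonal_projection:
  fixes t :: "'a \<Rightarrow> rat"
  assumes "finite B"
  shows "\<exists>w\<in>qvs.span B. \<forall>b\<in>B. (\<Sum>x\<in>S. b x * (t x - w x)) = 0"
  using assms
proof (induction B arbitrary: t rule: finite_induct)
  case empty
  show ?case by (auto intro: qvs.span_zero)
next
  case (insert b B)
  let ?ip = "\<lambda>f g :: 'a \<Rightarrow> rat. \<Sum>x\<in>S. f x * g x"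
  obtain w where w: "w \<in> qvs.span B" "\<And>b'. b' \<in> B \<Longrightarrow> ?ip b' (\<lambda>x. t x - w x) = 0"
    using insert.IH[of t] by auto
  obtain u where u: "u \<in> qvs.span B" "\<And>b'. b' \<in> B \<Longrightarrow> ?ip b' (\<lambda>x. b x - u x) = 0"
    using insert.IH[of b] by auto
  have ortho: "?ip v y = 0" if v: "v \<in> qvs.span B" and y: "\<And>b'. b' \<in> B \<Longrightarrow> ?ip b' y = 0" for v y
    using v
  proof (induction rule: qvs.span_induct_alt)
    case base
    show ?case by simp
  next
    case (step c x z)
    have "?ip (qscale c x + z) y = c * ?ip x y + ?ip z y"
      by (simp add: qscale_def distrib_right sum.distrib sum_distrib_left mult.assoc)
    then show ?case using step y by simp
  qed
  define b' where "b' = (\<lambda>x. b x - u x)"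
  define r where "r = ?ip b' (\<lambda>x. t x - w x) / ?ip b' b'"
  let ?w = "w + qscale r (b - u)"
  have diff: "t x - ?w x = (t x - w x) - r * b' x" for x by (simp add: qscale_def b'_def)
  have ip_diff: "?ip y (\<lambda>x. t x - ?w x) = ?ip y (\<lambda>x. t x - w x) - r * ?ip y b'" for y
    unfolding diff by (simp add: right_diff_distrib sum_subtractf sum_distrib_left mult.left_commute)
  \<comment> \<open>If \<open>b'\<close> has norm zero, then \<open>r\<close> is 0 by division by
    zero; this is the right value because positivity makes \<open>b'\<close> vanish on a finite
    \<open>S\<close>.\<close>
  have zero: "?ip b' b' = 0 \<Longrightarrow> ?ip b' (\<lambda>x. t x - w x) = 0"
  proof (cases "finite S")
    case True
    assume "?ip b' b' = 0"
    then have "\<forall>x\<in>S. b' x * b' x = 0" using True by (subst (asm) sum_nonneg_eq_0_iff) auto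
    then show ?thesis by (intro sum.neutral) auto
  qed simp
  have B': "?ip x (\<lambda>x. t x - ?w x) = 0" if "x \<in> B" for x
    using ip_diff[of x] w(2)[OF that] u(2)[OF that] by (simp add: b'_def)
  have "?ip b' (\<lambda>x. t x - ?w x) = 0"
    using ip_diff[of b'] zero by (auto simp: r_def)
  moreover have "?ip u (\<lambda>x. t x - ?w x) = 0" using ortho[OF u(1) B'] by blast
  moreover have "?ip b y = ?ip b' y + ?ip u y" for y
    unfolding sum.distrib[symmetric] by (rule sum.cong) (auto simp: b'_def algebra_simps)
  ultimately have "?ip b (\<lambda>x. t x - ?w x) = 0" by simp
  moreover have "?w \<in> qvs.span (insert b B)"
    using w(1) u(1) qvs.span_mono[of B "insert b B"] by (intro qvs.span_add qvs.span_scale qvs.span_diff)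
      (auto intro: qvs.span_base)
  ultimately show ?case using B' by (intro bexI[of _ ?w]) auto
qed

text \<open>The set of decomposable tensors in question may be infinite; common finite support
  bounds the dimension of its span, so a finite basis can stand in for it.\<close>

lemma orthogonal_projection':
  fixes V :: "('a \<Rightarrow> rat) set"
  assumes S: "finite S" and supp: "\<And>v x. v \<in> V \<Longrightarrow> x \<notin> S \<Longrightarrow> v x = 0"
  shows "\<exists>w\<in>qvs.span V. \<forall>v\<in>V. (\<Sum>x\<in>S. v x * (t x - w x)) = 0"
proof -
  obtain B where B: "B \<subseteq> V" "qvs.independent B" "V \<subseteq> qvs.span B"
    using qvs.maximal_independent_subset by blast
  have "v \<in> qvs.span (delta ` S)" if "v \<in> V" for v
  proof -
    have "v = (\<Sum>x\<in>S. qscale (v x) (delta x))"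
    proof
      fix y
      have "(\<Sum>x\<in>S. qscale (v x) (delta x)) y = (\<Sum>x\<in>S. if x = y then v y else 0)"
        unfolding sum_pointwise qscale_def delta_def by (rule sum.cong) auto
      then show "v y = (\<Sum>x\<in>S. qscale (v x) (delta x)) y" using supp[OF that, of y] S by simp
    qed
    then show ?thesis by (metis (no_types, lifting) image_eqI qvs.span_base qvs.span_scale qvs.span_sum)
  qed
  then have "B \<subseteq> qvs.span (delta ` S)" using B by auto
  then have "finite B" using qvs.independent_span_bound[OF finite_imageI[OF S] B(2)] by blast
  from orthogonal_projection[OF this, where S = S and t = t]
  obtain w where w: "w \<in> qvs.span B" "\<And>b. b \<in> B \<Longrightarrow> (\<Sum>x\<in>S. b x * (t x - w x)) = 0" by blast
  have "(\<Sum>x\<in>S. v x * (t x - w x)) = 0" if "v \<in> V" for v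
  proof -
    have "v \<in> qvs.span B" using that B by auto
    then show ?thesis
    proof (induction rule: qvs.span_induct_alt)
      case base
      show ?case by simp
    next
      case (step c x z)
      have "(\<Sum>y\<in>S. (qscale c x + z) y * (t y - w y))
        = c * (\<Sum>y\<in>S. x y * (t y - w y)) + (\<Sum>y\<in>S. z y * (t y - w y))"
        by (simp add: qscale_def distrib_right sum.distrib sum_distrib_left mult.assoc)
      then show ?case using step w by simp
    qed
  qed
  moreover have "w \<in> qvs.span V" using w(1) B(1) qvs.span_mono by blast
  ultimately show ?thesis by blast
qed

text \<open>The action of the elementary matrix \<open>1 + s E\<^bsub>ab\<^esub>\<close> on the vectors and of its inverse on
  the covectors.\<close>

definition elementary :: "nat \<Rightarrow> rat \<Rightarrow> nat \<Rightarrow> nat \<Rightarrow> (nat \<Rightarrow> rat) list \<Rightarrow> (nat \<Rightarrow> rat) list"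
  where "elementary p s a b vs = map (\<lambda>k.
    if k < p then (vs ! k)(a := (vs ! k) a + s * (vs ! k) b)
    else (vs ! k)(b := (vs ! k) b - s * (vs ! k) a)) [0..<length vs]"

lemma length_elementary [simp]: "length (elementary p s a b vs) = length vs"
  by (simp add: elementary_def)

text \<open>A tensor orthogonal to the whole orbit \<open>(1 + s E\<^bsub>ab\<^esub>) w\<close>, \<open>s \<in> \<nat>\<close>, is orthogonal to the
  derivative of this polynomial curve at \<open>s = 0\<close>.\<close>

lemma lie_orthogonal:
  assumes len: "length vs = N" and ab: "a < n" "b < n" "a \<noteq> b"
    and orth: "\<And>s :: nat. (\<Sum>K\<in>index_lists n N. decomposable n (elementary p (of_nat s) b a vs) K * t K) = 0"
  shows "(\<Sum>K\<in>index_lists n N. decomposable n vs K * lie p a b t K) = 0"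
proof -
  let ?I = "index_lists n N"
  \<comment> \<open>The derivative in s of entry \<open>m\<close> of factor \<open>k\<close>. The
    curve belongs to E_ba, the transpose of the operator \<open>lie p a b\<close>, because it moves
    the other argument of the pairing.\<close>
  define d :: "nat \<Rightarrow> nat \<Rightarrow> rat" where
    "d k m = (if k < p then if m = b then (vs ! k) a else 0
              else if m = a then - (vs ! k) b else 0)" for k m
  define P where "P = (\<Sum>K\<in>?I. smult (t K) (\<Prod>k<N. [:(vs ! k) (K ! k), d k (K ! k):]))"
  have entry: "(elementary p s b a vs ! k) m = (vs ! k) m + s * d k m" if "k < N" for s k m
    using that ab len by (auto simp: elementary_def d_def)
  have "poly P (of_nat s) = 0" for s :: nat
  proof -
    have "poly P (of_nat s) = (\<Sum>K\<in>?I. t K * (\<Prod>k<N. (vs ! k) (K ! k) + of_nat s * d k (K ! k)))"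
      by (simp add: P_def poly_sum poly_prod)
    also have "\<dots> = (\<Sum>K\<in>?I. decomposable n (elementary p (of_nat s) b a vs) K * t K)"
      by (rule sum.cong) (auto simp: decomposable_def entry len mult.commute)
    finally show ?thesis using orth by simp
  qed
  then have "range (of_nat :: nat \<Rightarrow> rat) \<subseteq> {x. poly P x = 0}" by auto
  moreover have "infinite (range (of_nat :: nat \<Rightarrow> rat))" by (simp add: range_inj_infinite inj_of_nat)
  ultimately have "P = 0" using poly_roots_finite infinite_super by blast
  then have "0 = poly (pderiv P) 0" by simp
  also have "\<dots> = (\<Sum>K\<in>?I. t K * (\<Sum>k<N. d k (K ! k) * (\<Prod>j\<in>{..<N} - {k}. (vs ! j) (K ! j))))"
    by (simp add: P_def higher_pderiv_sum[of 1, simplified] pderiv_smult pderiv_prod poly_sum poly_prod pderiv_pCons mult.commute)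
  also have "\<dots> = (\<Sum>k<N. \<Sum>K\<in>?I. t K * (d k (K ! k) * (\<Prod>j\<in>{..<N} - {k}. (vs ! j) (K ! j))))"
    unfolding sum_distrib_left by (rule sum.swap)
  also have "\<dots> = (\<Sum>k<N. \<Sum>K\<in>?I. decomposable n vs K * (if k < p then (if K ! k = a then t (K[k := b]) else 0)
    else (if K ! k = b then - t (K[k := a]) else 0)))"
  proof (rule sum.cong)
    fix k assume k: "k \<in> {..<N}"
    \<comment> \<open>At position \<open>k\<close> the derivative reads coordinate \<open>y\<close>
      and writes it, with sign \<open>e\<close>, at \<open>x\<close>. Reindexing from lists with
      entry \<open>x\<close> to lists with entry \<open>y\<close> transfers the operator to
      \<open>t\<close>.\<close>
    define x y where "x = (if k < p then b else a)" and "y = (if k < p then a else b)"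
    define e :: rat where "e = (if k < p then 1 else -1)"
    have xy: "x < n" "y < n" "x \<noteq> y" using ab by (auto simp: x_def y_def)
    have dk: "d k m = (if m = x then e * (vs ! k) y else 0)" for m
      by (auto simp: d_def x_def y_def e_def)
    have "(\<Sum>K\<in>?I. t K * (d k (K ! k) * (\<Prod>j\<in>{..<N} - {k}. (vs ! j) (K ! j))))
      = (\<Sum>K\<in>{K \<in> ?I. K ! k = x}. t K * (e * (vs ! k) y * (\<Prod>j\<in>{..<N} - {k}. (vs ! j) (K ! j))))"
      by (rule sum.mono_neutral_cong_right) (auto simp: finite_index_lists dk)
    also have "\<dots> = (\<Sum>K\<in>{K \<in> ?I. K ! k = y}. e * t (K[k := x]) * decomposable n vs K)"
    proof (rule sum.reindex_bij_witness[where i = "\<lambda>K. K[k := x]" and j = "\<lambda>K. K[k := y]"])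
      fix K assume K: "K \<in> {K \<in> ?I. K ! k = x}"
      then have Kl: "length K = N" by (simp add: index_lists_def)
      show "K[k := y, k := x] = K" using K by (auto simp del: list_update_id)  (metis list_update_id)
      show KI: "K[k := y] \<in> {K \<in> ?I. K ! k = y}" using K index_lists_update[of K n N y k] xy k Kl by auto
      have "decomposable n vs (K[k := y]) = (\<Prod>j<N. (vs ! j) (K[k := y] ! j))"
        using KI len by (simp add: decomposable_def)
      also have "\<dots> = (vs ! k) y * (\<Prod>j\<in>{..<N} - {k}. (vs ! j) (K[k := y] ! j))"
        using k Kl by (subst prod.remove[of _ k]) auto
      also have "(\<Prod>j\<in>{..<N} - {k}. (vs ! j) (K[k := y] ! j)) = (\<Prod>j\<in>{..<N} - {k}. (vs ! j) (K ! j))"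
        by (rule prod.cong) auto
      finally show "e * t (K[k := y, k := x]) * decomposable n vs (K[k := y])
        = t K * (e * (vs ! k) y * (\<Prod>j\<in>{..<N} - {k}. (vs ! j) (K ! j)))"
        using \<open>K[k := y, k := x] = K\<close> by simp
    next
      fix K assume K: "K \<in> {K \<in> ?I. K ! k = y}"
      then have Kl: "length K = N" by (simp add: index_lists_def)
      show "K[k := x, k := y] = K" using K by (auto simp del: list_update_id)  (metis list_update_id)
      show "K[k := x] \<in> {K \<in> ?I. K ! k = x}" using K index_lists_update[of K n N x k] xy k Kl by auto
    qed
    also have "\<dots> = (\<Sum>K\<in>?I. decomposable n vs K * (if k < p then (if K ! k = a then t (K[k := b]) else 0)
      else (if K ! k = b then - t (K[k := a]) else 0)))"
      by (rule sum.mono_neutral_cong_left) (auto simp: finite_index_lists x_def y_def e_def)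
    finally show "(\<Sum>K\<in>?I. t K * (d k (K ! k) * (\<Prod>j\<in>{..<N} - {k}. (vs ! j) (K ! j))))
      = (\<Sum>K\<in>?I. decomposable n vs K * (if k < p then (if K ! k = a then t (K[k := b]) else 0)
      else (if K ! k = b then - t (K[k := a]) else 0)))" .
  qed simp
  also have "\<dots> = (\<Sum>K\<in>?I. \<Sum>k<N. decomposable n vs K * (if k < p then (if K ! k = a then t (K[k := b]) else 0)
    else (if K ! k = b then - t (K[k := a]) else 0)))" by (rule sum.swap)
  also have "\<dots> = (\<Sum>K\<in>?I. decomposable n vs K * lie p a b t K)"
    by (rule sum.cong) (auto simp: lie_def sum_distrib_left index_lists_def)
  finally show ?thesis by simp
qed

text \<open>The entries of \<open>K\<close> at \<open>k\<close> and \<open>l\<close> are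
  overwritten; \<open>K\<close> only carries the remaining indices.\<close>

definition traceless_on :: "nat \<Rightarrow> nat \<Rightarrow> nat \<Rightarrow> (nat list \<Rightarrow> rat) set"
  where "traceless_on n p q = {t. \<forall>K\<in>index_lists n (p + q). \<forall>k l. k < p \<longrightarrow> p \<le> l \<longrightarrow> l < p + q \<longrightarrow>
    (\<Sum>m<n. t (K[k := m, l := m])) = 0}"

text \<open>Contractions commute with gl_n. Acting on any other position gives a trace of
  \<open>t\<close>, hence 0; acting on the two contracted positions gives
  \<open>t (K[k := b, l := a])\<close> with opposite signs.\<close>

lemma traceless_on_lie:
  assumes t: "t \<in> traceless_on n p q" and ab: "a < n" "b < n" "a \<noteq> b"
  shows "lie p a b t \<in> traceless_on n p q"
  unfolding traceless_on_def
proof (intro CollectI ballI allI impI)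
  fix K k l assume K: "K \<in> index_lists n (p + q)" and kl: "k < p" "p \<le> l" "l < p + q"
  have len: "length K = p + q" using K by (simp add: index_lists_def)
  define e where "e j m = (if j < p then (if K[k := m, l := m] ! j = a then t (K[k := m, l := m, j := b]) else 0)
    else (if K[k := m, l := m] ! j = b then - t (K[k := m, l := m, j := a]) else 0))" for j m
  have other: "(\<Sum>m<n. e j m) = 0" if j: "j < p + q" "j \<noteq> k" "j \<noteq> l" for j
  proof -
    have tr: "(\<Sum>m<n. t (K[j := x, k := m, l := m])) = 0" if "x < n" for x
      using t index_lists_update[OF K that] kl unfolding traceless_on_def by blast
    have "K[k := m, l := m, j := x] = K[j := x, k := m, l := m]" for m x
      using j by (metis list_update_swap)
    then have e: "e j m = (if j < p then (if K ! j = a then t (K[j := b, k := m, l := m]) else 0)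
      else (if K ! j = b then - t (K[j := a, k := m, l := m]) else 0))" for m
      using j len by (simp add: e_def nth_list_update)
    show ?thesis unfolding e using tr[OF ab(1)] tr[OF ab(2)]
      by (cases "j < p"; cases "K ! j = a"; cases "K ! j = b") (simp_all add: sum_negf)
  qed
  have ek: "(\<Sum>m<n. e k m) = t (K[k := b, l := a])"
  proof -
    have "e k m = (if m = a then t (K[k := b, l := a]) else 0)" for m
      using kl len by (auto simp: e_def nth_list_update list_update_swap)
    then show ?thesis using ab by simp
  qed
  have el: "(\<Sum>m<n. e l m) = - t (K[k := b, l := a])"
  proof -
    have "e l m = (if m = b then - t (K[k := b, l := a]) else 0)" for m
      using kl len by (auto simp: e_def nth_list_update)
    then show ?thesis using ab by simp
  qed
  have "(\<Sum>m<n. lie p a b t (K[k := m, l := m])) = (\<Sum>m<n. \<Sum>j<p + q. e j m)"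
    unfolding lie_def e_def using len by simp
  also have "\<dots> = (\<Sum>j<p + q. \<Sum>m<n. e j m)" by (rule sum.swap)
  also have "\<dots> = (\<Sum>j<p + q. (if j = k then t (K[k := b, l := a]) else 0) + (if j = l then - t (K[k := b, l := a]) else 0))"
    by (rule sum.cong) (use other ek el kl in auto)
  also have "\<dots> = 0" using kl by (simp add: sum.distrib)
  finally show "(\<Sum>m<n. lie p a b t (K[k := m, l := m])) = 0" .
qed

lemma decomposable_traceless:
  assumes len: "length vs = p + q"
    and tr: "\<And>k l. k < p \<Longrightarrow> p \<le> l \<Longrightarrow> l < p + q \<Longrightarrow> (\<Sum>m<n. (vs ! k) m * (vs ! l) m) = 0"
  shows "decomposable n vs \<in> traceless_on n p q"
  unfolding traceless_on_def
proof (intro CollectI ballI allI impI)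
  fix K k l assume K: "K \<in> index_lists n (p + q)" and kl: "k < p" "p \<le> l" "l < p + q"
  have lenK: "length K = p + q" using K by (simp add: index_lists_def)
  have "decomposable n vs (K[k := m, l := m]) = (\<Prod>j\<in>{..<p + q} - {k} - {l}. (vs ! j) (K ! j)) * ((vs ! k) m * (vs ! l) m)"
    if "m < n" for m
  proof -
    have "decomposable n vs (K[k := m, l := m]) = (\<Prod>j<p + q. (vs ! j) (K[k := m, l := m] ! j))"
      using index_lists_update[OF index_lists_update[OF K that] that] len by (simp add: decomposable_def)
    also have "\<dots> = (vs ! k) m * ((vs ! l) m * (\<Prod>j\<in>{..<p + q} - {k} - {l}. (vs ! j) (K[k := m, l := m] ! j)))"
      using kl lenK by (subst prod.remove[of _ k], simp, simp, subst prod.remove[of _ l]) (auto simp: nth_list_update)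
    also have "(\<Prod>j\<in>{..<p + q} - {k} - {l}. (vs ! j) (K[k := m, l := m] ! j)) = (\<Prod>j\<in>{..<p + q} - {k} - {l}. (vs ! j) (K ! j))"
      by (rule prod.cong) auto
    finally show ?thesis by (simp add: mult_ac)
  qed
  then have "(\<Sum>m<n. decomposable n vs (K[k := m, l := m]))
    = (\<Sum>m<n. (\<Prod>j\<in>{..<p + q} - {k} - {l}. (vs ! j) (K ! j)) * ((vs ! k) m * (vs ! l) m))" by simp
  then show "(\<Sum>m<n. decomposable n vs (K[k := m, l := m])) = 0"
    by (simp add: sum_distrib_left[symmetric] tr[OF kl])
qed

text \<open>The difference of \<open>t\<close> and its orthogonal projection lies in the complement
  \<open>X\<close>. The hypotheses on \<open>G\<close> make \<open>X\<close> a
  \<open>traceless_module\<close>, so \<open>vanish\<close> applies to the difference.\<close>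

lemma traceless_span:
  assumes dim: "p + q \<le> n" and len: "\<And>vs. vs \<in> G \<Longrightarrow> length vs = p + q"
    and elem: "\<And>vs a b. vs \<in> G \<Longrightarrow> a < n \<Longrightarrow> b < n \<Longrightarrow> a \<noteq> b \<Longrightarrow> elementary p 1 a b vs \<in> G"
    and tr: "\<And>vs k l. vs \<in> G \<Longrightarrow> k < p \<Longrightarrow> p \<le> l \<Longrightarrow> l < p + q \<Longrightarrow> (\<Sum>m<n. (vs ! k) m * (vs ! l) m) = 0"
    and basis: "\<And>K. K \<in> index_lists n (p + q) \<Longrightarrow> distinct (drop p K) \<Longrightarrow>
      set (take p K) \<inter> set (drop p K) = {} \<Longrightarrow> map delta K \<in> G"
    and t: "t \<in> traceless_on n p q"
  shows "\<exists>w\<in>qvs.span (decomposable n ` G). \<forall>K\<in>index_lists n (p + q). t K = w K"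
proof -
  let ?I = "index_lists n (p + q)" and ?W = "qvs.span (decomposable n ` G)"
  have "v K = 0" if "v \<in> decomposable n ` G" "K \<notin> ?I" for v K
    using that len by (auto simp: decomposable_def)
  then obtain w where w: "w \<in> ?W" "\<And>vs. vs \<in> G \<Longrightarrow> (\<Sum>K\<in>?I. decomposable n vs K * (t K - w K)) = 0"
    using orthogonal_projection'[where V = "decomposable n ` G" and S = ?I and t = t] finite_index_lists by blast
  have wtr: "w \<in> traceless_on n p q"
    using w(1)
  proof (induction rule: qvs.span_induct_alt)
    case base
    show ?case by (simp add: traceless_on_def)
  next
    case (step c x y)
    have "x \<in> traceless_on n p q" using step.hyps decomposable_traceless len tr by blast
    then show ?case using step.IH
      by (simp add: traceless_on_def qscale_def sum.distrib sum_distrib_left[symmetric])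
  qed
  define X where "X = {x \<in> traceless_on n p q. \<forall>vs\<in>G. (\<Sum>K\<in>?I. decomposable n vs K * x K) = 0}"
  \<comment> \<open>Iterating the case s = 1, the one supplied by automorphisms of F_n, reaches
    every natural s, enough points for the polynomial in \<open>lie_orthogonal\<close>.\<close>
  have G_elem: "elementary p (of_nat s) a b vs \<in> G" if "vs \<in> G" "a < n" "b < n" "a \<noteq> b" for s a b vs
  proof (induction s)
    case 0
    have "elementary p (of_nat 0) a b vs = vs"
      by (rule nth_equalityI) (auto simp: elementary_def)
    then show ?case using that by simp
  next
    case (Suc s)
    have "elementary p (of_nat (Suc s)) a b vs = elementary p 1 a b (elementary p (of_nat s) a b vs)"
      using that(4) by (intro nth_equalityI) (auto simp: elementary_def fun_eq_iff algebra_simps)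
    then show ?case using elem[OF Suc that(2-4)] by simp
  qed
  interpret traceless_module n p q X
  proof
    show "p + q \<le> n" by fact
    fix x K k l assume "x \<in> X" "K \<in> ?I" "k < p" "p \<le> l" "l < p + q"
    then show "(\<Sum>m<n. x (K[k := m, l := m])) = 0" unfolding X_def traceless_on_def by blast
  next
    fix x a b assume x: "x \<in> X" and ab: "a < n" "b < n" "a \<noteq> b"
    have "(\<Sum>K\<in>?I. decomposable n vs K * lie p a b x K) = 0" if "vs \<in> G" for vs
      by (rule lie_orthogonal[OF len[OF that] ab]) (use G_elem[OF that, of b a] x ab in \<open>auto simp: X_def\<close>)
    then show "lie p a b x \<in> X" using traceless_on_lie[OF _ ab, of x p q] x by (simp add: X_def)
  next
    fix x K assume x: "x \<in> X" and K: "K \<in> ?I" "distinct (drop p K)" "set (take p K) \<inter> set (drop p K) = {}"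
    have "decomposable n (map delta K) K' = (if K' = K then 1 else 0)" if K': "K' \<in> ?I" for K'
    proof -
      have l: "length K = p + q" "length K' = p + q" using K K' by (auto simp: index_lists_def)
      then have "decomposable n (map delta K) K' = (\<Prod>k<p + q. if K' ! k = K ! k then 1 else 0)"
        using K' by (simp add: decomposable_def delta_def)
      also have "\<dots> = (if K' = K then 1 else 0)"
        using l nth_equalityI[of K' K] by (auto simp: prod_zero_iff)
      finally show ?thesis .
    qed
    then have "(\<Sum>K'\<in>?I. decomposable n (map delta K) K' * x K') = (\<Sum>K'\<in>?I. if K' = K then x K else 0)"
      by (intro sum.cong) auto
    moreover have "(\<Sum>K'\<in>?I. decomposable n (map delta K) K' * x K') = 0"
      using x basis[OF K] by (simp add: X_def)
    ultimately show "x K = 0" using K by (simp add: finite_index_lists)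
  qed
  have "(\<lambda>K. t K - w K) \<in> X"
    using w(2) t wtr by (simp add: X_def traceless_on_def sum_subtractf)
  from vanish[OF this] show ?thesis using w(1) by (intro bexI[of _ w]) auto
qed

section \<open>Free groups and the projection to the second exterior power\<close>

lemma free_grp_simps [simp]:
  "carrier (free_grp n) = {w. reduced w \<and> fst ` set w \<subseteq> {..<n}}"
  "u \<otimes>\<^bsub>free_grp n\<^esub> v = foldr red_cons u v"
  "\<one>\<^bsub>free_grp n\<^esub> = []"
  by (simp_all add: free_grp_def)

lemma reduced_Cons: "reduced (x # w) \<Longrightarrow> reduced w"
  by (cases x; cases w) auto

lemma reduced_red_cons: "reduced w \<Longrightarrow> reduced (red_cons x w)"
proof (cases x)
  case (Pair k s)
  assume w: "reduced w"
  show ?thesis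
  proof (cases w)
    case (Cons y w')
    then show ?thesis using w Pair reduced_Cons[of y w'] by (cases y) auto
  qed (simp add: Pair)
qed

lemma red_cons_reduced: "reduced (x # w) \<Longrightarrow> red_cons x w = x # w"
  by (cases x; cases w) auto

text \<open>Van der Waerden's device: letters act on reduced words through \<open>red_cons\<close>,
  and inverse letters act as inverse maps. Associativity of the product rests on this instead of on
  confluence of reductions.\<close>

lemma red_cons_cancel:
  assumes "reduced w"
  shows "red_cons (k, s) (red_cons (k, \<not> s) w) = w"
proof (cases w)
  case (Cons y w')
  obtain l t where y: "y = (l, t)" by (cases y)
  show ?thesis
  proof (cases "k = l \<and> s = t")
    case True
    then have "red_cons (k, \<not> s) w = w'" using Cons y by auto
    then show ?thesis using red_cons_reduced[of y w'] assms Cons y True by simp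
  next
    case False
    then have "red_cons (k, \<not> s) w = (k, \<not> s) # w" using Cons y by auto
    then show ?thesis by simp
  qed
qed simp

lemma reduced_foldr_red_cons: "reduced w \<Longrightarrow> reduced (foldr red_cons u w)"
  by (induction u) (auto simp: reduced_red_cons)

lemma set_red_cons: "set (red_cons x w) \<subseteq> insert x (set w)"
  by (cases x; cases w) (auto split: if_splits)

lemma set_foldr_red_cons: "set (foldr red_cons u w) \<subseteq> set u \<union> set w"
proof (induction u)
  case (Cons x u)
  then show ?case using set_red_cons[of x "foldr red_cons u w"] by auto
qed simp

lemma letters_foldr_red_cons: "fst ` set (foldr red_cons u w) \<subseteq> fst ` set u \<union> fst ` set w"
  by (metis image_Un image_mono set_foldr_red_cons)

lemma foldr_red_cons_red_cons:
  assumes "reduced w"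
  shows "foldr red_cons (red_cons x u) w = red_cons x (foldr red_cons u w)"
proof (cases u)
  case (Cons y u')
  obtain k s l t where xy: "x = (k, s)" "y = (l, t)" by (cases x; cases y)
  have "red_cons (k, s) (red_cons (k, \<not> s) (foldr red_cons u' w)) = foldr red_cons u' w"
    by (rule red_cons_cancel) (rule reduced_foldr_red_cons[OF assms])
  moreover have "t = (\<not> s)" if "s \<noteq> t" using that by blast
  ultimately show ?thesis using Cons xy by auto
qed (cases x, simp)

lemma foldr_red_cons_assoc:
  "reduced w \<Longrightarrow> foldr red_cons (foldr red_cons u v) w = foldr red_cons u (foldr red_cons v w)"
  by (induction u) (simp_all add: foldr_red_cons_red_cons reduced_foldr_red_cons)

definition inv_word :: "word \<Rightarrow> word"
  where "inv_word w = rev (map (\<lambda>(k, s). (k, \<not> s)) w)"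

lemma foldr_red_cons_inv_word: "reduced w \<Longrightarrow> foldr red_cons (inv_word w) w = []"
proof (induction w)
  case (Cons x w)
  obtain k s where x: "x = (k, s)" by (cases x)
  have "red_cons (k, \<not> s) (x # w) = w" by (simp add: x)
  then show ?case using Cons reduced_Cons[OF Cons.prems] x by (auto simp: inv_word_def)
qed (simp add: inv_word_def)

lemma fst_set_inv_word: "fst ` set (inv_word w) = fst ` set w"
  by (force simp: inv_word_def)

lemma group_free_grp: "group (free_grp n)"
proof (rule groupI)
  fix u v assume "u \<in> carrier (free_grp n)" "v \<in> carrier (free_grp n)"
  then show "u \<otimes>\<^bsub>free_grp n\<^esub> v \<in> carrier (free_grp n)"
    using letters_foldr_red_cons[of u v] by (simp add: reduced_foldr_red_cons) (meson Un_least order_trans)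
next
  fix u v w assume "u \<in> carrier (free_grp n)" "v \<in> carrier (free_grp n)" "w \<in> carrier (free_grp n)"
  then show "u \<otimes>\<^bsub>free_grp n\<^esub> v \<otimes>\<^bsub>free_grp n\<^esub> w = u \<otimes>\<^bsub>free_grp n\<^esub> (v \<otimes>\<^bsub>free_grp n\<^esub> w)"
    by (simp add: foldr_red_cons_assoc)
next
  fix w assume w: "w \<in> carrier (free_grp n)"
  let ?v = "foldr red_cons (inv_word w) []"
  have "fst ` set ?v \<subseteq> {..<n}"
    using letters_foldr_red_cons[of "inv_word w" "[]"] w by (simp add: fst_set_inv_word order_trans)
  moreover have "reduced ?v" by (simp add: reduced_foldr_red_cons)
  moreover have "foldr red_cons ?v w = []"
    using w by (simp add: foldr_red_cons_assoc foldr_red_cons_inv_word)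
  ultimately show "\<exists>v\<in>carrier (free_grp n). v \<otimes>\<^bsub>free_grp n\<^esub> w = \<one>\<^bsub>free_grp n\<^esub>"
    by (intro bexI[of _ ?v]) auto
qed auto

global_interpretation fg: group "free_grp n" for n by (rule group_free_grp)

lemma inv_free_grp:
  assumes "w \<in> carrier (free_grp n)"
  shows "inv\<^bsub>free_grp n\<^esub> w = foldr red_cons (inv_word w) []"
proof (rule fg.inv_equality[OF _ assms])
  show "foldr red_cons (inv_word w) [] \<otimes>\<^bsub>free_grp n\<^esub> w = \<one>\<^bsub>free_grp n\<^esub>"
    using assms by (simp add: foldr_red_cons_assoc foldr_red_cons_inv_word)
  show "foldr red_cons (inv_word w) [] \<in> carrier (free_grp n)"
    using letters_foldr_red_cons[of "inv_word w" "[]"] assms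
    by (simp add: reduced_foldr_red_cons fst_set_inv_word order_trans)
qed

declare free_grp_simps [simp del]

lemma letters_mult: "fst ` set (u \<otimes>\<^bsub>free_grp n\<^esub> v) \<subseteq> fst ` set u \<union> fst ` set v"
  using letters_foldr_red_cons[of u v] by (simp add: free_grp_simps)

lemma letters_inv: "w \<in> carrier (free_grp n) \<Longrightarrow> fst ` set (inv\<^bsub>free_grp n\<^esub> w) \<subseteq> fst ` set w"
  using letters_foldr_red_cons[of "inv_word w" "[]"] by (simp add: inv_free_grp fst_set_inv_word)

lemma free_gen_closed [simp]: "free_gen k \<in> carrier (free_grp n) \<longleftrightarrow> k < n"
  by (simp add: free_gen_def free_grp_simps)

lemma inv_free_gen: "k < n \<Longrightarrow> inv\<^bsub>free_grp n\<^esub> free_gen k = [(k, False)]"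
  using inv_free_grp[of "free_gen k" n] by (simp add: free_gen_def[of k] inv_word_def free_grp_simps)

lemma free_grp_induct [consumes 1, case_names one gen inv]:
  assumes "w \<in> carrier (free_grp n)"
    and "P \<one>\<^bsub>free_grp n\<^esub>"
    and gen: "\<And>k w. k < n \<Longrightarrow> w \<in> carrier (free_grp n) \<Longrightarrow> P w \<Longrightarrow> P (free_gen k \<otimes>\<^bsub>free_grp n\<^esub> w)"
    and inv: "\<And>k w. k < n \<Longrightarrow> w \<in> carrier (free_grp n) \<Longrightarrow> P w \<Longrightarrow> P (inv\<^bsub>free_grp n\<^esub> free_gen k \<otimes>\<^bsub>free_grp n\<^esub> w)"
  shows "P w"
  using assms(1)
proof (induction w)
  case Nil
  then show ?case using assms(2) by (simp add: free_grp_simps)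
next
  case (Cons x w)
  obtain k s where x: "x = (k, s)" by (cases x)
  have w: "w \<in> carrier (free_grp n)" and k: "k < n" and eq: "x # w = [x] \<otimes>\<^bsub>free_grp n\<^esub> w"
    using Cons.prems reduced_Cons red_cons_reduced x by (auto simp: free_grp_simps)
  show ?case
  proof (cases s)
    case True
    then show ?thesis using eq gen[OF k w Cons.IH[OF w]] x by (simp add: free_gen_def)
  next
    case False
    then show ?thesis using eq inv[OF k w Cons.IH[OF w]] x inv_free_gen[OF k] by simp
  qed
qed

lemma hom_free_grp_eqI:
  assumes "group Q" "f \<in> hom (free_grp n) Q" "g \<in> hom (free_grp n) Q"
    and gen: "\<And>k. k < n \<Longrightarrow> f (free_gen k) = g (free_gen k)"
    and "w \<in> carrier (free_grp n)"
  shows "f w = g w"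
proof -
  interpret f: group_hom "free_grp n" Q f
    using assms group_free_grp by (simp add: group_hom_def group_hom_axioms_def)
  interpret g: group_hom "free_grp n" Q g
    using assms group_free_grp by (simp add: group_hom_def group_hom_axioms_def)
  show ?thesis
    using assms(5) by (induction rule: free_grp_induct) (simp_all add: gen)
qed

section \<open>The universal property of the free group and classes in H\<close>

definition ext_hom :: "('a, 'b) monoid_scheme \<Rightarrow> (nat \<Rightarrow> 'a) \<Rightarrow> word \<Rightarrow> 'a"
  where "ext_hom Q F w = foldr (\<lambda>(k, s) v. (if s then F k else inv\<^bsub>Q\<^esub> (F k)) \<otimes>\<^bsub>Q\<^esub> v) w \<one>\<^bsub>Q\<^esub>"

text \<open>A cancellation made by \<open>red_cons\<close> is matched by the cancellation of
  \<open>F k\<close> with its inverse in \<open>Q\<close>, so evaluation letter by letter respects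
  the reduced product.\<close>

lemma
  assumes "group Q" and F: "\<And>k. k < n \<Longrightarrow> F k \<in> carrier Q"
  shows ext_hom_hom: "ext_hom Q F \<in> hom (free_grp n) Q"
    and ext_hom_gen: "k < n \<Longrightarrow> ext_hom Q F (free_gen k) = F k"
proof -
  interpret Q: group Q by fact
  let ?l = "\<lambda>(k, s). if s then F k else inv\<^bsub>Q\<^esub> (F k)"
  have l: "fst x < n \<Longrightarrow> ?l x \<in> carrier Q" for x using F by (auto split: prod.split)
  have closed: "fst ` set w \<subseteq> {..<n} \<Longrightarrow> ext_hom Q F w \<in> carrier Q" for w
  proof (induction w)
    case (Cons x w)
    then show ?case using l[of x] by (auto simp: ext_hom_def split: prod.splits)
  qed (simp add: ext_hom_def)
  have Cons: "ext_hom Q F (x # w) = ?l x \<otimes>\<^bsub>Q\<^esub> ext_hom Q F w" for x w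
    by (auto simp: ext_hom_def split: prod.split)
  have cons: "ext_hom Q F (red_cons x w) = ?l x \<otimes>\<^bsub>Q\<^esub> ext_hom Q F w"
    if x: "fst x < n" and w: "fst ` set w \<subseteq> {..<n}" for x w
  proof (cases w)
    case Nil
    then show ?thesis using x Cons by (cases x) simp
  next
    case (Cons y w')
    obtain k s l t where xy: "x = (k, s)" "y = (l, t)" by (cases x; cases y)
    have w': "ext_hom Q F w' \<in> carrier Q" using closed[of w'] w Cons by simp
    show ?thesis
    proof (cases "k = l \<and> s \<noteq> t")
      case True
      have "?l x \<otimes>\<^bsub>Q\<^esub> (?l y \<otimes>\<^bsub>Q\<^esub> ext_hom Q F w') = ext_hom Q F w'"
        using True xy x F[of k] w' by (auto simp: Q.m_assoc[symmetric])
      then show ?thesis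
        using True xy Cons \<open>\<And>x w. ext_hom Q F (x # w) = ?l x \<otimes>\<^bsub>Q\<^esub> ext_hom Q F w\<close> by auto
    next
      case False
      then have "red_cons x w = x # w" using xy Cons by auto
      then show ?thesis
        using \<open>\<And>x w. ext_hom Q F (x # w) = ?l x \<otimes>\<^bsub>Q\<^esub> ext_hom Q F w\<close>[of x w] by simp
    qed
  qed
  have "ext_hom Q F (foldr red_cons u v) = ext_hom Q F u \<otimes>\<^bsub>Q\<^esub> ext_hom Q F v"
    if "fst ` set u \<subseteq> {..<n}" "fst ` set v \<subseteq> {..<n}" for u v
    using that
  proof (induction u)
    case Nil
    then show ?case using closed[of v] by (simp add: ext_hom_def)
  next
    case (Cons x u)
    have "fst ` set (foldr red_cons u v) \<subseteq> {..<n}"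
      using letters_foldr_red_cons[of u v] Cons.prems by (meson Un_least order_trans set_subset_Cons image_mono)
    then show ?case
      using Cons cons[of x "foldr red_cons u v"] l[of x] closed[of u] closed[of v]
        \<open>\<And>x w. ext_hom Q F (x # w) = ?l x \<otimes>\<^bsub>Q\<^esub> ext_hom Q F w\<close>[of x u]
      by (simp add: Q.m_assoc)
  qed
  then show "ext_hom Q F \<in> hom (free_grp n) Q"
    using closed by (auto simp: hom_def free_grp_simps)
  show "k < n \<Longrightarrow> ext_hom Q F (free_gen k) = F k"
    using F by (simp add: ext_hom_def free_gen_def)
qed

lemma exp_sum_simps: "exp_sum k [] = 0"
  "exp_sum k (x # w) = (if fst x = k then (if snd x then 1 else -1) else 0) + exp_sum k w"
  by (auto simp: exp_sum_def split: prod.split)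

lemma exp_sum_free_gen: "exp_sum k (free_gen l) = (if k = l then 1 else 0)"
  by (simp add: free_gen_def exp_sum_simps)

lemma exp_sum_red_cons: "exp_sum k (red_cons x w) = exp_sum k (x # w)"
  by (cases x; cases w) (auto simp: exp_sum_simps)

lemma exp_sum_mult: "exp_sum k (u \<otimes>\<^bsub>free_grp n\<^esub> v) = exp_sum k u + exp_sum k v"
  unfolding free_grp_simps by (induction u) (simp_all add: exp_sum_simps exp_sum_red_cons)

lemma exp_sum_outside: "w \<in> carrier (free_grp n) \<Longrightarrow> n \<le> k \<Longrightarrow> exp_sum k w = 0"
  unfolding free_grp_simps by (induction w) (auto simp: exp_sum_simps dest: reduced_Cons)

lemma H_class_mult: "H_class (u \<otimes>\<^bsub>free_grp n\<^esub> v) = H_class u + H_class v"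
  by (auto simp: H_class_def exp_sum_mult)

lemma H_class_one: "H_class \<one>\<^bsub>free_grp n\<^esub> = 0"
  by (auto simp: H_class_def exp_sum_simps free_grp_simps)

lemma H_class_inv:
  assumes "w \<in> carrier (free_grp n)"
  shows "H_class (inv\<^bsub>free_grp n\<^esub> w) = - H_class w"
proof -
  have "H_class (inv\<^bsub>free_grp n\<^esub> w) + H_class w = 0"
    using assms by (simp add: H_class_mult[symmetric, where n = n] H_class_one fg.l_inv)
  then show ?thesis by (simp add: eq_neg_iff_add_eq_0)
qed

lemma H_class_free_gen: "H_class (free_gen k) = delta k"
  by (auto simp: H_class_def exp_sum_free_gen delta_def)

text \<open>An additive map into a rational vector space factors through H. Besides
  \<open>H_class\<close> and its composites with automorphisms, this will evaluate the displacement
  map \<open>D\<close> behind \<open>johnson_comm_transv\<close>.\<close>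

lemma additive_expansion:
  fixes D :: "word \<Rightarrow> 'b \<Rightarrow> rat"
  assumes add: "\<And>x y. x \<in> carrier (free_grp n) \<Longrightarrow> y \<in> carrier (free_grp n) \<Longrightarrow>
      D (x \<otimes>\<^bsub>free_grp n\<^esub> y) = D x + D y"
    and w: "w \<in> carrier (free_grp n)"
  shows "D w = (\<Sum>k<n. qscale (H_class w k) (D (free_gen k)))"
  using w
proof (induction rule: free_grp_induct)
  have D_one: "D \<one>\<^bsub>free_grp n\<^esub> = 0"
    using add[OF fg.one_closed fg.one_closed] fg.l_one[OF fg.one_closed] by (metis add_cancel_right_left)
  have qdistrib: "qscale (r + s) x = qscale r x + qscale s x" for r s and x :: "'b \<Rightarrow> rat"
    by (rule qvs.scale_left_distrib)
  have single: "(\<Sum>k<n. qscale (r * delta j k) (D (free_gen k))) = qscale r (D (free_gen j))" if "j < n" for r j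
  proof -
    have "(\<Sum>k<n. qscale (r * delta j k) (D (free_gen k))) = (\<Sum>k<n. if k = j then qscale r (D (free_gen j)) else 0)"
      by (rule sum.cong) (auto simp: delta_def qscale_def)
    then show ?thesis using that by simp
  qed
  have split: "(\<Sum>k<n. qscale ((u + v) k) (D (free_gen k)))
    = (\<Sum>k<n. qscale (u k) (D (free_gen k))) + (\<Sum>k<n. qscale (v k) (D (free_gen k)))" for u v :: "nat \<Rightarrow> rat"
    unfolding plus_fun_apply qdistrib sum.distrib ..
  {
    case one
    show ?case by (simp add: D_one H_class_one)
  next
    case (gen j w)
    have "D (free_gen j \<otimes>\<^bsub>free_grp n\<^esub> w) = D (free_gen j) + D w"
      using gen by (intro add) auto
    also have "D (free_gen j) = (\<Sum>k<n. qscale (delta j k) (D (free_gen k)))"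
      using single[OF gen(1), of 1] by simp
    finally show ?case unfolding H_class_mult split H_class_free_gen gen(3) .
  next
    case (inv j w)
    have "D (inv\<^bsub>free_grp n\<^esub> free_gen j \<otimes>\<^bsub>free_grp n\<^esub> w) = D (inv\<^bsub>free_grp n\<^esub> free_gen j) + D w"
      using inv by (intro add) auto
    moreover have "D (inv\<^bsub>free_grp n\<^esub> free_gen j) + D (free_gen j) = 0"
      using add[of "inv\<^bsub>free_grp n\<^esub> free_gen j" "free_gen j"] inv(1) D_one by (simp add: fg.l_inv)
    then have "D (inv\<^bsub>free_grp n\<^esub> free_gen j) = - D (free_gen j)"
      by (simp only: eq_neg_iff_add_eq_0)
    moreover have "(\<Sum>k<n. qscale ((- delta j) k) (D (free_gen k))) = - D (free_gen j)"
      using single[OF inv(1), of "-1"] by (simp add: qvs.scale_minus_left)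
    moreover have "H_class (inv\<^bsub>free_grp n\<^esub> free_gen j) = - delta j"
      using inv(1) by (simp only: H_class_inv free_gen_closed H_class_free_gen)
    ultimately show ?case unfolding H_class_mult split by (simp only: inv(3))
  }
qed

section \<open>The degree two part of the Magnus expansion and the map \<open>gr2\<close>\<close>

text \<open>The coefficient of \<open>X\<^sub>a X\<^sub>b\<close> in the Magnus expansion \<open>x\<^sub>k \<mapsto> 1 + X\<^sub>k\<close>; an inverse letter
  contributes \<open>1 - X\<^sub>k + X\<^sub>k\<^sup>2\<close>.\<close>

primrec magnus :: "nat \<Rightarrow> nat \<Rightarrow> word \<Rightarrow> rat"
  where
    "magnus a b [] = 0"
  | "magnus a b (x # w) = (if fst x = a \<and> a = b \<and> \<not> snd x then 1 else 0) + magnus a b w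
       + of_int (exp_sum a [x]) * H_class w b"

lemma magnus_red_cons: "magnus a b (red_cons x w) = magnus a b (x # w)"
  by (cases x; cases w) (auto simp: exp_sum_simps H_class_def)

text \<open>Degree two coefficient of a product of series with constant term 1. The mixed term
  vanishes once one factor has zero class, which is where the additivity of \<open>quad\<close>
  comes from.\<close>

lemma magnus_mult:
  "magnus a b (u \<otimes>\<^bsub>free_grp n\<^esub> v) = magnus a b u + magnus a b v + H_class u a * H_class v b"
proof -
  have "magnus a b (foldr red_cons u v) = magnus a b u + magnus a b v + H_class u a * H_class v b"
  proof (induction u)
    case (Cons x u)
    have "H_class (foldr red_cons u v) = H_class u + H_class v"
      using H_class_mult[where u = u and v = v] by (simp add: free_grp_simps)
    then show ?case
      unfolding foldr.simps o_def magnus_red_cons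
      using Cons by (simp add: H_class_def exp_sum_simps algebra_simps)
  qed (simp add: H_class_def exp_sum_simps)
  then show ?thesis by (simp add: free_grp_simps)
qed

lemma magnus_inv:
  assumes "w \<in> carrier (free_grp n)"
  shows "magnus a b (inv\<^bsub>free_grp n\<^esub> w) = - magnus a b w + H_class w a * H_class w b"
proof -
  have "magnus a b (inv\<^bsub>free_grp n\<^esub> w \<otimes>\<^bsub>free_grp n\<^esub> w) = 0"
    using fg.l_inv[OF assms] by (simp add: free_grp_simps)
  then show ?thesis unfolding magnus_mult H_class_inv[OF assms] by simp
qed

text \<open>The full degree two part, in the list-indexed form of \<open>wedge\<close>. It is not
  alternating in general: the inverse of x_k has coefficient 1 at X_k X_k.\<close>

definition quad :: "word \<Rightarrow> nat list \<Rightarrow> rat"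
  where "quad w bs = (if length bs = 2 then magnus (bs ! 0) (bs ! 1) w else 0)"

abbreviation comm :: "nat \<Rightarrow> word \<Rightarrow> word \<Rightarrow> word"
  where "comm n x y \<equiv> x \<otimes>\<^bsub>free_grp n\<^esub> y \<otimes>\<^bsub>free_grp n\<^esub> inv\<^bsub>free_grp n\<^esub> x \<otimes>\<^bsub>free_grp n\<^esub> inv\<^bsub>free_grp n\<^esub> y"

lemma wedge2: "wedge [x, y] bs = (if length bs = 2 then x (bs ! 0) * y (bs ! 1) - x (bs ! 1) * y (bs ! 0) else 0)"
proof -
  let ?A = "mat 2 2 (\<lambda>(j, l). ([x, y] ! j) (bs ! l))"
  have "det ?A = (\<Sum>j<2. ?A $$ (0, j) * cofactor ?A 0 j)"
    by (rule laplace_expansion_row[of _ 2]) auto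
  also have "\<dots> = x (bs ! 0) * y (bs ! 1) - x (bs ! 1) * y (bs ! 0)"
    by (simp add: numeral_2_eq_2 cofactor_def det_single mat_delete_def)
  finally show ?thesis by (simp add: wedge_def numeral_2_eq_2)
qed

lemma H_class_comm:
  "x \<in> carrier (free_grp n) \<Longrightarrow> y \<in> carrier (free_grp n) \<Longrightarrow> H_class (comm n x y) = 0"
  by (simp add: H_class_mult H_class_inv)

text \<open>Modulo degree three, the commutator of 1 + X and 1 + Y is 1 + XY - YX, to which only the
  linear parts of X and Y contribute.\<close>

lemma quad_comm:
  "x \<in> carrier (free_grp n) \<Longrightarrow> y \<in> carrier (free_grp n) \<Longrightarrow> quad (comm n x y) = wedge [H_class x, H_class y]"
  by (auto simp: fun_eq_iff quad_def wedge2 magnus_mult magnus_inv H_class_mult H_class_inv algebra_simps)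

lemma quad_mult:
  assumes "H_class u = 0 \<or> H_class v = 0"
  shows "quad (u \<otimes>\<^bsub>free_grp n\<^esub> v) = quad u + quad v"
  using assms by (auto simp: fun_eq_iff quad_def magnus_mult)

lemma quad_inv:
  "w \<in> carrier (free_grp n) \<Longrightarrow> H_class w = 0 \<Longrightarrow> quad (inv\<^bsub>free_grp n\<^esub> w) = - quad w"
  by (auto simp: fun_eq_iff quad_def magnus_inv)

lemma quad_conj:
  assumes "u \<in> carrier (free_grp n)" "y \<in> carrier (free_grp n)" "H_class u = 0"
  shows "quad (inv\<^bsub>free_grp n\<^esub> y \<otimes>\<^bsub>free_grp n\<^esub> u \<otimes>\<^bsub>free_grp n\<^esub> y) = quad u"
  using assms by (auto simp: fun_eq_iff quad_def magnus_mult magnus_inv H_class_mult H_class_inv)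

lemma lcs2_induct [consumes 1, case_names one comm mult inv]:
  assumes "u \<in> lcs2 n"
    and "P \<one>\<^bsub>free_grp n\<^esub>"
    and "\<And>x y. x \<in> carrier (free_grp n) \<Longrightarrow> y \<in> carrier (free_grp n) \<Longrightarrow> P (comm n x y)"
    and "\<And>u v. u \<in> lcs2 n \<Longrightarrow> v \<in> lcs2 n \<Longrightarrow> P u \<Longrightarrow> P v \<Longrightarrow> P (u \<otimes>\<^bsub>free_grp n\<^esub> v)"
    and "\<And>u. u \<in> lcs2 n \<Longrightarrow> P u \<Longrightarrow> P (inv\<^bsub>free_grp n\<^esub> u)"
  shows "P u"
  using assms(1) unfolding lcs2_def derived_def
proof (induction rule: generate.induct)
  case one
  show ?case by (rule assms(2))
next
  case (incl h)
  then obtain x y where "h = comm n x y" "x \<in> carrier (free_grp n)" "y \<in> carrier (free_grp n)" by blast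
  then show ?case by (simp only: assms(3))
next
  case (inv h)
  have "h \<in> lcs2 n" unfolding lcs2_def derived_def by (rule generate.incl) (rule inv)
  moreover obtain x y where "h = comm n x y" "x \<in> carrier (free_grp n)" "y \<in> carrier (free_grp n)"
    using inv by blast
  then have "P h" by (simp only: assms(3))
  ultimately show ?case by (rule assms(5))
next
  case (eng h1 h2)
  show ?case by (rule assms(4)) (use eng in \<open>auto simp: lcs2_def derived_def\<close>)
qed

lemma lcs2_carrier: "u \<in> lcs2 n \<Longrightarrow> u \<in> carrier (free_grp n)"
  unfolding lcs2_def using fg.derived_in_carrier[of "carrier (free_grp n)" n] by blast

lemma subgroup_lcs2: "subgroup (lcs2 n) (free_grp n)"
  unfolding lcs2_def by (rule fg.derived_is_subgroup) simp

lemma comm_in_lcs2: "x \<in> carrier (free_grp n) \<Longrightarrow> y \<in> carrier (free_grp n) \<Longrightarrow> comm n x y \<in> lcs2 n"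
  unfolding lcs2_def derived_def by (rule generate.incl) blast

lemma H_class_lcs2: "u \<in> lcs2 n \<Longrightarrow> H_class u = 0"
  by (induction rule: lcs2_induct)
    (simp_all add: H_class_one H_class_comm H_class_mult H_class_inv lcs2_carrier)

lemma H_class_in_H_space:
  assumes "w \<in> carrier (free_grp n)"
  shows "H_class w \<in> H_space n"
proof -
  have "H_class w = (\<Sum>k<n. qscale (H_class w k) (delta k))"
    using additive_expansion[where D = H_class, OF H_class_mult assms] by (simp add: H_class_free_gen)
  also have "\<dots> \<in> H_space n"
    unfolding H_space_def by (intro qvs.span_sum qvs.span_scale qvs.span_base) auto
  finally show ?thesis .
qed

lemma wedge_H_class:
  assumes "x \<in> carrier (free_grp n)" "y \<in> carrier (free_grp n)"
  shows "wedge [H_class x, H_class y] \<in> ext_power 2 (H_space n)"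
  unfolding ext_power_def using assms H_class_in_H_space
  by (intro qvs.span_base CollectI exI[of _ "[H_class x, H_class y]"]) auto

lemma quad_lcs3:
  assumes "u \<in> lcs3 n"
  shows "u \<in> lcs2 n \<and> quad u = 0"
  using assms unfolding lcs3_def
proof (induction rule: generate.induct)
  case one
  then show ?case using subgroup.one_closed[OF subgroup_lcs2] by (auto simp: quad_def fun_eq_iff) (simp add: free_grp_simps)
next
  case (incl h)
  then obtain x y where h: "h = comm n x y" "x \<in> carrier (free_grp n)" "y \<in> lcs2 n" by auto
  then show ?case using comm_in_lcs2[of x n y] quad_comm[of x n y] H_class_lcs2[of y n] lcs2_carrier[of y n]
    by (auto simp: fun_eq_iff wedge2)
next
  case (inv h)
  then obtain x y where h: "h = comm n x y" "x \<in> carrier (free_grp n)" "y \<in> lcs2 n" by auto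
  have "h \<in> lcs2 n" "quad h = 0"
    using h comm_in_lcs2[of x n y] quad_comm[of x n y] H_class_lcs2[of y n] lcs2_carrier[of y n]
    by (auto simp: fun_eq_iff wedge2)
  then show ?case
    using subgroup.m_inv_closed[OF subgroup_lcs2] quad_inv[of h n] H_class_lcs2 lcs2_carrier by simp
next
  case (eng h1 h2)
  then have "quad (h1 \<otimes>\<^bsub>free_grp n\<^esub> h2) = quad h1 + quad h2"
    by (intro quad_mult) (use H_class_lcs2 in blast)
  then show ?case using subgroup.m_closed[OF subgroup_lcs2] eng.IH by simp
qed

text \<open>\<open>quad\<close> satisfies the definite description once restricted to
  \<open>lcs2 n\<close>, as an extensional function is asked for. It is the only solution because
  commutators generate \<open>lcs2 n\<close> and additivity propagates their values.\<close>

lemma gr2_eq_quad: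
  assumes "u \<in> lcs2 n"
  shows "gr2 n u = quad u"
proof -
  have quad_mem: "quad u \<in> ext_power 2 (H_space n)" if "u \<in> lcs2 n" for u
    using that
  proof (induction rule: lcs2_induct)
    case one
    have "quad \<one>\<^bsub>free_grp n\<^esub> = 0" by (auto simp: quad_def fun_eq_iff free_grp_simps)
    then show ?case unfolding ext_power_def by (simp only: qvs.span_zero)
  next
    case (comm x y)
    then show ?case by (simp only: quad_comm[OF comm] wedge_H_class[OF comm])
  next
    case (mult u v)
    have "quad (u \<otimes>\<^bsub>free_grp n\<^esub> v) = quad u + quad v"
      by (rule quad_mult) (use H_class_lcs2[OF mult(1)] in blast)
    then show ?case using mult(3,4) unfolding ext_power_def by (simp only: qvs.span_add)
  next
    case (inv u)
    have "quad (inv\<^bsub>free_grp n\<^esub> u) = - quad u"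
      by (rule quad_inv) (rule lcs2_carrier[OF inv(1)] H_class_lcs2[OF inv(1)])+
    then show ?case using inv(2) unfolding ext_power_def by (simp only: qvs.span_neg)
  qed
  have "gr2 n = restrict quad (lcs2 n)"
    unfolding gr2_def
  proof (rule the_equality, intro conjI ballI)
    show "restrict quad (lcs2 n) \<in> lcs2 n \<rightarrow>\<^sub>E ext_power 2 (H_space n)" using quad_mem by auto
  next
    fix u v assume "u \<in> lcs2 n" "v \<in> lcs2 n"
    then show "restrict quad (lcs2 n) (u \<otimes>\<^bsub>free_grp n\<^esub> v) = restrict quad (lcs2 n) u + restrict quad (lcs2 n) v"
      using subgroup.m_closed[OF subgroup_lcs2] by (simp add: quad_mult H_class_lcs2)
  next
    fix u assume "u \<in> lcs3 n"
    then show "restrict quad (lcs2 n) u = 0" using quad_lcs3 by simp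
  next
    fix x y assume "x \<in> carrier (free_grp n)" "y \<in> carrier (free_grp n)"
    then show "restrict quad (lcs2 n) (comm n x y) = wedge [H_class x, H_class y]"
      using comm_in_lcs2 by (simp add: quad_comm)
  next
    fix \<phi> assume \<phi>: "\<phi> \<in> lcs2 n \<rightarrow>\<^sub>E ext_power 2 (H_space n) \<and>
      (\<forall>u\<in>lcs2 n. \<forall>v\<in>lcs2 n. \<phi> (u \<otimes>\<^bsub>free_grp n\<^esub> v) = \<phi> u + \<phi> v) \<and>
      (\<forall>u\<in>lcs3 n. \<phi> u = 0) \<and>
      (\<forall>x\<in>carrier (free_grp n). \<forall>y\<in>carrier (free_grp n). \<phi> (comm n x y) = wedge [H_class x, H_class y])"
    then have add: "\<And>u v. u \<in> lcs2 n \<Longrightarrow> v \<in> lcs2 n \<Longrightarrow> \<phi> (u \<otimes>\<^bsub>free_grp n\<^esub> v) = \<phi> u + \<phi> v"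
      and com: "\<And>x y. x \<in> carrier (free_grp n) \<Longrightarrow> y \<in> carrier (free_grp n) \<Longrightarrow> \<phi> (comm n x y) = wedge [H_class x, H_class y]"
      by blast+
    have one: "\<phi> \<one>\<^bsub>free_grp n\<^esub> = 0"
      using add[of "\<one>\<^bsub>free_grp n\<^esub>" "\<one>\<^bsub>free_grp n\<^esub>"] subgroup.one_closed[OF subgroup_lcs2] by simp
    have "\<phi> u = quad u" if "u \<in> lcs2 n" for u
      using that
    proof (induction rule: lcs2_induct)
      case one
      then show ?case using \<open>\<phi> \<one>\<^bsub>free_grp n\<^esub> = 0\<close> by (auto simp: quad_def fun_eq_iff free_grp_simps)
    next
      case (comm x y)
      then show ?case by (simp add: quad_comm com)
    next
      case (mult u v)
      then show ?case by (simp add: quad_mult H_class_lcs2 add)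
    next
      case (inv u)
      have "\<phi> (inv\<^bsub>free_grp n\<^esub> u) + \<phi> u = 0"
        using add[of "inv\<^bsub>free_grp n\<^esub> u" u] subgroup.m_inv_closed[OF subgroup_lcs2] inv one lcs2_carrier[of u n]
        by (simp add: fg.l_inv)
      then have "\<phi> (inv\<^bsub>free_grp n\<^esub> u) = - \<phi> u" by (simp only: eq_neg_iff_add_eq_0)
      then show ?case
        by (simp only: inv(2) quad_inv[OF lcs2_carrier[OF inv(1)] H_class_lcs2[OF inv(1)]])
    qed
    moreover have "\<phi> \<in> extensional (lcs2 n)" using \<phi> by (auto simp: PiE_def)
    ultimately show "\<phi> = restrict quad (lcs2 n)" by (intro extensionalityI[of _ "lcs2 n"]) auto
  qed
  then show ?thesis using assms by simp
qed

text \<open>In the abelian quotient by the commutator subgroup, the projection equals the product of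
  the powers of the generators with exponents \<open>exp_sum\<close>, both being homomorphisms that
  agree on generators. Zero exponents put \<open>w\<close> in the kernel.\<close>

lemma H_class_zero_imp_lcs2:
  assumes w: "w \<in> carrier (free_grp n)" and zero: "H_class w = 0"
  shows "w \<in> lcs2 n"
proof -
  define Q where "Q = free_grp n Mod lcs2 n"
  interpret N: normal "lcs2 n" "free_grp n" unfolding lcs2_def by (rule fg.derived_self_is_normal)
  interpret Q: comm_group Q unfolding Q_def lcs2_def by (rule fg.derived_quot_is_comm_group)
  define \<pi> where "\<pi> x = lcs2 n #>\<^bsub>free_grp n\<^esub> x" for x
  have \<pi>: "\<pi> \<in> hom (free_grp n) Q" unfolding \<pi>_def Q_def by (rule N.r_coset_hom_Mod)
  have \<pi>c: "\<pi> (free_gen k) \<in> carrier Q" if "k < n" for k using hom_in_carrier[OF \<pi>] that by simp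
  define \<sigma> where "\<sigma> x = finprod Q (\<lambda>k. \<pi> (free_gen k) [^]\<^bsub>Q\<^esub> exp_sum k x) {..<n}" for x
  have pc: "(\<lambda>k. \<pi> (free_gen k) [^]\<^bsub>Q\<^esub> exp_sum k x) \<in> {..<n} \<rightarrow> carrier Q" for x
    using \<pi>c by auto
  have "\<sigma> \<in> hom (free_grp n) Q"
  proof (rule homI)
    fix x y assume "x \<in> carrier (free_grp n)" "y \<in> carrier (free_grp n)"
    have "\<sigma> (x \<otimes>\<^bsub>free_grp n\<^esub> y)
      = finprod Q (\<lambda>k. \<pi> (free_gen k) [^]\<^bsub>Q\<^esub> exp_sum k x \<otimes>\<^bsub>Q\<^esub> \<pi> (free_gen k) [^]\<^bsub>Q\<^esub> exp_sum k y) {..<n}"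
      unfolding \<sigma>_def using \<pi>c by (intro Q.finprod_cong' Pi_I) (auto simp: exp_sum_mult Q.int_pow_mult)
    also have "\<dots> = \<sigma> x \<otimes>\<^bsub>Q\<^esub> \<sigma> y" unfolding \<sigma>_def by (rule Q.finprod_multf[OF pc pc])
    finally show "\<sigma> (x \<otimes>\<^bsub>free_grp n\<^esub> y) = \<sigma> x \<otimes>\<^bsub>Q\<^esub> \<sigma> y" .
  qed (use pc in \<open>auto simp: \<sigma>_def intro!: Q.finprod_closed\<close>)
  moreover have "\<pi> (free_gen j) = \<sigma> (free_gen j)" if j: "j < n" for j
  proof -
    have "\<sigma> (free_gen j) = finprod Q (\<lambda>k. if j = k then \<pi> (free_gen k) else \<one>\<^bsub>Q\<^esub>) {..<n}"
      unfolding \<sigma>_def using \<pi>c by (intro Q.finprod_cong') (auto simp: exp_sum_free_gen Q.int_pow_1)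
    also have "\<dots> = \<pi> (free_gen j)" using \<pi>c j by (intro Q.finprod_singleton) auto
    finally show ?thesis by simp
  qed
  ultimately have "\<pi> w = \<sigma> w" using hom_free_grp_eqI[OF Q.is_group \<pi> _ _ w] by blast
  also have "\<sigma> w = \<one>\<^bsub>Q\<^esub>"
  proof -
    have "exp_sum k w = 0" for k using fun_cong[OF zero, of k] by (simp add: H_class_def)
    then show ?thesis unfolding \<sigma>_def by (simp add: Q.finprod_one_eqI)
  qed
  finally have "lcs2 n #>\<^bsub>free_grp n\<^esub> w = lcs2 n" by (simp add: \<pi>_def Q_def FactGroup_def)
  then show ?thesis using fg.rcos_self[OF w subgroup_lcs2] by simp
qed

section \<open>Abelian cycles\<close>

lemma wedge_leibniz:
  assumes "length vs = N" "length bs = N"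
  shows "wedge vs bs = (\<Sum>p | p permutes {0..<N}. signof p * (\<Prod>i = 0..<N. (vs ! i) (bs ! p i)))"
proof -
  have "wedge vs bs = (\<Sum>p | p permutes {0..<N}. signof p *
      (\<Prod>i = 0..<N. mat N N (\<lambda>(j, l). (vs ! j) (bs ! l)) $$ (i, p i)))"
    using assms by (simp add: wedge_def det_def'[of _ N])
  also have "\<dots> = (\<Sum>p | p permutes {0..<N}. signof p * (\<Prod>i = 0..<N. (vs ! i) (bs ! p i)))"
  proof (intro sum.cong refl arg_cong2[where f = "(*)"] prod.cong)
    fix p i assume p: "p \<in> {p. p permutes {0..<N}}" and i: "i \<in> {0..<N}"
    then have "p i < N" using permutes_in_image[of p "{0..<N}" i] by simp
    then show "mat N N (\<lambda>(j, l). (vs ! j) (bs ! l)) $$ (i, p i) = (vs ! i) (bs ! p i)" using i by simp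
  qed
  finally show ?thesis .
qed

text \<open>Isolating the factor of position \<open>k\<close> in the Leibniz formula makes linearity
  in \<open>v\<close> visible.\<close>

lemma wedge_update:
  assumes k: "k < length vs" and len: "length bs = length vs"
  shows "wedge (vs[k := v]) bs = (\<Sum>p | p permutes {0..<length vs}.
    signof p * (v (bs ! p k) * (\<Prod>i\<in>{0..<length vs} - {k}. (vs ! i) (bs ! p i))))"
  unfolding wedge_leibniz[of "vs[k := v]" "length vs" bs, OF length_list_update len]
proof (intro sum.cong refl arg_cong2[where f = "(*)"])
  fix p
  have "(\<Prod>i = 0..<length vs. (vs[k := v] ! i) (bs ! p i))
    = (vs[k := v] ! k) (bs ! p k) * (\<Prod>i\<in>{0..<length vs} - {k}. (vs[k := v] ! i) (bs ! p i))"
    using k by (intro prod.remove) auto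
  also have "(\<Prod>i\<in>{0..<length vs} - {k}. (vs[k := v] ! i) (bs ! p i))
    = (\<Prod>i\<in>{0..<length vs} - {k}. (vs ! i) (bs ! p i))" by (rule prod.cong) auto
  finally show "(\<Prod>i = 0..<length vs. (vs[k := v] ! i) (bs ! p i))
    = v (bs ! p k) * (\<Prod>i\<in>{0..<length vs} - {k}. (vs ! i) (bs ! p i))" using k by simp
qed

lemma wedge_length: "length bs \<noteq> length vs \<Longrightarrow> wedge vs bs = 0"
  by (simp add: wedge_def)

lemma wedge_add:
  assumes "k < length vs"
  shows "wedge (vs[k := x + y]) = wedge (vs[k := x]) + wedge (vs[k := y])"
proof
  fix bs
  show "wedge (vs[k := x + y]) bs = (wedge (vs[k := x]) + wedge (vs[k := y])) bs"
  proof (cases "length bs = length vs")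
    case True
    show ?thesis
      unfolding plus_fun_apply wedge_update[OF assms True] sum.distrib[symmetric]
      by (rule sum.cong) (simp_all add: algebra_simps)
  qed (simp add: wedge_length)
qed

lemma wedge_scale:
  assumes "k < length vs"
  shows "wedge (vs[k := qscale r x]) = qscale r (wedge (vs[k := x]))"
proof
  fix bs
  show "wedge (vs[k := qscale r x]) bs = qscale r (wedge (vs[k := x])) bs"
  proof (cases "length bs = length vs")
    case True
    show ?thesis
      unfolding qscale_def wedge_update[OF assms True] sum_distrib_left
      by (rule sum.cong) (simp_all add: algebra_simps)
  qed (simp add: wedge_length qscale_def)
qed

lemma wedge_append_add: "wedge (us @ (x + y) # vs) = wedge (us @ x # vs) + wedge (us @ y # vs)"
  using wedge_add[of "length us" "us @ x # vs" x y] by simp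

lemma wedge_repeated:
  assumes "i < length vs" "j < length vs" "i \<noteq> j" "vs ! i = vs ! j"
  shows "wedge vs = 0"
proof
  fix bs
  show "wedge vs bs = 0 bs"
  proof (cases "length bs = length vs")
    case True
    let ?A = "mat (length vs) (length vs) (\<lambda>(j, l). (vs ! j) (bs ! l))"
    have "row ?A i = row ?A j" using assms by (intro eq_vecI) auto
    then have "det ?A = 0" using assms by (intro det_identical_rows[of _ "length vs" i j]) auto
    then show ?thesis using True by (simp add: wedge_def)
  qed (simp add: wedge_length)
qed

lemma wedge_permute:
  assumes p: "p permutes {0..<length vs}"
  shows "wedge (map (\<lambda>j. vs ! p j) [0..<length vs]) = qscale (signof p) (wedge vs)"
proof
  fix bs
  let ?n = "length vs"
  let ?A = "mat ?n ?n (\<lambda>(j, l). (vs ! j) (bs ! l))"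
  have "mat ?n ?n (\<lambda>(j, l). (map (\<lambda>j. vs ! p j) [0..<?n] ! j) (bs ! l)) = mat ?n ?n (\<lambda>(i, j). ?A $$ (p i, j))"
    using permutes_in_image[OF p] by (intro eq_matI) auto
  moreover have "det (mat ?n ?n (\<lambda>(i, j). ?A $$ (p i, j))) = signof p * det ?A"
    by (rule det_permute_rows[OF _ p]) simp
  ultimately show "wedge (map (\<lambda>j. vs ! p j) [0..<?n]) bs = qscale (signof p) (wedge vs) bs"
    by (simp add: wedge_def qscale_def)
qed

section \<open>Linear extensions and bar chains\<close>

text \<open>\<open>lin_ext\<close> collapses to 0 on infinite support, so its linearity rules carry
  this hypothesis.\<close>

abbreviation finsupp :: "('a \<Rightarrow> rat) \<Rightarrow> bool"
  where "finsupp c \<equiv> finite {x. c x \<noteq> 0}"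

lemma finsupp_add: "finsupp c \<Longrightarrow> finsupp d \<Longrightarrow> finsupp (c + d)"
  by (rule finite_subset[of _ "{x. c x \<noteq> 0} \<union> {x. d x \<noteq> 0}"]) auto

lemma finsupp_scale: "finsupp c \<Longrightarrow> finsupp (qscale r c)"
  by (rule finite_subset[of _ "{x. c x \<noteq> 0}"]) (auto simp: qscale_def)

lemma finsupp_zero: "finsupp 0"
  by simp

lemma finsupp_delta: "finsupp (delta x)"
  by (rule finite_subset[of _ "{x}"]) (auto simp: delta_def)

lemma finsupp_diff: "finsupp c \<Longrightarrow> finsupp d \<Longrightarrow> finsupp (c - d)"
  by (rule finite_subset[of _ "{x. c x \<noteq> 0} \<union> {x. d x \<noteq> 0}"]) auto

lemma finsupp_sum: "(\<And>i. i \<in> I \<Longrightarrow> finsupp (c i)) \<Longrightarrow> finsupp (sum c I)"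
proof (induction I rule: infinite_finite_induct)
  case (insert i I)
  then show ?case unfolding sum.insert[OF insert(1,2)] by (intro finsupp_add) auto
qed (simp_all add: finsupp_zero)

lemma lin_ext_eq:
  assumes "finite S" "{x. c x \<noteq> 0} \<subseteq> S"
  shows "lin_ext F c = (\<Sum>x\<in>S. qscale (c x) (F x))"
  unfolding lin_ext_def using assms by (intro sum.mono_neutral_left) (auto simp: qscale_def)

lemma lin_ext_zero: "lin_ext F 0 = 0"
  by (simp add: lin_ext_def)

lemma lin_ext_delta: "lin_ext F (delta x) = F x"
  by (subst lin_ext_eq[of "{x}"]) (auto simp: delta_def qscale_def)

lemma lin_ext_add:
  assumes "finsupp c" "finsupp d"
  shows "lin_ext F (c + d) = lin_ext F c + lin_ext F d"
proof -
  let ?S = "{x. c x \<noteq> 0} \<union> {x. d x \<noteq> 0}"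
  have fin: "finite ?S" using assms by simp
  have "{x. (c + d) x \<noteq> 0} \<subseteq> ?S" by auto
  then show ?thesis
    unfolding lin_ext_eq[OF fin Un_upper1] lin_ext_eq[OF fin Un_upper2]
    by (subst lin_ext_eq[OF fin]) (auto simp: qvs.scale_left_distrib sum.distrib)
qed

lemma lin_ext_scale:
  assumes "finsupp c"
  shows "lin_ext F (qscale r c) = qscale r (lin_ext F c)"
proof -
  have "{x. qscale r c x \<noteq> 0} \<subseteq> {x. c x \<noteq> 0}" by (auto simp: qscale_def)
  from lin_ext_eq[OF assms this]
  have "lin_ext F (qscale r c) = (\<Sum>x | c x \<noteq> 0. qscale (r * c x) (F x))" by (simp add: qscale_def)
  also have "\<dots> = qscale r (lin_ext F c)"
    unfolding lin_ext_def qvs.scale_sum_right by (simp only: qvs.scale_scale)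
  finally show ?thesis .
qed

lemma lin_ext_diff:
  assumes "finsupp c" "finsupp d"
  shows "lin_ext F (c - d) = lin_ext F c - lin_ext F d"
proof -
  have "c - d = c + qscale (-1) d" by (auto simp: qscale_def)
  then have "lin_ext F (c - d) = lin_ext F c + qscale (-1) (lin_ext F d)"
    by (simp only: lin_ext_add assms finsupp_scale lin_ext_scale)
  then show ?thesis by (simp add: qscale_def fun_eq_iff)
qed

lemma lin_ext_sum: "(\<And>i. i \<in> I \<Longrightarrow> finsupp (c i)) \<Longrightarrow> lin_ext F (sum c I) = (\<Sum>i\<in>I. lin_ext F (c i))"
proof (induction I rule: infinite_finite_induct)
  case (insert i I)
  have "lin_ext F (c i + sum c I) = lin_ext F (c i) + lin_ext F (sum c I)"
    using insert.prems by (intro lin_ext_add finsupp_sum) auto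
  also have "lin_ext F (sum c I) = (\<Sum>i\<in>I. lin_ext F (c i))" using insert by auto
  finally show ?case unfolding sum.insert[OF insert(1,2)] .
qed (simp_all add: lin_ext_zero)

lemma lin_ext_lin_ext:
  assumes "\<And>x. c x \<noteq> 0 \<Longrightarrow> finsupp (F x)"
  shows "lin_ext L (lin_ext F c) = lin_ext (\<lambda>x. lin_ext L (F x)) c"
proof -
  have "lin_ext L (lin_ext F c) = (\<Sum>x | c x \<noteq> 0. lin_ext L (qscale (c x) (F x)))"
    unfolding lin_ext_def[of F c] using assms by (intro lin_ext_sum finsupp_scale) auto
  also have "\<dots> = (\<Sum>x | c x \<noteq> 0. qscale (c x) (lin_ext L (F x)))"
    using assms by (intro sum.cong refl lin_ext_scale) auto
  finally show ?thesis unfolding lin_ext_def[of "\<lambda>x. lin_ext L (F x)" c] .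
qed

lemma finsupp_lin_ext: "(\<And>x. c x \<noteq> 0 \<Longrightarrow> finsupp (F x)) \<Longrightarrow> finsupp (lin_ext F c)"
  unfolding lin_ext_def by (intro finsupp_sum finsupp_scale) auto

lemma lin_ext_cong: "(\<And>x. c x \<noteq> 0 \<Longrightarrow> F x = G x) \<Longrightarrow> lin_ext F c = lin_ext G c"
  unfolding lin_ext_def by (intro sum.cong) auto

lemma lin_ext_neutral: "(\<And>x. c x \<noteq> 0 \<Longrightarrow> F x = 0) \<Longrightarrow> lin_ext F c = 0"
  unfolding lin_ext_def by (intro sum.neutral ballI) (simp add: qvs.scale_zero_right)

lemma bar_chains_finsupp:
  assumes "c \<in> bar_chains G k"
  shows "finsupp c \<and> (\<forall>gs. c gs \<noteq> 0 \<longrightarrow> length gs = k \<and> set gs \<subseteq> carrier G)"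
  using assms unfolding bar_chains_def
proof (induction rule: qvs.span_induct_alt)
  case (step r x y)
  then obtain gs where x: "x = delta gs" "length gs = k" "set gs \<subseteq> carrier G" by blast
  have "finsupp (qscale r x + y)" using x step by (intro finsupp_add finsupp_scale) (auto simp: finsupp_delta)
  moreover have "(qscale r x + y) hs \<noteq> 0 \<Longrightarrow> hs = gs \<or> y hs \<noteq> 0" for hs
    by (auto simp: x(1) qscale_def delta_def split: if_splits)
  ultimately show ?case using step x by blast
qed simp

lemma bar_chains_zero: "0 \<in> bar_chains G k"
  unfolding bar_chains_def by (rule qvs.span_zero)

lemma finsupp_bar_face_sum: "finsupp (bar_face_sum G gs)"
proof (cases "gs = []")
  case False
  show ?thesis unfolding bar_face_sum_def if_not_P[OF False]
    by (intro finsupp_add finsupp_sum finsupp_scale finsupp_delta)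
qed (simp add: bar_face_sum_def)

lemma bar_boundary_zero: "bar_boundary G 0 = 0"
  unfolding bar_boundary_def by (rule lin_ext_zero)

lemma zero_in_bar_boundaries: "0 \<in> bar_boundaries G k"
  unfolding bar_boundaries_def using bar_boundary_zero[of G] bar_chains_zero[of G "Suc k"] by (metis imageI)

lemma finsupp_bar_boundaries: "b \<in> bar_boundaries G k \<Longrightarrow> finsupp b"
  unfolding bar_boundaries_def bar_boundary_def
  by (auto intro!: finsupp_lin_ext finsupp_bar_face_sum)

lemma telescope:
  fixes \<omega> :: "nat \<Rightarrow> 'a \<Rightarrow> rat"
  shows "(\<Sum>j\<in>{1..<Suc k}. qscale ((-1) ^ j) (\<omega> j + \<omega> (j - 1))) = qscale ((-1) ^ k) (\<omega> k) - \<omega> 0"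
proof (induction k)
  case (Suc k)
  have "(\<Sum>j\<in>{1..<Suc (Suc k)}. qscale ((-1) ^ j) (\<omega> j + \<omega> (j - 1)))
    = (\<Sum>j\<in>{1..<Suc k}. qscale ((-1) ^ j) (\<omega> j + \<omega> (j - 1)))
      + qscale ((-1) ^ Suc k) (\<omega> (Suc k) + \<omega> (Suc k - 1))"
    by (rule sum.atLeastLessThan_Suc) simp
  then show ?case unfolding Suc.IH by (simp add: qscale_def fun_eq_iff algebra_simps)
qed (simp add: qscale_def fun_eq_iff)

text \<open>Expanding the merged entries by additivity turns the faces of \<open>[g\<^sub>1 | \<dots> | g\<^sub>m]\<close> into a
  telescoping sum of wedges with one entry omitted.\<close>

lemma wedge_bar_face_sum:
  assumes add: "\<And>x y. x \<in> carrier G \<Longrightarrow> y \<in> carrier G \<Longrightarrow> \<phi> (x \<otimes>\<^bsub>G\<^esub> y) = \<phi> x + \<phi> y"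
    and gs: "set gs \<subseteq> carrier G"
  shows "lin_ext (\<lambda>hs. wedge (map \<phi> hs)) (bar_face_sum G gs) = 0"
proof (cases "length gs")
  case 0
  then show ?thesis by (simp add: bar_face_sum_def lin_ext_zero)
next
  case (Suc k)
  let ?L = "lin_ext (\<lambda>hs. wedge (map \<phi> hs))"
  define \<omega> where "\<omega> j = wedge (map \<phi> (take j gs @ drop (Suc j) gs))" for j
  have merge: "wedge (map \<phi> (take (j - 1) gs @ (gs ! (j - 1) \<otimes>\<^bsub>G\<^esub> gs ! j) # drop (j + 1) gs)) = \<omega> j + \<omega> (j - 1)"
    if j: "j \<in> {1..<Suc k}" for j
  proof -
    obtain i where i: "j = Suc i" using j by (cases j) auto
    have "gs ! i \<in> carrier G" "gs ! j \<in> carrier G" using gs Suc j i by (auto simp: subset_iff)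
    then have "\<phi> (gs ! i \<otimes>\<^bsub>G\<^esub> gs ! j) = \<phi> (gs ! i) + \<phi> (gs ! j)" by (rule add)
    moreover have "take j gs = take i gs @ [gs ! i]" "drop (Suc i) gs = gs ! j # drop (Suc j) gs"
      using Suc j i by (simp_all add: take_Suc_conv_app_nth Cons_nth_drop_Suc)
    ultimately show ?thesis by (simp add: \<omega>_def wedge_append_add i)
  qed
  have ne: "gs \<noteq> []" using Suc by auto
  have "?L (bar_face_sum G gs) = ?L (delta (tl gs))
      + (\<Sum>j\<in>{1..<Suc k}. qscale ((-1) ^ j)
          (?L (delta (take (j - 1) gs @ (gs ! (j - 1) \<otimes>\<^bsub>G\<^esub> gs ! j) # drop (j + 1) gs))))
      + qscale ((-1) ^ Suc k) (?L (delta (butlast gs)))"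
    unfolding bar_face_sum_def if_not_P[OF ne] Suc
    by (simp only: lin_ext_add lin_ext_sum lin_ext_scale finsupp_add finsupp_sum finsupp_scale finsupp_delta)
  also have "\<dots> = \<omega> 0 + (\<Sum>j\<in>{1..<Suc k}. qscale ((-1) ^ j) (\<omega> j + \<omega> (j - 1))) + qscale ((-1) ^ Suc k) (\<omega> k)"
    unfolding lin_ext_delta
  proof (intro arg_cong2[where f = "(+)"] sum.cong refl)
    show "wedge (map \<phi> (tl gs)) = \<omega> 0" by (simp add: \<omega>_def drop_Suc)
    show "qscale ((-1) ^ Suc k) (wedge (map \<phi> (butlast gs))) = qscale ((-1) ^ Suc k) (\<omega> k)"
      using Suc by (simp add: \<omega>_def butlast_conv_take)
  qed (simp only: merge)
  also have "\<dots> = 0" unfolding telescope by (auto simp: qscale_def fun_eq_iff)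
  finally show ?thesis .
qed

text \<open>Lets wedges of an additive map descend to homology; used for a group and again for its
  abelianization.\<close>

lemma wedge_bar_boundaries:
  assumes add: "\<And>x y. x \<in> carrier G \<Longrightarrow> y \<in> carrier G \<Longrightarrow> \<phi> (x \<otimes>\<^bsub>G\<^esub> y) = \<phi> x + \<phi> y"
    and b: "b \<in> bar_boundaries G k"
  shows "lin_ext (\<lambda>gs. wedge (map \<phi> gs)) b = 0"
proof -
  obtain c where c: "c \<in> bar_chains G (Suc k)" "b = lin_ext (bar_face_sum G) c"
    using b by (auto simp: bar_boundaries_def bar_boundary_def)
  have "lin_ext (\<lambda>gs. wedge (map \<phi> gs)) (bar_face_sum G gs) = 0" if "c gs \<noteq> 0" for gs
    using bar_chains_finsupp[OF c(1)] that by (intro wedge_bar_face_sum add) auto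
  then show ?thesis unfolding c(2) lin_ext_lin_ext[OF finsupp_bar_face_sum] by (rule lin_ext_neutral)
qed

section \<open>Abelian cycles of commuting elements\<close>

text \<open>The cyclic shift that will match last faces with first faces in an abelian cycle; what
  matters there is its sign.\<close>

lemma cycle_permutation:
  "\<exists>c. c permutes {0..<Suc k} \<and> sign c = (-1) ^ k \<and> (\<forall>j<k. c j = Suc j) \<and> c k = 0"
proof (induction k)
  case 0
  show ?case by (intro exI[of _ id] conjI allI impI permutes_id) simp_all
next
  case (Suc k)
  then obtain c where c: "c permutes {0..<Suc k}" "sign c = (-1) ^ k" "\<And>j. j < k \<Longrightarrow> c j = Suc j" "c k = 0"
    by blast
  let ?t = "transpose k (Suc k)"
  have c': "c permutes {0..<Suc (Suc k)}" using c(1) by (rule permutes_subset) auto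
  have t: "?t permutes {0..<Suc (Suc k)}" by (rule permutes_swap_id) auto
  have "c (Suc k) = Suc k" using c(1) by (rule permutes_not_in) auto
  moreover have "sign (c \<circ> ?t) = (-1) ^ Suc k"
    using sign_compose[of c ?t] c(1,2) t by (simp add: sign_swap_id permutes_imp_permutation[of "{0..<Suc k}"] permutation_swap_id)
  moreover have "(c \<circ> ?t) j = Suc j" if "j < Suc k" for j
  proof (cases "j = k")
    case True
    then show ?thesis using \<open>c (Suc k) = Suc k\<close> by simp
  next
    case False
    then show ?thesis using that c(3)[of j] by simp
  qed
  moreover have "(c \<circ> ?t) (Suc k) = 0" using c(4) by simp
  ultimately show ?case using permutes_compose[OF t c'] by blast
qed

text \<open>For commuting entries, the Pontryagin product of their one-dimensional classes, i.e. the
  image of the fundamental class of a torus.\<close>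

definition abelian_cycle :: "'a list \<Rightarrow> 'a list \<Rightarrow> rat"
  where "abelian_cycle fs = (\<Sum>p | p permutes {0..<length fs}.
    qscale (signof p) (delta (map (\<lambda>j. fs ! p j) [0..<length fs])))"

text \<open>An inner face merges two adjacent commuting entries, so exchanging them alters only the
  sign and these faces cancel in pairs. The first and last faces cancel against each other after a
  cyclic shift.\<close>

lemma abelian_cycle_in_bar_cycles:
  assumes fs: "set fs \<subseteq> carrier G" and comm: "\<And>x y. x \<in> set fs \<Longrightarrow> y \<in> set fs \<Longrightarrow> x \<otimes>\<^bsub>G\<^esub> y = y \<otimes>\<^bsub>G\<^esub> x"
  shows "abelian_cycle fs \<in> bar_cycles G (length fs)"
proof -
  let ?k = "length fs"
  let ?P = "{p. p permutes {0..<?k}}"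
  define w where "w p = map (\<lambda>j. fs ! p j) [0..<?k]" for p
  have len: "length (w p) = ?k" for p by (simp add: w_def)
  have mem: "fs ! p j \<in> set fs" if "p \<in> ?P" "j < ?k" for p j
    using that permutes_in_image[of p "{0..<?k}" j] by simp
  have chain: "abelian_cycle fs \<in> bar_chains G ?k"
    unfolding abelian_cycle_def bar_chains_def
  proof (intro qvs.span_sum qvs.span_scale qvs.span_base CollectI exI conjI)
    fix p assume "p \<in> ?P"
    then show "set (map (\<lambda>j. fs ! p j) [0..<?k]) \<subseteq> carrier G" using mem fs by auto
  qed auto
  have "bar_boundary G (abelian_cycle fs) = (\<Sum>p\<in>?P. qscale (signof p) (bar_face_sum G (w p)))"
    unfolding bar_boundary_def abelian_cycle_def w_def[symmetric]
    by (subst lin_ext_sum) (auto intro!: sum.cong simp: finsupp_scale finsupp_delta lin_ext_scale lin_ext_delta)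
  also have "\<dots> = 0"
  proof (cases "?k")
    case 0
    then show ?thesis by (simp add: bar_face_sum_def w_def qvs.scale_zero_right)
  next
    case (Suc k)
    have sum_neg: "S = 0" if "S = - S" for S :: "'a list \<Rightarrow> rat"
    proof
      fix x
      have "S x = - S x" using fun_cong[OF that, of x] by simp
      then show "S x = 0 x" by simp
    qed
    have sgn_comp: "signof (p \<circ> q) = (signof p * signof q :: rat)" if "p \<in> ?P" "q \<in> ?P" for p q
      using that by (auto intro!: signof_compose)
    define m where "m j p = take (j - 1) (w p) @ (w p ! (j - 1) \<otimes>\<^bsub>G\<^esub> w p ! j) # drop (j + 1) (w p)" for j p
    have inner: "(\<Sum>p\<in>?P. qscale (signof p) (delta (m j p))) = 0" if j: "j \<in> {1..<?k}" for j
    proof -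
      let ?t = "transpose (j - 1) j"
      have "j - 1 \<noteq> j" using j by auto
      then have st: "signof ?t = (-1 :: rat)" by (simp add: sign_swap_id)
      have t: "?t permutes {0..<?k}" using j by (intro permutes_swap_id) auto
      have mt: "m j (p \<circ> ?t) = m j p" if p: "p \<in> ?P" for p
      proof -
        have "fs ! p j \<otimes>\<^bsub>G\<^esub> fs ! p (j - 1) = fs ! p (j - 1) \<otimes>\<^bsub>G\<^esub> fs ! p j"
          using j by (intro comm mem[OF p]) auto
        moreover have "take (j - 1) (w (p \<circ> ?t)) = take (j - 1) (w p)"
          using j by (intro nth_equalityI) (auto simp: w_def transpose_def)
        moreover have "drop (j + 1) (w (p \<circ> ?t)) = drop (j + 1) (w p)"
          using j by (intro nth_equalityI) (auto simp: w_def transpose_def)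
        ultimately show ?thesis using j by (simp add: m_def w_def less_imp_diff_less)
      qed
      have "(\<Sum>p\<in>?P. qscale (signof p) (delta (m j p)))
        = (\<Sum>p\<in>?P. qscale (signof (p \<circ> ?t)) (delta (m j (p \<circ> ?t))))"
        by (rule sum_permutations_compose_right[OF t])
      also have "\<dots> = (\<Sum>p\<in>?P. - qscale (signof p) (delta (m j p)))"
        using sgn_comp t st mt by (intro sum.cong refl) (auto simp: qscale_def fun_eq_iff)
      also have "\<dots> = - (\<Sum>p\<in>?P. qscale (signof p) (delta (m j p)))" by (rule sum_negf)
      finally show ?thesis by (rule sum_neg)
    qed
    obtain c where c: "c permutes {0..<Suc k}" "sign c = (-1) ^ k" "\<And>j. j < k \<Longrightarrow> c j = Suc j"
      using cycle_permutation[of k] by blast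
    have cP: "c permutes {0..<?k}" using c Suc by simp
    have rot: "butlast (w (p \<circ> c)) = tl (w p)" for p
      using Suc c(3) by (intro nth_equalityI) (auto simp: w_def nth_butlast nth_tl simp del: upt_Suc)
    have "(\<Sum>p\<in>?P. qscale (signof p) (delta (butlast (w p))))
      = (\<Sum>p\<in>?P. qscale (signof (p \<circ> c)) (delta (butlast (w (p \<circ> c)))))"
      by (rule sum_permutations_compose_right[OF cP])
    also have "\<dots> = (\<Sum>p\<in>?P. qscale ((-1) ^ k) (qscale (signof p) (delta (tl (w p)))))"
      unfolding rot using sgn_comp cP c(2) by (intro sum.cong refl) (auto simp: qscale_def fun_eq_iff)
    finally have outer: "(\<Sum>p\<in>?P. qscale (signof p) (delta (butlast (w p))))
      = qscale ((-1) ^ k) (\<Sum>p\<in>?P. qscale (signof p) (delta (tl (w p))))"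
      by (simp only: qvs.scale_sum_right)
    \<comment> \<open>The shift of k + 1 entries has sign (-1)^k, the last face carries (-1)^(k +
      1), and the product is -1.\<close>
    have cancel: "S + 0 + qscale ((-1) ^ ?k) (qscale ((-1) ^ k) S) = 0" for S :: "'a list \<Rightarrow> rat"
    proof -
      have "(-1) ^ ?k * (-1) ^ k = (-1 :: rat)" unfolding Suc by (simp flip: power_mult_distrib)
      then show ?thesis unfolding qvs.scale_scale by (simp add: qscale_def fun_eq_iff)
    qed
    have ne: "w p \<noteq> []" for p using len[of p] Suc by auto
    have "(\<Sum>p\<in>?P. qscale (signof p) (bar_face_sum G (w p)))
      = (\<Sum>p\<in>?P. qscale (signof p) (delta (tl (w p)))
         + (\<Sum>j\<in>{1..<?k}. qscale ((-1) ^ j) (qscale (signof p) (delta (m j p))))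
         + qscale ((-1) ^ ?k) (qscale (signof p) (delta (butlast (w p)))))"
      unfolding bar_face_sum_def len m_def
      by (intro sum.cong refl) (simp only: ne if_False qvs.scale_right_distrib qvs.scale_sum_right qvs.scale_left_commute)
    also have "\<dots> = (\<Sum>p\<in>?P. qscale (signof p) (delta (tl (w p))))
         + (\<Sum>j\<in>{1..<?k}. qscale ((-1) ^ j) (\<Sum>p\<in>?P. qscale (signof p) (delta (m j p))))
         + qscale ((-1) ^ ?k) (\<Sum>p\<in>?P. qscale (signof p) (delta (butlast (w p))))"
      unfolding sum.distrib qvs.scale_sum_right by (subst sum.swap) (rule refl)
    also have "(\<Sum>j\<in>{1..<?k}. qscale ((-1) ^ j) (\<Sum>p\<in>?P. qscale (signof p) (delta (m j p)))) = 0"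
      by (intro sum.neutral ballI) (simp only: inner qvs.scale_zero_right)
    also have "(\<Sum>p\<in>?P. qscale (signof p) (delta (tl (w p)))) + 0
      + qscale ((-1) ^ ?k) (\<Sum>p\<in>?P. qscale (signof p) (delta (butlast (w p)))) = 0"
      unfolding outer by (rule cancel)
    finally show ?thesis .
  qed
  finally show ?thesis using chain by (simp add: bar_cycles_def)
qed

text \<open>Reordering the wedge reproduces the sign of the permutation, so all terms are equal.
  Their number cancels the factor 1 / k! in \<open>homology_to_ext\<close>.\<close>

lemma wedge_abelian_cycle:
  "lin_ext (\<lambda>hs. wedge (map \<phi> hs)) (abelian_cycle fs) = qscale (fact (length fs)) (wedge (map \<phi> fs))"
proof -
  let ?k = "length fs"
  let ?P = "{p. p permutes {0..<?k}}"
  have "lin_ext (\<lambda>hs. wedge (map \<phi> hs)) (abelian_cycle fs)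
    = (\<Sum>p\<in>?P. qscale (signof p) (wedge (map \<phi> (map (\<lambda>j. fs ! p j) [0..<?k]))))"
    unfolding abelian_cycle_def
    by (subst lin_ext_sum) (auto intro!: sum.cong simp: finsupp_scale finsupp_delta lin_ext_scale lin_ext_delta)
  also have "\<dots> = (\<Sum>p\<in>?P. wedge (map \<phi> fs))"
  proof (rule sum.cong)
    fix p assume p: "p \<in> ?P"
    have "map \<phi> (map (\<lambda>j. fs ! p j) [0..<?k]) = map (\<lambda>j. map \<phi> fs ! p j) [0..<length (map \<phi> fs)]"
      using p permutes_in_image[of p "{0..<?k}"] by auto
    moreover have "p permutes {0..<length (map \<phi> fs)}" using p by simp
    ultimately have "qscale (signof p) (wedge (map \<phi> (map (\<lambda>j. fs ! p j) [0..<?k])))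
      = qscale (signof p) (qscale (signof p) (wedge (map \<phi> fs)))"
      by (simp only: wedge_permute)
    also have "\<dots> = wedge (map \<phi> fs)"
      using signof_pm_one[of p] by (auto simp: qscale_def fun_eq_iff sign_def)
    finally show "qscale (signof p) (wedge (map \<phi> (map (\<lambda>j. fs ! p j) [0..<?k]))) = wedge (map \<phi> fs)" .
  qed simp
  also have "\<dots> = qscale (fact ?k) (wedge (map \<phi> fs))"
  proof
    fix bs
    have "card ?P = fact ?k" by (rule card_permutations) auto
    then have "(\<Sum>p\<in>?P. wedge (map \<phi> fs) bs) = fact ?k * wedge (map \<phi> fs) bs"
      by (simp only: sum_constant of_nat_fact)
    then show "(\<Sum>p\<in>?P. wedge (map \<phi> fs)) bs = qscale (fact ?k) (wedge (map \<phi> fs)) bs"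
      by (simp only: sum_pointwise qscale_def)
  qed
  finally show ?thesis .
qed

section \<open>Albanese homology evaluated by an additive map\<close>

text \<open>Additivity alone carries a map through the abelianization, bar homology and the
  presentation of the exterior power. The instance in view is the Johnson homomorphism, with
  \<open>quot\<close> becoming \<open>johnson_ab\<close>.\<close>

locale additive_map = group G for G :: "('a, 'm) monoid_scheme" (structure) +
  fixes \<phi> :: "'a \<Rightarrow> 'b \<Rightarrow> rat"
  assumes additive: "\<And>x y. x \<in> carrier G \<Longrightarrow> y \<in> carrier G \<Longrightarrow> \<phi> (x \<otimes> y) = \<phi> x + \<phi> y"
begin

lemma additive_one: "\<phi> \<one> = 0"
  using additive[OF one_closed one_closed] by (simp only: l_one[OF one_closed] add_cancel_right_right)

lemma additive_inv: "x \<in> carrier G \<Longrightarrow> \<phi> (inv x) = - \<phi> x"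
  using additive[of "inv x" x] additive_one by (simp add: eq_neg_iff_add_eq_0)

lemma additive_derived:
  assumes "d \<in> derived G (carrier G)"
  shows "\<phi> d = 0"
proof -
  have c: "x \<in> carrier G \<and> y \<in> carrier G \<Longrightarrow> \<phi> (x \<otimes> y \<otimes> inv x \<otimes> inv y) = 0" for x y
    by (simp add: additive additive_inv)
  have "d \<in> carrier G \<and> \<phi> d = 0"
    using assms unfolding derived_def
  proof (induction rule: generate.induct)
    case (inv h)
    then have "h \<in> carrier G" "\<phi> h = 0" using c by auto
    then show ?case using additive_inv[of h] by auto
  next
    case (eng h1 h2)
    then show ?case using additive[of h1 h2] by auto
  qed (use c additive_one in auto)
  then show ?thesis ..
qed

abbreviation (input) A where "A \<equiv> abelianization G"

definition quot :: "'a set \<Rightarrow> 'b \<Rightarrow> rat"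
  where "quot X = the_elem (\<phi> ` X)"

lemma quot_to_abelianization:
  assumes "g \<in> carrier G"
  shows "quot (to_abelianization G g) = \<phi> g"
proof -
  have sub: "subgroup (derived G (carrier G)) G" by (rule derived_is_subgroup) simp
  have "\<phi> ` to_abelianization G g = {\<phi> g}"
  proof
    show "\<phi> ` to_abelianization G g \<subseteq> {\<phi> g}"
    proof
      fix v assume "v \<in> \<phi> ` to_abelianization G g"
      then obtain d where d: "d \<in> derived G (carrier G)" "v = \<phi> (d \<otimes> g)"
        by (auto simp: to_abelianization_def r_coset_def)
      have "\<phi> (d \<otimes> g) = \<phi> d + \<phi> g" using additive subgroup.mem_carrier[OF sub d(1)] assms by blast
      then show "v \<in> {\<phi> g}" using d additive_derived by simp
    qed
    show "{\<phi> g} \<subseteq> \<phi> ` to_abelianization G g"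
      using rcos_self[OF assms sub] by (auto simp: to_abelianization_def)
  qed
  then show ?thesis by (simp add: quot_def)
qed

lemma carrier_abelianization: "X \<in> carrier A \<Longrightarrow> \<exists>g\<in>carrier G. X = to_abelianization G g"
  by (auto simp: abelianization_def FactGroup_def RCOSETS_def to_abelianization_def)

lemma quot_additive:
  assumes "X \<in> carrier A" "Y \<in> carrier A"
  shows "quot (X \<otimes>\<^bsub>A\<^esub> Y) = quot X + quot Y"
proof -
  obtain g h where gh: "g \<in> carrier G" "h \<in> carrier G" "X = to_abelianization G g" "Y = to_abelianization G h"
    using assms carrier_abelianization by metis
  interpret N: normal "derived G (carrier G)" G by (rule derived_self_is_normal)
  have "X \<otimes>\<^bsub>A\<^esub> Y = to_abelianization G (g \<otimes> h)"
    using gh by (simp add: abelianization_def FactGroup_def to_abelianization_def N.rcos_sum)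
  then show ?thesis using gh by (simp only: quot_to_abelianization m_closed additive)
qed

abbreviation (input) LA :: "('a set list \<Rightarrow> rat) \<Rightarrow> 'b list \<Rightarrow> rat"
  where "LA \<equiv> lin_ext (\<lambda>Xs. wedge (map quot Xs))"

text \<open>The relations are additivity in an entry and vanishing at a repeated entry, which
  \<open>wedge\<close> obeys. Finite support is part of the induction because \<open>lin_ext\<close>
  is linear only there.\<close>

lemma LA_ext_relations:
  assumes "r \<in> ext_relations A k"
  shows "finsupp r \<and> LA r = 0"
  using assms unfolding ext_relations_def
proof (induction rule: qvs.span_induct_alt)
  case base
  show ?case by (simp only: lin_ext_zero finsupp_zero simp_thms)
next
  case (step s x y)
  have x: "finsupp x \<and> LA x = 0"
    using step.hyps
  proof
    assume "x \<in> {delta (us @ [a \<otimes>\<^bsub>A\<^esub> b] @ vs) - delta (us @ [a] @ vs) - delta (us @ [b] @ vs) | us a b vs.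
        length us + 1 + length vs = k \<and> set us \<union> {a, b} \<union> set vs \<subseteq> carrier A}"
    then obtain us a b vs where x: "x = delta (us @ [a \<otimes>\<^bsub>A\<^esub> b] @ vs) - delta (us @ [a] @ vs) - delta (us @ [b] @ vs)"
      and ab: "a \<in> carrier A" "b \<in> carrier A" by auto
    have "LA x = LA (delta (us @ [a \<otimes>\<^bsub>A\<^esub> b] @ vs)) - LA (delta (us @ [a] @ vs)) - LA (delta (us @ [b] @ vs))"
      unfolding x by (simp only: lin_ext_diff finsupp_diff finsupp_delta)
    also have "\<dots> = 0"
      unfolding lin_ext_delta by (simp add: quot_additive[OF ab] wedge_append_add)
    finally show ?thesis unfolding x by (simp only: finsupp_diff finsupp_delta simp_thms)
  next
    assume "x \<in> {delta (us @ [a] @ vs @ [a] @ ws) | us a vs ws.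
        length us + 1 + length vs + 1 + length ws = k \<and>
        set us \<union> {a} \<union> set vs \<union> set ws \<subseteq> carrier A}"
    then obtain us a vs ws where x: "x = delta (us @ [a] @ vs @ [a] @ ws)" by auto
    have "wedge (map quot (us @ [a] @ vs @ [a] @ ws)) = 0"
      by (rule wedge_repeated[of "length us" _ "length us + 1 + length vs"]) (auto simp: nth_append)
    then show ?thesis unfolding x lin_ext_delta by (simp only: finsupp_delta simp_thms)
  qed
  then show ?case
    using step.IH by (simp only: finsupp_add finsupp_scale lin_ext_add lin_ext_scale qvs.scale_zero_right add_0 simp_thms)
qed

text \<open>\<open>the_elem\<close> is applied to the values at all representatives of nested
  cosets. Boundaries of \<open>G\<close>, boundaries of its abelianization and exterior relations
  all evaluate to 0, so there is a single value.\<close>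

lemma albanese_value:
  assumes z: "z \<in> bar_cycles G k"
  shows "the_elem (LA ` homology_to_ext A k
      (grp_homology_map A (to_abelianization G) k (z +o bar_boundaries G k)))
    = qscale (1 / fact k) (lin_ext (\<lambda>gs. wedge (map \<phi> gs)) z)"
proof -
  let ?\<pi> = "lin_ext (\<lambda>gs. delta (map (to_abelianization G) gs))"
  let ?L = "lin_ext (\<lambda>gs. wedge (map \<phi> gs))"
  let ?v = "qscale (1 / fact k) (?L z)"
  have zc: "z \<in> bar_chains G k" using z by (simp add: bar_cycles_def)
  let ?\<psi> = "\<lambda>g. quot (to_abelianization G g)"
  have \<psi>: "?\<psi> (x \<otimes> y) = ?\<psi> x + ?\<psi> y" if "x \<in> carrier G" "y \<in> carrier G" for x y
    using that by (simp only: quot_to_abelianization m_closed additive)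
  have cycle: "finsupp (?\<pi> (z + b)) \<and> LA (?\<pi> (z + b)) = ?L z" if b: "b \<in> bar_boundaries G k" for b
  proof -
    let ?M = "lin_ext (\<lambda>gs. wedge (map ?\<psi> gs))"
    have "LA (?\<pi> (z + b)) = lin_ext (\<lambda>gs. LA (delta (map (to_abelianization G) gs))) (z + b)"
      by (rule lin_ext_lin_ext) (rule finsupp_delta)
    also have "\<dots> = ?M (z + b)" by (simp add: lin_ext_delta comp_def)
    also have "\<dots> = ?M z + ?M b"
      using bar_chains_finsupp[OF zc] finsupp_bar_boundaries[OF b] by (intro lin_ext_add) auto
    also have "?M z = ?L z"
    proof (rule lin_ext_cong)
      fix gs assume "z gs \<noteq> 0"
      then have "map ?\<psi> gs = map \<phi> gs"
        using bar_chains_finsupp[OF zc] quot_to_abelianization by auto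
      then show "wedge (map ?\<psi> gs) = wedge (map \<phi> gs)" by (simp only:)
    qed
    also have "?M b = 0" by (rule wedge_bar_boundaries[OF \<psi> b])
    finally show ?thesis using finsupp_lin_ext[OF finsupp_delta] by (simp only: add_0_right simp_thms)
  qed
  have "LA ` homology_to_ext A k (grp_homology_map A (to_abelianization G) k (z +o bar_boundaries G k)) = {?v}"
  proof (intro equalityI subsetI)
    fix v assume "v \<in> LA ` homology_to_ext A k (grp_homology_map A (to_abelianization G) k (z +o bar_boundaries G k))"
    then obtain b b' r where bbr: "b \<in> bar_boundaries G k" "b' \<in> bar_boundaries A k" "r \<in> ext_relations A k"
      and v: "v = LA (qscale (1 / fact k) (?\<pi> (z + b) + b') + r)"
      by (auto simp: homology_to_ext_def grp_homology_map_def set_plus_def elt_set_plus_def)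
    have "v = qscale (1 / fact k) (LA (?\<pi> (z + b)) + LA b') + LA r"
      unfolding v using cycle[OF bbr(1)] finsupp_bar_boundaries[OF bbr(2)] LA_ext_relations[OF bbr(3)]
      by (simp only: lin_ext_add lin_ext_scale finsupp_add finsupp_scale)
    then show "v \<in> {?v}"
      using cycle[OF bbr(1)] wedge_bar_boundaries[OF quot_additive bbr(2)] LA_ext_relations[OF bbr(3)]
      by (simp only: add_0_right singleton_iff)
  next
    \<comment> \<open>The zero representatives show that the value is attained.\<close>
    fix v assume "v \<in> {?v}"
    have r0: "0 \<in> ext_relations A k" unfolding ext_relations_def by (rule qvs.span_zero)
    have "qscale (1 / fact k) (?\<pi> (z + 0) + 0) + 0
        \<in> homology_to_ext A k (grp_homology_map A (to_abelianization G) k (z +o bar_boundaries G k))"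
      unfolding homology_to_ext_def grp_homology_map_def
      by (intro set_plus_intro imageI r0 zero_in_bar_boundaries) (auto simp: elt_set_plus_def intro: zero_in_bar_boundaries)
    moreover have "LA (qscale (1 / fact k) (?\<pi> (z + 0) + 0) + 0) = ?v"
      using cycle[OF zero_in_bar_boundaries] by (simp only: add_0_right lin_ext_scale)
    ultimately show "v \<in> LA ` homology_to_ext A k (grp_homology_map A (to_abelianization G) k (z +o bar_boundaries G k))"
      using \<open>v \<in> {?v}\<close> by (metis imageI singletonD)
  qed
  then show ?thesis by simp
qed

end

section \<open>The Johnson homomorphism\<close>

global_interpretation au: group "AutoGroup (free_grp n)" for n
  by (rule fg.AutoGroup)

lemma carrier_AutoGroup: "carrier (AutoGroup G) = auto G"
  by (simp add: AutoGroup_def)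

lemma auto_closed: "f \<in> auto G \<Longrightarrow> x \<in> carrier G \<Longrightarrow> f x \<in> carrier G"
  by (auto simp: auto_def hom_def)

lemma auto_hom: "f \<in> auto G \<Longrightarrow> x \<in> carrier G \<Longrightarrow> y \<in> carrier G \<Longrightarrow> f (x \<otimes>\<^bsub>G\<^esub> y) = f x \<otimes>\<^bsub>G\<^esub> f y"
  by (auto simp: auto_def hom_def)

lemma auto_inv:
  assumes "f \<in> auto (free_grp n)" "x \<in> carrier (free_grp n)"
  shows "f (inv\<^bsub>free_grp n\<^esub> x) = inv\<^bsub>free_grp n\<^esub> f x"
proof -
  interpret group_hom "free_grp n" "free_grp n" f
    using assms(1) group_free_grp by (simp add: group_hom_def group_hom_axioms_def auto_def)
  show ?thesis using assms(2) by (rule hom_inv)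
qed

lemma auto_comm:
  assumes "f \<in> auto (free_grp n)" "x \<in> carrier (free_grp n)" "y \<in> carrier (free_grp n)"
  shows "f (comm n x y) = comm n (f x) (f y)"
  using assms by (simp add: auto_hom auto_inv)

lemma AutoGroup_mult_apply:
  assumes "f \<in> auto G" "g \<in> auto G" "x \<in> carrier G"
  shows "(f \<otimes>\<^bsub>AutoGroup G\<^esub> g) x = f (g x)"
  using assms by (simp add: AutoGroup_def BijGroup_def auto_def compose_eq)

lemma AutoGroup_one_apply: "x \<in> carrier G \<Longrightarrow> \<one>\<^bsub>AutoGroup G\<^esub> x = x"
  by (simp add: AutoGroup_def BijGroup_def)

lemma auto_eqI:
  assumes "f \<in> auto G" "g \<in> auto G" "\<And>x. x \<in> carrier G \<Longrightarrow> f x = g x"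
  shows "f = g"
  using assms by (intro extensionalityI[of _ "carrier G"]) (auto simp: auto_def Bij_def)

lemma auto_inv_apply:
  assumes "f \<in> auto (free_grp n)" "x \<in> carrier (free_grp n)"
  shows "f ((inv\<^bsub>AutoGroup (free_grp n)\<^esub> f) x) = x" "(inv\<^bsub>AutoGroup (free_grp n)\<^esub> f) (f x) = x"
proof -
  let ?A = "AutoGroup (free_grp n)"
  have f: "f \<in> carrier ?A" using assms(1) by (simp add: carrier_AutoGroup)
  have i: "inv\<^bsub>?A\<^esub> f \<in> auto (free_grp n)" using au.inv_closed[OF f] by (simp add: carrier_AutoGroup)
  have "(f \<otimes>\<^bsub>?A\<^esub> inv\<^bsub>?A\<^esub> f) x = x" unfolding au.r_inv[OF f] by (rule AutoGroup_one_apply[OF assms(2)])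
  then show "f ((inv\<^bsub>?A\<^esub> f) x) = x" unfolding AutoGroup_mult_apply[OF assms(1) i assms(2)] .
  have "(inv\<^bsub>?A\<^esub> f \<otimes>\<^bsub>?A\<^esub> f) x = x" unfolding au.l_inv[OF f] by (rule AutoGroup_one_apply[OF assms(2)])
  then show "(inv\<^bsub>?A\<^esub> f) (f x) = x" unfolding AutoGroup_mult_apply[OF i assms(1) assms(2)] .
qed

lemma H_class_auto:
  assumes "f \<in> auto (free_grp n)" "w \<in> carrier (free_grp n)"
  shows "H_class (f w) = (\<Sum>k<n. qscale (H_class w k) (H_class (f (free_gen k))))"
  by (rule additive_expansion[where D = "\<lambda>w. H_class (f w)", OF _ assms(2)])
    (simp only: auto_hom[OF assms(1)] H_class_mult)

text \<open>Turns a matrix condition on the generators into a condition on all words, which passes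
  to composites and inverses at once.\<close>

lemma carrier_IA: "f \<in> carrier (IA n) \<longleftrightarrow>
  f \<in> auto (free_grp n) \<and> (\<forall>w\<in>carrier (free_grp n). H_class (f w) = H_class w)"
proof (cases "f \<in> auto (free_grp n)")
  case True
  have "abel_mat n f = 1\<^sub>m n \<longleftrightarrow> (\<forall>w\<in>carrier (free_grp n). H_class (f w) = H_class w)"
  proof
    assume eq: "abel_mat n f = 1\<^sub>m n"
    have gen: "H_class (f (free_gen l)) = H_class (free_gen l)" if l: "l < n" for l
    proof
      fix k
      show "H_class (f (free_gen l)) k = H_class (free_gen l) k"
      proof (cases "k < n")
        case True
        have "abel_mat n f $$ (k, l) = 1\<^sub>m n $$ (k, l)" unfolding eq ..
        then show ?thesis using l True by (simp add: abel_mat_def H_class_def exp_sum_free_gen)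
      next
        case False
        have "f (free_gen l) \<in> carrier (free_grp n)" using auto_closed[OF \<open>f \<in> _\<close>] l by simp
        then show ?thesis using False l by (simp add: H_class_def exp_sum_outside[of _ n] exp_sum_free_gen)
      qed
    qed
    show "\<forall>w\<in>carrier (free_grp n). H_class (f w) = H_class w"
    proof
      fix w assume w: "w \<in> carrier (free_grp n)"
      have "H_class (f w) = (\<Sum>k<n. qscale (H_class w k) (H_class (free_gen k)))"
        unfolding H_class_auto[OF True w] by (intro sum.cong refl) (simp add: gen)
      then show "H_class (f w) = H_class w"
        unfolding additive_expansion[where D = H_class, OF H_class_mult w, symmetric] .
    qed
  next
    assume H: "\<forall>w\<in>carrier (free_grp n). H_class (f w) = H_class w"
    show "abel_mat n f = 1\<^sub>m n"
    proof (rule eq_matI)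
      fix k l assume kl: "k < dim_row (1\<^sub>m n :: int mat)" "l < dim_col (1\<^sub>m n :: int mat)"
      then have "H_class (f (free_gen l)) k = H_class (free_gen l) k" using H by simp
      then show "abel_mat n f $$ (k, l) = 1\<^sub>m n $$ (k, l)"
        using kl by (simp add: abel_mat_def H_class_def exp_sum_free_gen)
    qed (simp_all add: abel_mat_def)
  qed
  then show ?thesis
    using True by (simp add: IA_def kernel_def carrier_AutoGroup GL_int_def units_of_def ring_mat_def)
next
  case False
  then show ?thesis by (simp add: IA_def kernel_def carrier_AutoGroup)
qed

lemma mult_IA: "f \<otimes>\<^bsub>IA n\<^esub> g = f \<otimes>\<^bsub>AutoGroup (free_grp n)\<^esub> g"
  by (simp add: IA_def)

lemma group_IA: "group (IA n)"
proof -
  let ?A = "AutoGroup (free_grp n)"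
  have eq: "IA n = ?A\<lparr>carrier := carrier (IA n)\<rparr>" by (simp add: IA_def)
  have "subgroup (carrier (IA n)) ?A"
  proof (rule au.subgroupI)
    show "carrier (IA n) \<subseteq> carrier ?A" by (auto simp: carrier_IA carrier_AutoGroup)
    have "\<one>\<^bsub>?A\<^esub> \<in> carrier (IA n)"
      using au.one_closed by (auto simp: carrier_IA carrier_AutoGroup AutoGroup_one_apply)
    then show "carrier (IA n) \<noteq> {}" by blast
  next
    fix f assume f: "f \<in> carrier (IA n)"
    then have fa: "f \<in> auto (free_grp n)" by (simp add: carrier_IA)
    have i: "inv\<^bsub>?A\<^esub> f \<in> auto (free_grp n)" using au.inv_closed[of f] fa by (simp add: carrier_AutoGroup)
    have "H_class ((inv\<^bsub>?A\<^esub> f) w) = H_class w" if w: "w \<in> carrier (free_grp n)" for w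
    proof -
      have "H_class ((inv\<^bsub>?A\<^esub> f) w) = H_class (f ((inv\<^bsub>?A\<^esub> f) w))"
        using f auto_closed[OF i w] by (simp add: carrier_IA)
      then show ?thesis by (simp only: auto_inv_apply[OF fa w])
    qed
    then show "inv\<^bsub>?A\<^esub> f \<in> carrier (IA n)" using i by (simp add: carrier_IA)
  next
    fix f g assume f: "f \<in> carrier (IA n)" and g: "g \<in> carrier (IA n)"
    have a: "f \<in> auto (free_grp n)" "g \<in> auto (free_grp n)" using f g by (simp_all add: carrier_IA)
    have "f \<otimes>\<^bsub>?A\<^esub> g \<in> auto (free_grp n)" using au.m_closed[of f n g] a by (simp add: carrier_AutoGroup)
    then show "f \<otimes>\<^bsub>?A\<^esub> g \<in> carrier (IA n)"
      using f g a by (simp add: carrier_IA AutoGroup_mult_apply auto_closed)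
  qed
  then show ?thesis using au.subgroup_imp_group eq by metis
qed

lemma IA_displacement:
  assumes f: "f \<in> carrier (IA n)" and w: "w \<in> carrier (free_grp n)"
  shows "inv\<^bsub>free_grp n\<^esub> w \<otimes>\<^bsub>free_grp n\<^esub> f w \<in> lcs2 n"
    and "H_class (inv\<^bsub>free_grp n\<^esub> w \<otimes>\<^bsub>free_grp n\<^esub> f w) = 0"
    and "inv\<^bsub>free_grp n\<^esub> w \<otimes>\<^bsub>free_grp n\<^esub> f w \<in> carrier (free_grp n)"
proof -
  have fa: "f \<in> auto (free_grp n)" and fH: "H_class (f w) = H_class w" using f w by (auto simp: carrier_IA)
  show c: "inv\<^bsub>free_grp n\<^esub> w \<otimes>\<^bsub>free_grp n\<^esub> f w \<in> carrier (free_grp n)"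
    using auto_closed[OF fa w] w by simp
  show H: "H_class (inv\<^bsub>free_grp n\<^esub> w \<otimes>\<^bsub>free_grp n\<^esub> f w) = 0"
    unfolding H_class_mult H_class_inv[OF w] fH by simp
  show "inv\<^bsub>free_grp n\<^esub> w \<otimes>\<^bsub>free_grp n\<^esub> f w \<in> lcs2 n" by (rule H_class_zero_imp_lcs2[OF c H])
qed

text \<open>The value on a commutator depends only on classes in H, which IA-automorphisms fix;
  hence they act trivially on the second graded piece.\<close>

lemma quad_IA:
  assumes f: "f \<in> carrier (IA n)" and u: "u \<in> lcs2 n"
  shows "quad (f u) = quad u"
proof -
  have fa: "f \<in> auto (free_grp n)"
    and fH: "\<And>w. w \<in> carrier (free_grp n) \<Longrightarrow> H_class (f w) = H_class w"
    using f by (auto simp: carrier_IA)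
  have fH0: "H_class (f v) = 0" if "v \<in> lcs2 n" for v
    unfolding fH[OF lcs2_carrier[OF that]] by (rule H_class_lcs2[OF that])
  show ?thesis
    using u
  proof (induction rule: lcs2_induct)
    case one
    have "f \<one>\<^bsub>free_grp n\<^esub> = \<one>\<^bsub>free_grp n\<^esub>"
      using fa group_free_grp hom_one[of f "free_grp n" "free_grp n"] by (auto simp: auto_def)
    then show ?case by simp
  next
    case (comm x y)
    then show ?case by (simp only: auto_comm[OF fa] quad_comm auto_closed[OF fa] fH)
  next
    case (mult u v)
    have "quad (f u \<otimes>\<^bsub>free_grp n\<^esub> f v) = quad (f u) + quad (f v)"
      by (rule quad_mult) (use fH0[OF mult(1)] in blast)
    moreover have "quad (u \<otimes>\<^bsub>free_grp n\<^esub> v) = quad u + quad v"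
      by (rule quad_mult) (use H_class_lcs2[OF mult(1)] in blast)
    ultimately show ?case by (simp only: auto_hom[OF fa] lcs2_carrier mult)
  next
    case (inv u)
    note c = lcs2_carrier[OF inv(1)]
    show ?case
      unfolding auto_inv[OF fa c] quad_inv[OF auto_closed[OF fa c] fH0[OF inv(1)]]
        quad_inv[OF c H_class_lcs2[OF inv(1)]] inv(2) ..
  qed
qed

lemma tensor_add: "tensor (x + y) z = tensor x z + tensor y z"
  by (auto simp: tensor_def fun_eq_iff algebra_simps)

lemma johnson_eq:
  assumes "f \<in> carrier (IA n)"
  shows "johnson n f = (\<Sum>k<n. tensor (quad (inv\<^bsub>free_grp n\<^esub> free_gen k \<otimes>\<^bsub>free_grp n\<^esub> f (free_gen k))) (delta k))"
  unfolding johnson_def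
proof (rule sum.cong)
  fix k assume "k \<in> {..<n}"
  then have "inv\<^bsub>free_grp n\<^esub> free_gen k \<otimes>\<^bsub>free_grp n\<^esub> f (free_gen k) \<in> lcs2 n"
    by (intro IA_displacement(1)[OF assms]) simp
  then show "tensor (gr2 n (inv\<^bsub>free_grp n\<^esub> free_gen k \<otimes>\<^bsub>free_grp n\<^esub> f (free_gen k))) (delta k)
    = tensor (quad (inv\<^bsub>free_grp n\<^esub> free_gen k \<otimes>\<^bsub>free_grp n\<^esub> f (free_gen k))) (delta k)"
    by (simp only: gr2_eq_quad)
qed simp

lemma (in group) cancel_middle:
  "a \<in> carrier G \<Longrightarrow> b \<in> carrier G \<Longrightarrow> c \<in> carrier G \<Longrightarrow> (a \<otimes> b) \<otimes> (inv b \<otimes> c) = a \<otimes> c"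
  by (metis inv_closed l_one m_assoc m_closed r_inv)

text \<open>From w^-1 f(g w) = (w^-1 f(w)) f(w^-1 g(w)): the first factor has class zero, so
  \<open>quad\<close> is additive here, and \<open>quad_IA\<close> removes the outer
  \<open>f\<close>.\<close>

lemma quad_displacement_mult:
  assumes f: "f \<in> carrier (IA n)" and g: "g \<in> carrier (IA n)" and w: "w \<in> carrier (free_grp n)"
  shows "quad (inv\<^bsub>free_grp n\<^esub> w \<otimes>\<^bsub>free_grp n\<^esub> f (g w))
    = quad (inv\<^bsub>free_grp n\<^esub> w \<otimes>\<^bsub>free_grp n\<^esub> f w) + quad (inv\<^bsub>free_grp n\<^esub> w \<otimes>\<^bsub>free_grp n\<^esub> g w)"
proof -
  have fa: "f \<in> auto (free_grp n)" and ga: "g \<in> auto (free_grp n)" using f g by (auto simp: carrier_IA)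
  note fw = auto_closed[OF fa w] and gw = auto_closed[OF ga w]
  have iw: "inv\<^bsub>free_grp n\<^esub> w \<in> carrier (free_grp n)" using w by simp
  have "(inv\<^bsub>free_grp n\<^esub> w \<otimes>\<^bsub>free_grp n\<^esub> f w) \<otimes>\<^bsub>free_grp n\<^esub> f (inv\<^bsub>free_grp n\<^esub> w \<otimes>\<^bsub>free_grp n\<^esub> g w)
    = inv\<^bsub>free_grp n\<^esub> w \<otimes>\<^bsub>free_grp n\<^esub> f (g w)"
    unfolding auto_hom[OF fa iw gw] auto_inv[OF fa w]
    by (rule fg.cancel_middle[OF iw fw auto_closed[OF fa gw]])
  moreover have "quad ((inv\<^bsub>free_grp n\<^esub> w \<otimes>\<^bsub>free_grp n\<^esub> f w) \<otimes>\<^bsub>free_grp n\<^esub> f (inv\<^bsub>free_grp n\<^esub> w \<otimes>\<^bsub>free_grp n\<^esub> g w))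
    = quad (inv\<^bsub>free_grp n\<^esub> w \<otimes>\<^bsub>free_grp n\<^esub> f w) + quad (f (inv\<^bsub>free_grp n\<^esub> w \<otimes>\<^bsub>free_grp n\<^esub> g w))"
    by (rule quad_mult) (use IA_displacement(2)[OF f w] in blast)
  ultimately show ?thesis by (simp only: quad_IA[OF f IA_displacement(1)[OF g w]])
qed

lemma johnson_additive:
  assumes f: "f \<in> carrier (IA n)" and g: "g \<in> carrier (IA n)"
  shows "johnson n (f \<otimes>\<^bsub>IA n\<^esub> g) = johnson n f + johnson n g"
proof -
  interpret I: group "IA n" by (rule group_IA)
  have a: "f \<in> auto (free_grp n)" "g \<in> auto (free_grp n)" using f g by (auto simp: carrier_IA)
  show ?thesis
    unfolding johnson_eq[OF f] johnson_eq[OF g] johnson_eq[OF I.m_closed[OF f g]] sum.distrib[symmetric]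
  proof (rule sum.cong)
    fix k assume "k \<in> {..<n}"
    then have k: "free_gen k \<in> carrier (free_grp n)" by simp
    show "tensor (quad (inv\<^bsub>free_grp n\<^esub> free_gen k \<otimes>\<^bsub>free_grp n\<^esub> (f \<otimes>\<^bsub>IA n\<^esub> g) (free_gen k))) (delta k) =
      tensor (quad (inv\<^bsub>free_grp n\<^esub> free_gen k \<otimes>\<^bsub>free_grp n\<^esub> f (free_gen k))) (delta k) +
      tensor (quad (inv\<^bsub>free_grp n\<^esub> free_gen k \<otimes>\<^bsub>free_grp n\<^esub> g (free_gen k))) (delta k)"
      unfolding mult_IA AutoGroup_mult_apply[OF a k] quad_displacement_mult[OF f g k] tensor_add ..
  qed simp
qed

lemma additive_map_johnson: "additive_map (IA n) (johnson n)"
  using group_IA[of n] johnson_additive[of _ n] by (simp add: additive_map_def additive_map_axioms_def)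

text \<open>Eliminates the abelianization and all cosets; what remains is evaluation on bar
  cycles.\<close>

lemma albanese_IA_eq: "albanese_IA n i =
  (\<lambda>z. qscale (1 / fact i) (lin_ext (\<lambda>fs. wedge (map (johnson n) fs)) z)) ` bar_cycles (IA n) i"
proof -
  interpret J: additive_map "IA n" "johnson n" by (rule additive_map_johnson)
  have "johnson_ab n = J.quot" by (simp add: fun_eq_iff johnson_ab_def J.quot_def)
  then have "johnson_ext n (homology_to_ext (abelianization (IA n)) i
      (grp_homology_map (abelianization (IA n)) (to_abelianization (IA n)) i (z +o bar_boundaries (IA n) i)))
    = qscale (1 / fact i) (lin_ext (\<lambda>fs. wedge (map (johnson n) fs)) z)"
    if "z \<in> bar_cycles (IA n) i" for z
    using J.albanese_value[OF that] by (simp only: johnson_ext_def)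
  moreover have "grp_homology (IA n) i = (\<lambda>z. z +o bar_boundaries (IA n) i) ` bar_cycles (IA n) i"
    by (auto simp: grp_homology_def)
  ultimately show ?thesis
    unfolding albanese_IA_def albanese_homology_def by (simp add: image_image cong: image_cong)
qed

lemma subspace_bar_cycles: "qvs.subspace (bar_cycles G k)"
  unfolding qvs.subspace_def
proof (intro conjI ballI allI)
  show "0 \<in> bar_cycles G k" by (simp only: bar_cycles_def mem_Collect_eq bar_chains_zero bar_boundary_zero simp_thms)
next
  fix x y assume "x \<in> bar_cycles G k" "y \<in> bar_cycles G k"
  then have xy: "x \<in> bar_chains G k" "y \<in> bar_chains G k" "bar_boundary G x = 0" "bar_boundary G y = 0"
    by (auto simp: bar_cycles_def)
  have "bar_boundary G (x + y) = bar_boundary G x + bar_boundary G y"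
    unfolding bar_boundary_def using xy(1,2)[THEN bar_chains_finsupp] by (intro lin_ext_add) auto
  also have "\<dots> = 0" by (simp only: xy add_0_right)
  moreover have "x + y \<in> bar_chains G k"
    using xy(1,2) unfolding bar_chains_def by (rule qvs.span_add)
  ultimately show "x + y \<in> bar_cycles G k" by (simp only: bar_cycles_def mem_Collect_eq simp_thms)
next
  fix r x assume "x \<in> bar_cycles G k"
  then have x: "x \<in> bar_chains G k" "bar_boundary G x = 0" by (auto simp: bar_cycles_def)
  have "bar_boundary G (qscale r x) = qscale r (bar_boundary G x)"
    unfolding bar_boundary_def using bar_chains_finsupp[OF x(1)] by (intro lin_ext_scale) auto
  also have "\<dots> = 0" by (simp only: x qvs.scale_zero_right)
  moreover have "qscale r x \<in> bar_chains G k"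
    using x(1) unfolding bar_chains_def by (rule qvs.span_scale)
  ultimately show "qscale r x \<in> bar_cycles G k" by (simp only: bar_cycles_def mem_Collect_eq simp_thms)
qed

lemma bar_cycles_finsupp: "z \<in> bar_cycles G k \<Longrightarrow> finsupp z"
  using bar_chains_finsupp by (auto simp: bar_cycles_def)

lemma subspace_albanese_IA: "qvs.subspace (albanese_IA n i)"
proof -
  let ?L = "lin_ext (\<lambda>fs. wedge (map (johnson n) fs))"
  note sub = subspace_bar_cycles[of "IA n" i]
  show ?thesis
    unfolding qvs.subspace_def albanese_IA_eq
  proof (intro conjI ballI allI)
    have "0 = qscale (1 / fact i) (?L 0)" by (simp only: lin_ext_zero qvs.scale_zero_right)
    then show "0 \<in> (\<lambda>z. qscale (1 / fact i) (?L z)) ` bar_cycles (IA n) i"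
      using qvs.subspace_0[OF sub] by blast
  next
    fix x y assume "x \<in> (\<lambda>z. qscale (1 / fact i) (?L z)) ` bar_cycles (IA n) i"
      "y \<in> (\<lambda>z. qscale (1 / fact i) (?L z)) ` bar_cycles (IA n) i"
    then obtain z z' where z: "z \<in> bar_cycles (IA n) i" "z' \<in> bar_cycles (IA n) i"
      "x = qscale (1 / fact i) (?L z)" "y = qscale (1 / fact i) (?L z')" by blast
    have "x + y = qscale (1 / fact i) (?L (z + z'))"
      unfolding lin_ext_add[OF z(1,2)[THEN bar_cycles_finsupp]] z(3,4) by (simp only: qvs.scale_right_distrib)
    then show "x + y \<in> (\<lambda>z. qscale (1 / fact i) (?L z)) ` bar_cycles (IA n) i"
      using qvs.subspace_add[OF sub z(1,2)] by blast
  next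
    fix r x assume "x \<in> (\<lambda>z. qscale (1 / fact i) (?L z)) ` bar_cycles (IA n) i"
    then obtain z where z: "z \<in> bar_cycles (IA n) i" "x = qscale (1 / fact i) (?L z)" by blast
    have "qscale r x = qscale (1 / fact i) (?L (qscale r z))"
      unfolding lin_ext_scale[OF bar_cycles_finsupp[OF z(1)]] z(2) by (rule qvs.scale_left_commute)
    then show "qscale r x \<in> (\<lambda>z. qscale (1 / fact i) (?L z)) ` bar_cycles (IA n) i"
      using qvs.subspace_scale[OF sub z(1)] by blast
  qed
qed

lemma wedge_johnson_in_albanese_IA:
  assumes fs: "set fs \<subseteq> carrier (IA n)"
    and comm: "\<And>f g. f \<in> set fs \<Longrightarrow> g \<in> set fs \<Longrightarrow> f \<otimes>\<^bsub>IA n\<^esub> g = g \<otimes>\<^bsub>IA n\<^esub> f"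
  shows "wedge (map (johnson n) fs) \<in> albanese_IA n (length fs)"
proof -
  have "wedge (map (johnson n) fs)
    = qscale (1 / fact (length fs)) (lin_ext (\<lambda>fs. wedge (map (johnson n) fs)) (abelian_cycle fs))"
    unfolding wedge_abelian_cycle qvs.scale_scale by (simp add: qscale_def fun_eq_iff)
  then show ?thesis
    unfolding albanese_IA_eq using abelian_cycle_in_bar_cycles[OF fs comm] by blast
qed

section \<open>Conjugates of commutator transvections\<close>

text \<open>An automorphism when \<open>c\<close> is not a letter of \<open>u\<close>; for u = x_c
  it would send x_c to its square. The restriction is there because members of \<open>auto\<close>
  are extensional.\<close>

definition transv :: "nat \<Rightarrow> nat \<Rightarrow> word \<Rightarrow> word \<Rightarrow> word"
  where "transv n c u = restrict (ext_hom (free_grp n)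
    (\<lambda>k. if k = c then free_gen c \<otimes>\<^bsub>free_grp n\<^esub> u else free_gen k)) (carrier (free_grp n))"

lemma hom_fixes:
  assumes f: "f \<in> hom (free_grp n) (free_grp n)" and w: "w \<in> carrier (free_grp n)"
    and fix_letters: "\<And>k. k \<in> fst ` set w \<Longrightarrow> f (free_gen k) = free_gen k"
  shows "f w = w"
  using w fix_letters
proof (induction w)
  interpret f: group_hom "free_grp n" "free_grp n" f
    using f group_free_grp by (simp add: group_hom_def group_hom_axioms_def)
  {
    case Nil
    show ?case using f.hom_one by (simp add: free_grp_simps)
  next
    case (Cons x w)
    obtain k s where x: "x = (k, s)" by (cases x)
    have w: "w \<in> carrier (free_grp n)" and k: "k < n" and eq: "x # w = [x] \<otimes>\<^bsub>free_grp n\<^esub> w"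
      using Cons.prems(1) reduced_Cons red_cons_reduced x by (auto simp: free_grp_simps)
    have fk: "f (free_gen k) = free_gen k" using Cons.prems(2) x by auto
    have "[x] = (if s then free_gen k else inv\<^bsub>free_grp n\<^esub> free_gen k)"
      using x inv_free_gen[OF k] by (simp add: free_gen_def)
    then have "f [x] = [x]" "[x] \<in> carrier (free_grp n)" using k fk f.hom_inv[of "free_gen k"] by auto
    moreover have "f w = w" using Cons.IH[OF w] Cons.prems(2) by auto
    ultimately show ?case unfolding eq using w by simp
  }
qed

context
  fixes n c :: nat and u :: word
  assumes c: "c < n" and u: "u \<in> carrier (free_grp n)" and avoid: "c \<notin> fst ` set u"
begin

lemma transv_hom: "transv n c u \<in> hom (free_grp n) (free_grp n)"
proof -
  have "ext_hom (free_grp n) (\<lambda>k. if k = c then free_gen c \<otimes>\<^bsub>free_grp n\<^esub> u else free_gen k)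
      \<in> hom (free_grp n) (free_grp n)"
    by (rule ext_hom_hom[OF group_free_grp]) (use c u in auto)
  then show ?thesis unfolding transv_def by (auto simp: hom_def)
qed

lemma transv_gen: "k < n \<Longrightarrow> transv n c u (free_gen k) = (if k = c then free_gen c \<otimes>\<^bsub>free_grp n\<^esub> u else free_gen k)"
  unfolding transv_def by (subst restrict_apply', simp, rule ext_hom_gen[OF group_free_grp]) (use c u in auto)

lemma transv_fixes:
  assumes w: "w \<in> carrier (free_grp n)" and "c \<notin> fst ` set w"
  shows "transv n c u w = w"
proof (rule hom_fixes[OF transv_hom w])
  fix k assume k: "k \<in> fst ` set w"
  then have "k < n" using w by (auto simp: free_grp_simps)
  then show "transv n c u (free_gen k) = free_gen k" using k assms(2) transv_gen by auto
qed

end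

text \<open>The outer transvection fixes \<open>v\<close>, which avoids the letter \<open>c\<close>,
  so the composite sends x_c to x_c u v.\<close>

lemma transv_inverse:
  assumes c: "c < n" and u: "u \<in> carrier (free_grp n)" "c \<notin> fst ` set u"
    and v: "v \<in> carrier (free_grp n)" "c \<notin> fst ` set v" and uv: "u \<otimes>\<^bsub>free_grp n\<^esub> v = \<one>\<^bsub>free_grp n\<^esub>"
    and w: "w \<in> carrier (free_grp n)"
  shows "transv n c u (transv n c v w) = w"
proof -
  interpret T: group_hom "free_grp n" "free_grp n" "transv n c u"
    using transv_hom[OF c u] group_free_grp by (simp add: group_hom_def group_hom_axioms_def)
  have comp: "transv n c u \<circ> transv n c v \<in> hom (free_grp n) (free_grp n)"
    using transv_hom[OF c u] transv_hom[OF c v] by (auto simp: hom_def Pi_iff)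
  have idh: "(\<lambda>x. x) \<in> hom (free_grp n) (free_grp n)" by (auto simp: hom_def)
  have "(transv n c u \<circ> transv n c v) w = (\<lambda>x. x) w"
  proof (rule hom_free_grp_eqI[OF group_free_grp comp idh _ w])
    fix k assume k: "k < n"
    have gc: "free_gen c \<in> carrier (free_grp n)" using c by simp
    have "transv n c u (free_gen c \<otimes>\<^bsub>free_grp n\<^esub> v) = free_gen c"
      unfolding T.hom_mult[OF gc v(1)] transv_gen[OF c u c] transv_fixes[OF c u v]
      using gc u v uv by (simp add: fg.m_assoc)
    then show "(transv n c u \<circ> transv n c v) (free_gen k) = free_gen k"
      using k by (simp add: transv_gen[OF c u] transv_gen[OF c v])
  qed
  then show ?thesis by simp
qed

lemma
  assumes c: "c < n" and u: "u \<in> carrier (free_grp n)" "c \<notin> fst ` set u"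
  shows transv_auto: "transv n c u \<in> auto (free_grp n)"
    and transv_inv: "w \<in> carrier (free_grp n) \<Longrightarrow>
      (inv\<^bsub>AutoGroup (free_grp n)\<^esub> (transv n c u)) w = transv n c (inv\<^bsub>free_grp n\<^esub> u) w"
    and H_class_transv: "w \<in> carrier (free_grp n) \<Longrightarrow>
      H_class (transv n c u w) = H_class w + qscale (H_class w c) (H_class u)"
proof -
  let ?v = "inv\<^bsub>free_grp n\<^esub> u"
  have v: "?v \<in> carrier (free_grp n)" "c \<notin> fst ` set ?v" using u letters_inv[OF u(1)] by auto
  note uv = transv_inverse[OF c u v fg.r_inv[OF u(1)]] and vu = transv_inverse[OF c v u fg.l_inv[OF u(1)]]
  have "bij_betw (transv n c u) (carrier (free_grp n)) (carrier (free_grp n))"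
    by (rule bij_betw_byWitness[where f' = "transv n c ?v"])
      (use uv vu hom_in_carrier[OF transv_hom[OF c u]] hom_in_carrier[OF transv_hom[OF c v]] in auto)
  moreover have "transv n c u \<in> extensional (carrier (free_grp n))" by (simp add: transv_def)
  ultimately show a: "transv n c u \<in> auto (free_grp n)"
    using transv_hom[OF c u] by (simp add: auto_def Bij_def)
  show "(inv\<^bsub>AutoGroup (free_grp n)\<^esub> (transv n c u)) w = transv n c ?v w" if w: "w \<in> carrier (free_grp n)"
  proof -
    have "transv n c ?v w \<in> carrier (free_grp n)" using hom_in_carrier[OF transv_hom[OF c v] w] .
    from auto_inv_apply(2)[OF a this] show ?thesis unfolding uv[OF w] .
  qed
  show "H_class (transv n c u w) = H_class w + qscale (H_class w c) (H_class u)"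
    if w: "w \<in> carrier (free_grp n)"
  proof -
    have "H_class (transv n c u w) = (\<Sum>k<n. qscale (H_class w k) (H_class (transv n c u (free_gen k))))"
      by (rule H_class_auto[OF a w])
    also have "\<dots> = (\<Sum>k<n. qscale (H_class w k) (H_class (free_gen k))
      + (if k = c then qscale (H_class w c) (H_class u) else 0))"
      by (rule sum.cong) (auto simp: transv_gen[OF c u] H_class_mult qscale_def fun_eq_iff algebra_simps)
    also have "\<dots> = H_class w + qscale (H_class w c) (H_class u)"
      unfolding sum.distrib additive_expansion[where D = H_class, OF H_class_mult w, symmetric]
      using c by simp
    finally show ?thesis .
  qed
qed

text \<open>Each transvection fixes the word by which the other one multiplies, so both orders agree
  on every generator.\<close>

lemma transv_commute:
  assumes c: "c < n" and u: "u \<in> carrier (free_grp n)" "c \<notin> fst ` set u"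
    and d: "d < n" and v: "v \<in> carrier (free_grp n)" "d \<notin> fst ` set v"
    and cd: "c \<noteq> d" "c \<notin> fst ` set v" "d \<notin> fst ` set u"
  shows "transv n c u \<otimes>\<^bsub>AutoGroup (free_grp n)\<^esub> transv n d v = transv n d v \<otimes>\<^bsub>AutoGroup (free_grp n)\<^esub> transv n c u"
proof (rule auto_eqI)
  let ?A = "AutoGroup (free_grp n)"
  let ?f = "transv n c u" and ?g = "transv n d v"
  note fa = transv_auto[OF c u] and ga = transv_auto[OF d v]
  show fg: "?f \<otimes>\<^bsub>?A\<^esub> ?g \<in> auto (free_grp n)" "?g \<otimes>\<^bsub>?A\<^esub> ?f \<in> auto (free_grp n)"
    using au.m_closed[of ?f n ?g] au.m_closed[of ?g n ?f] fa ga by (simp_all add: carrier_AutoGroup)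
  fix w assume w: "w \<in> carrier (free_grp n)"
  show "(?f \<otimes>\<^bsub>?A\<^esub> ?g) w = (?g \<otimes>\<^bsub>?A\<^esub> ?f) w"
  proof (rule hom_free_grp_eqI[OF group_free_grp _ _ _ w])
    show "?f \<otimes>\<^bsub>?A\<^esub> ?g \<in> hom (free_grp n) (free_grp n)" "?g \<otimes>\<^bsub>?A\<^esub> ?f \<in> hom (free_grp n) (free_grp n)"
      using fg by (auto simp: auto_def)
    fix k assume k: "k < n"
    then have kc: "free_gen k \<in> carrier (free_grp n)" by simp
    have gens: "free_gen c \<in> carrier (free_grp n)" "free_gen d \<in> carrier (free_grp n)" using c d by simp_all
    show "(?f \<otimes>\<^bsub>?A\<^esub> ?g) (free_gen k) = (?g \<otimes>\<^bsub>?A\<^esub> ?f) (free_gen k)"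
      unfolding AutoGroup_mult_apply[OF fa ga kc] AutoGroup_mult_apply[OF ga fa kc]
        transv_gen[OF c u k] transv_gen[OF d v k]
      using cd(1) by (auto simp: transv_gen[OF c u] transv_gen[OF d v] k c d auto_hom[OF fa gens(2) v(1)]
        auto_hom[OF ga gens(1) u(1)] transv_fixes[OF c u v(1) cd(2)] transv_fixes[OF d v u(1) cd(3)])
  qed
qed

lemma letters_mult_le:
  "fst ` set u \<subseteq> S \<Longrightarrow> fst ` set v \<subseteq> S \<Longrightarrow> fst ` set (u \<otimes>\<^bsub>free_grp n\<^esub> v) \<subseteq> S"
  by (rule order_trans[OF letters_mult Un_least])

lemma comm_letters:
  assumes "a < n" "b < n"
  shows "comm n (free_gen a) (free_gen b) \<in> carrier (free_grp n)"
    and "fst ` set (comm n (free_gen a) (free_gen b)) \<subseteq> {a, b}"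
proof -
  have ab: "free_gen a \<in> carrier (free_grp n)" "free_gen b \<in> carrier (free_grp n)" using assms by simp_all
  then show "comm n (free_gen a) (free_gen b) \<in> carrier (free_grp n)" by simp
  have l: "fst ` set (free_gen k) = {k}" for k by (simp add: free_gen_def)
  have i: "fst ` set (inv\<^bsub>free_grp n\<^esub> free_gen a) \<subseteq> {a}" "fst ` set (inv\<^bsub>free_grp n\<^esub> free_gen b) \<subseteq> {b}"
    using letters_inv[OF ab(1), unfolded l] letters_inv[OF ab(2), unfolded l] .
  show "fst ` set (comm n (free_gen a) (free_gen b)) \<subseteq> {a, b}"
    by (intro letters_mult_le) (use i in \<open>auto simp: l\<close>)
qed

section \<open>Conjugated commutator transvections and their Johnson images\<close>

definition comm_transv :: "nat \<Rightarrow> (word \<Rightarrow> word) \<Rightarrow> nat \<Rightarrow> nat \<Rightarrow> nat \<Rightarrow> word \<Rightarrow> word"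
  where "comm_transv n g a b c = g \<otimes>\<^bsub>AutoGroup (free_grp n)\<^esub> transv n c (comm n (free_gen a) (free_gen b))
    \<otimes>\<^bsub>AutoGroup (free_grp n)\<^esub> inv\<^bsub>AutoGroup (free_grp n)\<^esub> g"

text \<open>Coordinates of the c-th member of the basis dual to the classes of g x_0, ..., g
  x_(n-1), i.e. of the c-th coordinate function composed with the inverse of \<open>g\<close>. The
  value 0 from n on fits the convention for \<open>H_dual\<close>.\<close>

definition covector :: "nat \<Rightarrow> (word \<Rightarrow> word) \<Rightarrow> nat \<Rightarrow> nat \<Rightarrow> rat"
  where "covector n g c m =
    (if m < n then H_class ((inv\<^bsub>AutoGroup (free_grp n)\<^esub> g) (free_gen m)) c else 0)"

text \<open>As \<open>g\<close> need not be in IA_n, its effect on degree two cannot be discarded.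
  The displacement is therefore measured after applying \<open>g\<close>, by the map
  \<open>D\<close> below; it is additive, hence determined on generators, and its value at g^-1 x_m
  is the coordinate at x_m of the Johnson image.\<close>

lemma
  assumes g: "g \<in> auto (free_grp n)" and abc: "a < n" "b < n" "c < n" and ne: "c \<noteq> a" "c \<noteq> b"
  shows comm_transv_IA: "comm_transv n g a b c \<in> carrier (IA n)"
    and johnson_comm_transv: "johnson n (comm_transv n g a b c)
      = tensor (wedge [H_class (g (free_gen a)), H_class (g (free_gen b))]) (covector n g c)"
proof -
  let ?F = "free_grp n" and ?A = "AutoGroup (free_grp n)"
  let ?u = "comm n (free_gen a) (free_gen b)"
  define f where "f = transv n c ?u"
  define h where "h = inv\<^bsub>?A\<^esub> g"
  have ab: "free_gen a \<in> carrier ?F" "free_gen b \<in> carrier ?F" using abc by simp_all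
  have u: "?u \<in> carrier ?F" "c \<notin> fst ` set ?u" using comm_letters[OF abc(1,2)] ne by auto
  have fa: "f \<in> auto ?F" unfolding f_def by (rule transv_auto[OF abc(3) u])
  have ha: "h \<in> auto ?F" unfolding h_def using au.inv_closed[of g n] g by (simp add: carrier_AutoGroup)
  have gfa: "g \<otimes>\<^bsub>?A\<^esub> f \<in> auto ?F" using au.m_closed[of g n f] g fa by (simp add: carrier_AutoGroup)
  have Fa: "comm_transv n g a b c \<in> auto ?F"
    unfolding comm_transv_def f_def[symmetric] h_def[symmetric]
    using au.m_closed[of "g \<otimes>\<^bsub>?A\<^esub> f" n h] gfa ha by (simp add: carrier_AutoGroup)
  have F: "comm_transv n g a b c w = g (f (h w))" if "w \<in> carrier ?F" for w
    unfolding comm_transv_def f_def[symmetric] h_def[symmetric]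
    by (simp only: AutoGroup_mult_apply[OF gfa ha that] AutoGroup_mult_apply[OF g fa auto_closed[OF ha that]])
  have gh: "g (h w) = w" "h (g w) = w" if "w \<in> carrier ?F" for w
    unfolding h_def using auto_inv_apply[OF g that] by auto
  have Hf: "H_class (f w) = H_class w" if "w \<in> carrier ?F" for w
    unfolding f_def H_class_transv[OF abc(3) u that] H_class_comm[OF ab] by (simp add: qscale_def fun_eq_iff)
  have HF: "H_class (comm_transv n g a b c w) = H_class w" if w: "w \<in> carrier ?F" for w
  proof -
    note hw = auto_closed[OF ha w]
    have "H_class (g (f (h w))) = H_class (g (h w))"
      unfolding H_class_auto[OF g auto_closed[OF fa hw]] H_class_auto[OF g hw] Hf[OF hw] ..
    then show ?thesis by (simp only: F[OF w] gh[OF w])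
  qed
  show IA: "comm_transv n g a b c \<in> carrier (IA n)" using Fa HF by (simp add: carrier_IA)
  define D where "D v = quad (inv\<^bsub>?F\<^esub> g v \<otimes>\<^bsub>?F\<^esub> g (f v))" for v
  let ?\<omega> = "wedge [H_class (g (free_gen a)), H_class (g (free_gen b))]"
  have Dadd: "D (x \<otimes>\<^bsub>?F\<^esub> y) = D x + D y" if x: "x \<in> carrier ?F" and y: "y \<in> carrier ?F" for x y
  proof -
    define p where "p z = inv\<^bsub>?F\<^esub> g z \<otimes>\<^bsub>?F\<^esub> g (f z)" for z
    have pc: "p z \<in> carrier ?F" "H_class (p z) = 0" if z: "z \<in> carrier ?F" for z
    proof -
      note gz = auto_closed[OF g z] and fz = auto_closed[OF fa z]
      note gfz = auto_closed[OF g fz]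
      show "p z \<in> carrier ?F" unfolding p_def using gz gfz by simp
      have "H_class (g (f z)) = H_class (g z)"
        unfolding H_class_auto[OF g fz] H_class_auto[OF g z] Hf[OF z] ..
      then show "H_class (p z) = 0" unfolding p_def H_class_mult H_class_inv[OF gz] by simp
    qed
    note gx = auto_closed[OF g x] and gy = auto_closed[OF g y]
    note gfx = auto_closed[OF g auto_closed[OF fa x]] and gfy = auto_closed[OF g auto_closed[OF fa y]]
    \<comment> \<open>The displacement of a product is a conjugate of the first displacement times
      the second, and \<open>quad\<close> ignores conjugation of words of class zero.\<close>
    have "p (x \<otimes>\<^bsub>?F\<^esub> y) = (inv\<^bsub>?F\<^esub> g y \<otimes>\<^bsub>?F\<^esub> p x \<otimes>\<^bsub>?F\<^esub> g y) \<otimes>\<^bsub>?F\<^esub> p y"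
    proof -
      have "p (x \<otimes>\<^bsub>?F\<^esub> y) = inv\<^bsub>?F\<^esub> g y \<otimes>\<^bsub>?F\<^esub> p x \<otimes>\<^bsub>?F\<^esub> g (f y)"
        unfolding p_def auto_hom[OF fa x y] auto_hom[OF g x y] auto_hom[OF g auto_closed[OF fa x] auto_closed[OF fa y]]
        using gx gy gfx gfy by (simp add: fg.inv_mult_group fg.m_assoc)
      also have "\<dots> = (inv\<^bsub>?F\<^esub> g y \<otimes>\<^bsub>?F\<^esub> p x \<otimes>\<^bsub>?F\<^esub> g y) \<otimes>\<^bsub>?F\<^esub> (inv\<^bsub>?F\<^esub> g y \<otimes>\<^bsub>?F\<^esub> g (f y))"
        by (rule fg.cancel_middle[symmetric]) (use pc[OF x] gy gfy in auto)
      finally show ?thesis unfolding p_def[of y] .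
    qed
    moreover have "quad ((inv\<^bsub>?F\<^esub> g y \<otimes>\<^bsub>?F\<^esub> p x \<otimes>\<^bsub>?F\<^esub> g y) \<otimes>\<^bsub>?F\<^esub> p y)
      = quad (inv\<^bsub>?F\<^esub> g y \<otimes>\<^bsub>?F\<^esub> p x \<otimes>\<^bsub>?F\<^esub> g y) + quad (p y)"
      by (rule quad_mult) (use pc[OF y] in blast)
    ultimately show ?thesis
      unfolding D_def p_def[symmetric] by (simp only: quad_conj[OF pc(1)[OF x] gy pc(2)[OF x]])
  qed
  have Dgen: "D (free_gen k) = (if k = c then ?\<omega> else 0)" if k: "k < n" for k
  proof -
    have gk: "g (free_gen k) \<in> carrier ?F" using auto_closed[OF g] k by simp
    have fk: "f (free_gen k) = (if k = c then free_gen c \<otimes>\<^bsub>?F\<^esub> ?u else free_gen k)"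
      unfolding f_def by (rule transv_gen[OF abc(3) u k])
    show ?thesis
    proof (cases "k = c")
      case True
      have gcc: "free_gen c \<in> carrier ?F" using abc by simp
      have "inv\<^bsub>?F\<^esub> g (free_gen c) \<otimes>\<^bsub>?F\<^esub> g (free_gen c \<otimes>\<^bsub>?F\<^esub> ?u) = g ?u"
        unfolding auto_hom[OF g gcc u(1)]
        using auto_closed[OF g gcc] auto_closed[OF g u(1)] by (simp add: fg.m_assoc[symmetric])
      then have "D (free_gen c) = quad (comm n (g (free_gen a)) (g (free_gen b)))"
        using fk True unfolding D_def auto_comm[OF g ab, symmetric] by simp
      then show ?thesis
        using True quad_comm[OF auto_closed[OF g ab(1)] auto_closed[OF g ab(2)]] by simp
    next
      case False
      then have "D (free_gen k) = quad \<one>\<^bsub>?F\<^esub>" unfolding D_def fk using fg.l_inv[OF gk] by simp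
      also have "\<dots> = 0" by (simp add: quad_def fun_eq_iff free_grp_simps)
      finally show ?thesis using False by simp
    qed
  qed
  have D: "D v = qscale (H_class v c) ?\<omega>" if v: "v \<in> carrier ?F" for v
  proof -
    have "D v = (\<Sum>k<n. qscale (H_class v k) (D (free_gen k)))"
      using additive_expansion[where D = D, OF Dadd v] .
    also have "\<dots> = (\<Sum>k<n. if k = c then qscale (H_class v c) ?\<omega> else 0)"
      by (rule sum.cong) (auto simp: Dgen qscale_def fun_eq_iff)
    also have "\<dots> = qscale (H_class v c) ?\<omega>" using abc(3) by simp
    finally show ?thesis .
  qed
  have "quad (inv\<^bsub>?F\<^esub> free_gen m \<otimes>\<^bsub>?F\<^esub> comm_transv n g a b c (free_gen m))
    = qscale (covector n g c m) ?\<omega>" if m: "m < n" for m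
  proof -
    have mc: "free_gen m \<in> carrier ?F" using m by simp
    have "quad (inv\<^bsub>?F\<^esub> free_gen m \<otimes>\<^bsub>?F\<^esub> comm_transv n g a b c (free_gen m)) = D (h (free_gen m))"
      unfolding D_def F[OF mc] gh[OF mc] ..
    also have "\<dots> = qscale (covector n g c m) ?\<omega>"
      unfolding D[OF auto_closed[OF ha mc]] covector_def h_def[symmetric] using m by simp
    finally show ?thesis .
  qed
  then have "johnson n (comm_transv n g a b c) = (\<Sum>m<n. tensor (qscale (covector n g c m) ?\<omega>) (delta m))"
    unfolding johnson_eq[OF IA] by (intro sum.cong) auto
  also have "\<dots> = tensor ?\<omega> (covector n g c)"
  proof
    fix x :: "nat list \<times> nat"
    obtain y k where x: "x = (y, k)" by (cases x)
    have "(\<Sum>m<n. tensor (qscale (covector n g c m) ?\<omega>) (delta m)) x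
      = (\<Sum>m<n. if m = k then covector n g c k * ?\<omega> y else 0)"
      unfolding sum_pointwise x by (rule sum.cong) (auto simp: tensor_def qscale_def delta_def)
    also have "\<dots> = ?\<omega> y * covector n g c k" by (auto simp: covector_def)
    finally show "(\<Sum>m<n. tensor (qscale (covector n g c m) ?\<omega>) (delta m)) x = tensor ?\<omega> (covector n g c) x"
      by (simp add: x tensor_def)
  qed
  finally show "johnson n (comm_transv n g a b c) = tensor ?\<omega> (covector n g c)" .
qed

lemma (in group) conj_commute:
  assumes "g \<in> carrier G" "x \<in> carrier G" "y \<in> carrier G" "x \<otimes> y = y \<otimes> x"
  shows "(g \<otimes> x \<otimes> inv g) \<otimes> (g \<otimes> y \<otimes> inv g) = (g \<otimes> y \<otimes> inv g) \<otimes> (g \<otimes> x \<otimes> inv g)"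
proof -
  have "(g \<otimes> x \<otimes> inv g) \<otimes> (g \<otimes> y \<otimes> inv g) = g \<otimes> (x \<otimes> y) \<otimes> inv g"
    if "x \<in> carrier G" "y \<in> carrier G" for x y
  proof -
    have "(g \<otimes> x \<otimes> inv g) \<otimes> (inv (inv g) \<otimes> (y \<otimes> inv g)) = (g \<otimes> x) \<otimes> (y \<otimes> inv g)"
      using that assms(1) by (intro cancel_middle) auto
    then show ?thesis using that assms(1) by (simp add: m_assoc)
  qed
  then show ?thesis using assms by simp
qed

lemma comm_transv_commute:
  assumes g: "g \<in> auto (free_grp n)"
    and abc: "a < n" "b < n" "c < n" "c \<noteq> a" "c \<noteq> b"
    and abc': "a' < n" "b' < n" "c' < n" "c' \<noteq> a'" "c' \<noteq> b'"
    and ne: "c \<noteq> c'" "c \<noteq> a'" "c \<noteq> b'" "c' \<noteq> a" "c' \<noteq> b"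
  shows "comm_transv n g a b c \<otimes>\<^bsub>IA n\<^esub> comm_transv n g a' b' c'
    = comm_transv n g a' b' c' \<otimes>\<^bsub>IA n\<^esub> comm_transv n g a b c"
proof -
  have u: "comm n (free_gen a) (free_gen b) \<in> carrier (free_grp n)"
    "c \<notin> fst ` set (comm n (free_gen a) (free_gen b))" "c' \<notin> fst ` set (comm n (free_gen a) (free_gen b))"
    using comm_letters[OF abc(1,2)] abc ne by auto
  have v: "comm n (free_gen a') (free_gen b') \<in> carrier (free_grp n)"
    "c' \<notin> fst ` set (comm n (free_gen a') (free_gen b'))" "c \<notin> fst ` set (comm n (free_gen a') (free_gen b'))"
    using comm_letters[OF abc'(1,2)] abc' ne by auto
  show ?thesis
    unfolding mult_IA comm_transv_def
    by (rule au.conj_commute)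
      (simp_all only: carrier_AutoGroup g transv_auto[OF abc(3) u(1,2)] transv_auto[OF abc'(3) v(1,2)]
        transv_commute[OF abc(3) u(1,2) abc'(3) v(1,2) ne(1) v(3) u(3)])
qed

section \<open>Frames: bases of H and their duals induced by automorphisms\<close>

definition frame :: "nat \<Rightarrow> nat \<Rightarrow> (word \<Rightarrow> word) \<Rightarrow> nat list \<Rightarrow> (nat \<Rightarrow> rat) list"
  where "frame n p g K = map (\<lambda>k. if k < p then H_class (g (free_gen (K ! k))) else covector n g (K ! k)) [0..<length K]"

lemma covector_one:
  assumes "c < n"
  shows "covector n \<one>\<^bsub>AutoGroup (free_grp n)\<^esub> c = delta c"
proof
  fix m
  show "covector n \<one>\<^bsub>AutoGroup (free_grp n)\<^esub> c m = delta c m"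
    using assms AutoGroup_one_apply[of "free_gen m" "free_grp n"]
    by (auto simp: covector_def au.inv_one H_class_free_gen delta_def)
qed

lemma frame_one:
  assumes "K \<in> index_lists n N"
  shows "frame n p \<one>\<^bsub>AutoGroup (free_grp n)\<^esub> K = map delta K"
proof (rule nth_equalityI)
  fix k assume "k < length (frame n p \<one>\<^bsub>AutoGroup (free_grp n)\<^esub> K)"
  then have k: "k < length K" "K ! k < n" using assms index_lists_nth[OF assms, of k]
    by (auto simp: frame_def index_lists_def)
  then show "frame n p \<one>\<^bsub>AutoGroup (free_grp n)\<^esub> K ! k = map delta K ! k"
    by (simp add: frame_def AutoGroup_one_apply H_class_free_gen covector_one)
qed (simp add: frame_def)

text \<open>The matrix is induced by the Nielsen automorphism x_b -> x_b x_a, applied after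
  \<open>g\<close>. The covectors use the inverse composite, where x_b -> x_b x_a^-1 acts first;
  this produces the subtraction.\<close>

lemma elementary_frame:
  assumes g: "g \<in> auto (free_grp n)" and K: "K \<in> index_lists n N" and ab: "a < n" "b < n" "a \<noteq> b"
  shows "\<exists>g'\<in>auto (free_grp n). elementary p 1 a b (frame n p g K) = frame n p g' K"
proof -
  let ?F = "free_grp n" and ?A = "AutoGroup (free_grp n)"
  have u: "free_gen a \<in> carrier ?F" "b \<notin> fst ` set (free_gen a)" using ab by (simp, simp add: free_gen_def)
  have v: "inv\<^bsub>?F\<^esub> free_gen a \<in> carrier ?F" "b \<notin> fst ` set (inv\<^bsub>?F\<^esub> free_gen a)"
    using u letters_inv[OF u(1)] by auto
  define t where "t = transv n b (free_gen a)"
  have ta: "t \<in> auto ?F" unfolding t_def by (rule transv_auto[OF ab(2) u])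
  have gA: "g \<in> carrier ?A" "t \<in> carrier ?A" using g ta by (simp_all add: carrier_AutoGroup)
  have ia: "inv\<^bsub>?A\<^esub> g \<in> auto ?F" "inv\<^bsub>?A\<^esub> t \<in> auto ?F"
    using au.inv_closed[OF gA(1)] au.inv_closed[OF gA(2)] by (simp_all add: carrier_AutoGroup)
  have ga': "t \<otimes>\<^bsub>?A\<^esub> g \<in> auto ?F" using au.m_closed[OF gA(2,1)] by (simp add: carrier_AutoGroup)
  have vec: "H_class ((t \<otimes>\<^bsub>?A\<^esub> g) x) = (H_class (g x))(a := H_class (g x) a + H_class (g x) b)"
    if x: "x \<in> carrier ?F" for x
    unfolding AutoGroup_mult_apply[OF ta g x] H_class_transv[OF ab(2) u auto_closed[OF g x], folded t_def]
    by (auto simp: qscale_def H_class_free_gen delta_def)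
  have cov: "covector n (t \<otimes>\<^bsub>?A\<^esub> g) c = (covector n g c)(b := covector n g c b - covector n g c a)" for c
  proof
    fix m
    show "covector n (t \<otimes>\<^bsub>?A\<^esub> g) c m = ((covector n g c)(b := covector n g c b - covector n g c a)) m"
    proof (cases "m < n")
      case True
      then have mc: "free_gen m \<in> carrier ?F" by simp
      have "covector n (t \<otimes>\<^bsub>?A\<^esub> g) c m = H_class ((inv\<^bsub>?A\<^esub> g) (transv n b (inv\<^bsub>?F\<^esub> free_gen a) (free_gen m))) c"
        using True unfolding covector_def au.inv_mult_group[OF gA(2,1)] AutoGroup_mult_apply[OF ia mc]
        by (simp only: t_def transv_inv[OF ab(2) u mc] if_True)
      also have "\<dots> = ((covector n g c)(b := covector n g c b - covector n g c a)) m"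
      proof (cases "m = b")
        case True
        have "H_class ((inv\<^bsub>?A\<^esub> g) (free_gen b \<otimes>\<^bsub>?F\<^esub> inv\<^bsub>?F\<^esub> free_gen a)) =
          H_class ((inv\<^bsub>?A\<^esub> g) (free_gen b)) - H_class ((inv\<^bsub>?A\<^esub> g) (free_gen a))"
          using mc True unfolding auto_hom[OF ia(1) mc[unfolded True] v(1)] auto_inv[OF ia(1) u(1)] H_class_mult
            H_class_inv[OF auto_closed[OF ia(1) u(1)]] by simp
        then show ?thesis using True ab by (simp add: transv_gen[OF ab(2) v] covector_def)
      next
        case False
        then show ?thesis using True by (simp add: transv_gen[OF ab(2) v] covector_def)
      qed
      finally show ?thesis .
    next
      case False
      then show ?thesis using ab by (auto simp: covector_def)
    qed
  qed
  have "elementary p 1 a b (frame n p g K) = frame n p (t \<otimes>\<^bsub>?A\<^esub> g) K"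
  proof (rule nth_equalityI)
    fix k assume "k < length (elementary p 1 a b (frame n p g K))"
    then have k: "k < length K" by (simp add: frame_def)
    then have "K ! k < n" using K index_lists_nth[OF K, of k] by (auto simp: index_lists_def)
    then show "elementary p 1 a b (frame n p g K) ! k = frame n p (t \<otimes>\<^bsub>?A\<^esub> g) K ! k"
      using k by (simp add: elementary_def frame_def vec cov)
  qed (simp add: frame_def)
  then show ?thesis using ga' by blast
qed

lemma nth_in_set_take: "k < p \<Longrightarrow> k < length K \<Longrightarrow> K ! k \<in> set (take p K)"
  using nth_mem[of k "take p K"] by simp

lemma nth_in_set_drop: "p \<le> l \<Longrightarrow> l < length K \<Longrightarrow> K ! l \<in> set (drop p K)"
  using nth_mem[of "l - p" "drop p K"] by simp

text \<open>The pairing is the coordinate with index \<open>K ! l\<close> of g^-1 (g x), with x the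
  generator of index \<open>K ! k\<close>; disjointness makes the two indices differ.\<close>

lemma frame_traceless:
  assumes g: "g \<in> auto (free_grp n)" and K: "K \<in> index_lists n N"
    and disj: "set (take p K) \<inter> set (drop p K) = {}" and kl: "k < p" "p \<le> l" "l < N"
  shows "(\<Sum>m<n. (frame n p g K ! k) m * (frame n p g K ! l) m) = 0"
proof -
  let ?F = "free_grp n" and ?A = "AutoGroup (free_grp n)"
  have len: "length K = N" using K by (simp add: index_lists_def)
  let ?x = "free_gen (K ! k)" and ?h = "inv\<^bsub>?A\<^esub> g"
  have x: "?x \<in> carrier ?F" using index_lists_nth[OF K, of k] kl by simp
  have ha: "?h \<in> auto ?F" using au.inv_closed[of g n] g by (simp add: carrier_AutoGroup)
  have "K ! k \<in> set (take p K)" "K ! l \<in> set (drop p K)"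
    using kl len by (auto intro: nth_in_set_take nth_in_set_drop)
  then have ne: "K ! k \<noteq> K ! l" using disj by auto
  have "(\<Sum>m<n. (frame n p g K ! k) m * (frame n p g K ! l) m)
    = (\<Sum>m<n. qscale (H_class (g ?x) m) (H_class (?h (free_gen m)))) (K ! l)"
    unfolding sum_pointwise using kl len by (intro sum.cong) (auto simp: frame_def covector_def qscale_def)
  also have "\<dots> = H_class (?h (g ?x)) (K ! l)"
    unfolding H_class_auto[OF ha auto_closed[OF g x]] ..
  also have "\<dots> = H_class ?x (K ! l)" by (simp only: auto_inv_apply(2)[OF g x])
  also have "\<dots> = 0" using ne by (simp add: H_class_free_gen delta_def)
  finally show ?thesis .
qed

section \<open>The traceless part\<close>

definition wedge_tensor :: "nat \<Rightarrow> (nat \<Rightarrow> rat) list \<Rightarrow> (nat list \<times> nat) list \<Rightarrow> rat"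
  where "wedge_tensor i vs = wedge (map (\<lambda>j.
    tensor (wedge [vs ! (2 * j), vs ! (2 * j + 1)]) (vs ! (2 * i + j))) [0..<i])"

text \<open>Distinctness of the dual indices and disjointness are what
  \<open>comm_transv_commute\<close> asks. The vector indices may repeat, even within a pair, where
  the inner wedge is then zero.\<close>

lemma wedge_tensor_frame:
  assumes g: "g \<in> auto (free_grp n)" and K: "K \<in> index_lists n (2 * i + i)"
    and dist: "distinct (drop (2 * i) K)" and disj: "set (take (2 * i) K) \<inter> set (drop (2 * i) K) = {}"
  shows "wedge_tensor i (frame n (2 * i) g K) \<in> albanese_IA n i"
proof -
  have len: "length K = 2 * i + i" using K by (simp add: index_lists_def)
  have lt: "K ! k < n" if "k < 2 * i + i" for k using index_lists_nth[OF K that] .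
  have dj: "K ! (2 * i + j) \<noteq> K ! k" if "j < i" "k < 2 * i" for j k
  proof -
    have "K ! k \<in> set (take (2 * i) K)" "K ! (2 * i + j) \<in> set (drop (2 * i) K)"
      using that len by (auto intro: nth_in_set_take nth_in_set_drop)
    then show ?thesis using disj by auto
  qed
  have ds: "K ! (2 * i + j) \<noteq> K ! (2 * i + j')" if "j < i" "j' < i" "j \<noteq> j'" for j j'
    using dist that len by (auto simp: distinct_conv_nth)
  define f where "f j = comm_transv n g (K ! (2 * j)) (K ! (2 * j + 1)) (K ! (2 * i + j))" for j
  have ind: "2 * j < 2 * i" "2 * j + 1 < 2 * i" "2 * j < 2 * i + i" "2 * j + 1 < 2 * i + i" "2 * i + j < 2 * i + i"
    if "j < i" for j using that by auto
  have fIA: "f j \<in> carrier (IA n)" if "j < i" for j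
    unfolding f_def using ind[OF that] that by (intro comm_transv_IA[OF g] lt dj) auto
  have fc: "f j \<otimes>\<^bsub>IA n\<^esub> f j' = f j' \<otimes>\<^bsub>IA n\<^esub> f j" if j: "j < i" and j': "j' < i" for j j'
  proof (cases "j = j'")
    case False
    show ?thesis unfolding f_def
      by (rule comm_transv_commute[OF g]; (rule lt ds dj)?; use ind[OF j] ind[OF j'] j j' False in \<open>simp\<close>)
  qed simp
  have "wedge (map (johnson n) (map f [0..<i])) \<in> albanese_IA n (length (map f [0..<i]))"
    by (rule wedge_johnson_in_albanese_IA) (use fIA fc in auto)
  moreover have "map (johnson n) (map f [0..<i]) = map (\<lambda>j.
    tensor (wedge [frame n (2 * i) g K ! (2 * j), frame n (2 * i) g K ! (2 * j + 1)]) (frame n (2 * i) g K ! (2 * i + j))) [0..<i]"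
  proof (rule nth_equalityI)
    fix j assume "j < length (map (johnson n) (map f [0..<i]))"
    then have j: "j < i" by simp
    have "johnson n (f j) = tensor (wedge [H_class (g (free_gen (K ! (2 * j)))), H_class (g (free_gen (K ! (2 * j + 1))))])
      (covector n g (K ! (2 * i + j)))"
      unfolding f_def using ind[OF j] j by (intro johnson_comm_transv[OF g] lt dj) auto
    then show "map (johnson n) (map f [0..<i]) ! j = map (\<lambda>j.
      tensor (wedge [frame n (2 * i) g K ! (2 * j), frame n (2 * i) g K ! (2 * j + 1)]) (frame n (2 * i) g K ! (2 * i + j))) [0..<i] ! j"
      using j ind[OF j] len by (simp add: frame_def)
  qed simp
  ultimately show ?thesis unfolding wedge_tensor_def by (simp only: length_map length_upt diff_zero)
qed

text \<open>Entries are replaced by basis vectors from left to right; \<open>supp\<close> ensures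
  that the coordinates below \<open>n\<close> exhaust each entry.\<close>

lemma multilinear_expansion:
  fixes \<Phi> :: "(nat \<Rightarrow> rat) list \<Rightarrow> 'b \<Rightarrow> rat"
  assumes add: "\<And>us k x y. length us = N \<Longrightarrow> k < N \<Longrightarrow> \<Phi> (us[k := x + y]) = \<Phi> (us[k := x]) + \<Phi> (us[k := y])"
    and scale: "\<And>us k r x. length us = N \<Longrightarrow> k < N \<Longrightarrow> \<Phi> (us[k := qscale r x]) = qscale r (\<Phi> (us[k := x]))"
    and len: "length vs = N" and supp: "\<And>k m. k < N \<Longrightarrow> n \<le> m \<Longrightarrow> (vs ! k) m = 0"
  shows "\<Phi> vs = (\<Sum>K\<in>index_lists n N. qscale (decomposable n vs K) (\<Phi> (map delta K)))"
proof -
  have sums: "\<Phi> (us[k := \<Sum>m\<in>S. qscale (r m) (delta m)]) = (\<Sum>m\<in>S. qscale (r m) (\<Phi> (us[k := delta m])))"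
    if "finite S" "length us = N" "k < N" for S us k and r :: "nat \<Rightarrow> rat"
    using that(1)
  proof (induction S rule: finite_induct)
    case empty
    have "\<Phi> (us[k := qscale 0 0]) = qscale 0 (\<Phi> (us[k := 0]))" by (rule scale[OF that(2,3)])
    then show ?case by (simp only: qvs.scale_zero_left sum.empty)
  next
    case (insert m S)
    show ?case unfolding sum.insert[OF insert(1,2)] add[OF that(2,3)] scale[OF that(2,3)] insert.IH ..
  qed
  have "\<Phi> vs = (\<Sum>K\<in>index_lists n j. qscale (\<Prod>k<j. (vs ! k) (K ! k)) (\<Phi> (map delta K @ drop j vs)))"
    if "j \<le> N" for j
    using that
  proof (induction j)
    case 0
    have "index_lists n 0 = {[]}" by (auto simp: index_lists_def)
    then show ?case by simp
  next
    case (Suc j)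
    then have j: "j < N" by simp
    have step: "\<Phi> (map delta K @ drop j vs) = (\<Sum>m<n. qscale ((vs ! j) m) (\<Phi> (map delta (K @ [m]) @ drop (Suc j) vs)))"
      if K: "K \<in> index_lists n j" for K
    proof -
      let ?us = "map delta K @ drop j vs"
      have lK: "length K = j" using K by (simp add: index_lists_def)
      then have lus: "length ?us = N" using len j by simp
      have "vs ! j = (\<Sum>m<n. qscale ((vs ! j) m) (delta m))"
      proof
        fix y
        have "(\<Sum>m<n. qscale ((vs ! j) m) (delta m)) y = (\<Sum>m<n. if m = y then (vs ! j) y else 0)"
          unfolding sum_pointwise by (rule sum.cong) (auto simp: qscale_def delta_def)
        then show "(vs ! j) y = (\<Sum>m<n. qscale ((vs ! j) m) (delta m)) y"
          using supp[OF j, of y] by (cases "y < n") auto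
      qed
      moreover have "?us = ?us[j := vs ! j]"
        using lK j len by (simp add: list_update_append nth_append Cons_nth_drop_Suc[symmetric])
      moreover have "?us[j := delta m] = map delta (K @ [m]) @ drop (Suc j) vs" for m
        using lK j len by (simp add: list_update_append Cons_nth_drop_Suc[symmetric])
      ultimately show ?thesis using sums[OF finite_lessThan lus j, of "vs ! j" n] by simp
    qed
    have "\<Phi> vs = (\<Sum>K\<in>index_lists n j. \<Sum>m<n.
      qscale ((\<Prod>k<j. (vs ! k) (K ! k)) * (vs ! j) m) (\<Phi> (map delta (K @ [m]) @ drop (Suc j) vs)))"
      unfolding Suc.IH[OF less_imp_le[OF j]]
      by (intro sum.cong refl) (simp only: step qvs.scale_sum_right qvs.scale_scale)
    also have "\<dots> = (\<Sum>(K, m)\<in>index_lists n j \<times> {..<n}.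
      qscale ((\<Prod>k<j. (vs ! k) (K ! k)) * (vs ! j) m) (\<Phi> (map delta (K @ [m]) @ drop (Suc j) vs)))"
      by (rule sum.cartesian_product)
    also have "\<dots> = (\<Sum>K\<in>index_lists n (Suc j). qscale (\<Prod>k<Suc j. (vs ! k) (K ! k)) (\<Phi> (map delta K @ drop (Suc j) vs)))"
    proof (rule sum.reindex_bij_witness[where i = "\<lambda>K. (butlast K, last K)" and j = "\<lambda>(K, m). K @ [m]"])
      fix x assume x: "x \<in> index_lists n j \<times> {..<n}"
      obtain K m where Km: "x = (K, m)" by (cases x)
      have lK: "length K = j" using x Km by (simp add: index_lists_def)
      have "(\<Prod>k<j. (vs ! k) ((K @ [m]) ! k)) = (\<Prod>k<j. (vs ! k) (K ! k))"
        by (rule prod.cong) (auto simp: nth_append lK)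
      then show "qscale (\<Prod>k<Suc j. (vs ! k) ((case x of (K, m) \<Rightarrow> K @ [m]) ! k))
          (\<Phi> (map delta (case x of (K, m) \<Rightarrow> K @ [m]) @ drop (Suc j) vs)) =
        (case x of (K, m) \<Rightarrow> qscale ((\<Prod>k<j. (vs ! k) (K ! k)) * (vs ! j) m) (\<Phi> (map delta (K @ [m]) @ drop (Suc j) vs)))"
        using lK by (simp add: Km nth_append)
    next
      fix K assume K: "K \<in> index_lists n (Suc j)"
      then have K': "K \<noteq> []" "length K = Suc j" "set K \<subseteq> {..<n}" by (auto simp: index_lists_def)
      moreover have "last K < n" using last_in_set[OF K'(1)] K'(3) by auto
      ultimately show "(butlast K, last K) \<in> index_lists n j \<times> {..<n}" "(case (butlast K, last K) of (K, m) \<Rightarrow> K @ [m]) = K"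
        by (auto simp: index_lists_def dest: in_set_butlastD)
    qed (auto simp: index_lists_def)
    finally show ?case .
  qed
  from this[OF order_refl] show ?thesis
    using len by (simp add: decomposable_def cong: sum.cong)
qed

lemma
  assumes len: "length us = 2 * i + i" and k: "k < 2 * i + i"
  shows wedge_tensor_add: "wedge_tensor i (us[k := x + y]) = wedge_tensor i (us[k := x]) + wedge_tensor i (us[k := y])"
    and wedge_tensor_scale: "wedge_tensor i (us[k := qscale r x]) = qscale r (wedge_tensor i (us[k := x]))"
proof -
  define c where "c j vs = tensor (wedge [vs ! (2 * j), vs ! (2 * j + 1)]) (vs ! (2 * i + j))"
    for j and vs :: "(nat \<Rightarrow> rat) list"
  \<comment> \<open>The outer wedge factor containing position \<open>k\<close>: factor j owns the
    positions 2j, 2j + 1 and 2i + j, so an update at \<open>k\<close> touches a single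
    argument.\<close>
  define j where "j = (if k < 2 * i then k div 2 else k - 2 * i)"
  have j: "j < i" using k by (auto simp: j_def)
  have kj: "k = 2 * j \<or> k = 2 * j + 1 \<or> k = 2 * i + j" using k by (auto simp: j_def)
  have other: "c j' (us[k := z]) = c j' us" if "j' < i" "j' \<noteq> j" for j' z
  proof -
    have "k \<noteq> 2 * j'" using kj that j by (elim disjE; arith)
    moreover have "k \<noteq> 2 * j' + 1" using kj that j by (elim disjE; arith)
    moreover have "k \<noteq> 2 * i + j'" using kj that j by (elim disjE; arith)
    ultimately show ?thesis unfolding c_def by simp
  qed
  have W: "wedge_tensor i (us[k := z]) = wedge ((map (\<lambda>j. c j us) [0..<i])[j := c j (us[k := z])])" for z
    unfolding wedge_tensor_def c_def[symmetric]
    by (intro arg_cong[where f = wedge] nth_equalityI) (auto simp: nth_list_update other j)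
  have l: "j < length (map (\<lambda>j. c j us) [0..<i])" using j by simp
  have ks: "k < length us" "2 * j < length us" "2 * j + 1 < length us" "2 * i + j < length us" using len k j by auto
  have nes: "2 * j + 1 \<noteq> 2 * i + j" "2 * j \<noteq> 2 * i + j" using j by auto
  have "c j (us[k := x + y]) = c j (us[k := x]) + c j (us[k := y])"
    using kj ks nes by (auto simp: c_def fun_eq_iff tensor_def wedge2 nth_list_update algebra_simps)
  then show "wedge_tensor i (us[k := x + y]) = wedge_tensor i (us[k := x]) + wedge_tensor i (us[k := y])"
    unfolding W by (simp only: wedge_add[OF l])
  have "c j (us[k := qscale r x]) = qscale r (c j (us[k := x]))"
    using kj ks nes by (auto simp: c_def fun_eq_iff tensor_def wedge2 nth_list_update qscale_def algebra_simps)
  then show "wedge_tensor i (us[k := qscale r x]) = qscale r (wedge_tensor i (us[k := x]))"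
    unfolding W by (simp only: wedge_scale[OF l])
qed

lemma frame_support:
  assumes g: "g \<in> auto (free_grp n)" and K: "K \<in> index_lists n N" and k: "k < N" "n \<le> m"
  shows "(frame n p g K ! k) m = 0"
proof -
  have "free_gen (K ! k) \<in> carrier (free_grp n)" using index_lists_nth[OF K k(1)] by simp
  from exp_sum_outside[OF auto_closed[OF g this] k(2)] show ?thesis
    using K k by (auto simp: frame_def covector_def H_class_def index_lists_def)
qed

text \<open>Passes from pairs of lists to single lists cut after 2i entries, the form in which the
  spanning theorem is stated.\<close>

lemma tensors_to_ext_eq:
  assumes t: "t \<in> mixed_tensors n (2 * i) i"
  shows "tensors_to_ext i t = (\<Sum>K\<in>index_lists n (2 * i + i).
    qscale (t (take (2 * i) K, drop (2 * i) K)) (wedge_tensor i (map delta K)))"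
proof -
  define E where "E = (\<lambda>(I, J). wedge (map (\<lambda>j.
    tensor (wedge [delta (I ! (2 * j)), delta (I ! (2 * j + 1))]) (delta (J ! j))) [0..<i]) :: (nat list \<times> nat) list \<Rightarrow> rat)"
  let ?s = "\<lambda>K :: nat list. (take (2 * i) K, drop (2 * i) K)"
  let ?S = "?s ` index_lists n (2 * i + i)"
  have "{x. t x \<noteq> 0} \<subseteq> ?S"
  proof
    fix x assume "x \<in> {x. t x \<noteq> 0}"
    moreover obtain I J where x: "x = (I, J)" by (cases x)
    ultimately have "length I = 2 * i" "length J = i" "set I \<subseteq> {..<n}" "set J \<subseteq> {..<n}"
      using mixed_tensors_support[OF t, of I J] by auto
    then show "x \<in> ?S" unfolding x by (intro image_eqI[of _ _ "I @ J"]) (auto simp: index_lists_def)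
  qed
  then have "tensors_to_ext i t = (\<Sum>x\<in>?S. qscale (t x) (E x))"
    unfolding tensors_to_ext_def E_def[symmetric] by (intro lin_ext_eq finite_imageI finite_index_lists)
  also have "\<dots> = (\<Sum>K\<in>index_lists n (2 * i + i). qscale (t (?s K)) (E (?s K)))"
  proof -
    have "inj_on ?s (index_lists n (2 * i + i))"
      by (rule inj_onI) (metis Pair_inject append_take_drop_id)
    from sum.reindex[OF this, of "\<lambda>x. qscale (t x) (E x)"] show ?thesis by (simp only: comp_def)
  qed
  also have "\<dots> = (\<Sum>K\<in>index_lists n (2 * i + i). qscale (t (?s K)) (wedge_tensor i (map delta K)))"
  proof (rule sum.cong)
    fix K assume K: "K \<in> index_lists n (2 * i + i)"
    have "E (?s K) = wedge_tensor i (map delta K)"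
      unfolding E_def wedge_tensor_def case_prod_conv
      by (intro arg_cong[where f = wedge] map_cong refl) (use K in \<open>auto simp: index_lists_def\<close>)
    then show "qscale (t (?s K)) (E (?s K)) = qscale (t (?s K)) (wedge_tensor i (map delta K))" by simp
  qed simp
  finally show ?thesis .
qed

lemma traceless_tensors_traceless_on:
  assumes "t \<in> traceless_tensors n p q"
  shows "(\<lambda>K. t (take p K, drop p K)) \<in> traceless_on n p q"
  unfolding traceless_on_def
proof (intro CollectI ballI allI impI)
  fix K k l assume K: "K \<in> index_lists n (p + q)" and kl: "k < p" "p \<le> l" "l < p + q"
  have len: "length K = p + q" using K by (simp add: index_lists_def)
  define l' where "l' = l - p"
  have l': "l = p + l'" "l' < q" using kl by (auto simp: l'_def)
  \<comment> \<open>Contraction inserts an entry, whereas the trace condition overwrites one;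
    overwriting is deletion followed by insertion at the same place.\<close>
  have upd: "L[j := m] = take j (take j L @ drop (Suc j) L) @ m # drop j (take j L @ drop (Suc j) L)"
    if "j < length L" for L :: "nat list" and j m
    using that by (simp add: upd_conv_take_nth_drop)
  define I where "I = take k (take p K) @ drop (Suc k) (take p K)"
  define J where "J = take l' (drop p K) @ drop (Suc l') (drop p K)"
  have "take p (K[k := m, l := m]) = take k I @ m # drop k I" for m
  proof -
    have "take p (K[k := m, l := m]) = (take p K)[k := m]" using kl by (simp add: take_update_swap list_update_beyond)
    then show ?thesis using kl len upd[of k "take p K" m] by (simp only: I_def) simp
  qed
  moreover have "drop p (K[k := m, l := m]) = take l' J @ m # drop l' J" for m
  proof -
    have "drop p (K[k := m, l := m]) = (drop p K)[l' := m]" using kl l' by (simp add: drop_update_swap)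
    then show ?thesis using len l' upd[of l' "drop p K" m] by (simp only: J_def) simp
  qed
  ultimately have "(\<Sum>m<n. t (take p (K[k := m, l := m]), drop p (K[k := m, l := m]))) = contraction n k l' t (I, J)"
    by (simp add: contraction_def)
  also have "\<dots> = 0" using assms kl l' by (simp add: traceless_tensors_def)
  finally show "(\<Sum>m<n. t (take p (K[k := m, l := m]), drop p (K[k := m, l := m]))) = 0" .
qed

theorem theorem1p11:
  fixes i n :: nat
  assumes "n \<ge> 3 * i"
  shows "traceless_U n i \<subseteq> albanese_IA n i"
proof
  fix \<tau> assume "\<tau> \<in> traceless_U n i"
  then obtain t where t: "t \<in> traceless_tensors n (2 * i) i" and \<tau>: "\<tau> = tensors_to_ext i t"
    by (auto simp: traceless_U_def)
  let ?I = "index_lists n (2 * i + i)"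
  define G where "G = {frame n (2 * i) g K | g K. g \<in> auto (free_grp n) \<and> K \<in> ?I \<and>
    distinct (drop (2 * i) K) \<and> set (take (2 * i) K) \<inter> set (drop (2 * i) K) = {}}"
  \<comment> \<open>\<open>tensors_to_ext\<close> for list-indexed tensors. It reads
    \<open>w\<close> only on \<open>?I\<close>, so equality of coefficients there is enough.\<close>
  define \<Theta> where "\<Theta> w = (\<Sum>K\<in>?I. qscale (w K) (wedge_tensor i (map delta K)))" for w
  have len: "length vs = 2 * i + i" if "vs \<in> G" for vs
    using that by (auto simp: G_def frame_def index_lists_def)
  have "\<exists>w\<in>qvs.span (decomposable n ` G). \<forall>K\<in>?I. t (take (2 * i) K, drop (2 * i) K) = w K"
  proof (rule traceless_span[where G = G and p = "2 * i" and q = i])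
    show "2 * i + i \<le> n" using assms by simp
    show "(\<lambda>K. t (take (2 * i) K, drop (2 * i) K)) \<in> traceless_on n (2 * i) i"
      by (rule traceless_tensors_traceless_on[OF t])
  next
    fix vs a b assume "vs \<in> G" "a < n" "b < n" "a \<noteq> b"
    then show "elementary (2 * i) 1 a b vs \<in> G" unfolding G_def using elementary_frame by blast
  next
    fix vs k l assume "vs \<in> G" "k < 2 * i" "2 * i \<le> l" "l < 2 * i + i"
    then show "(\<Sum>m<n. (vs ! k) m * (vs ! l) m) = 0" unfolding G_def using frame_traceless by blast
  next
    fix K assume K: "K \<in> ?I" "distinct (drop (2 * i) K)" "set (take (2 * i) K) \<inter> set (drop (2 * i) K) = {}"
    have "\<one>\<^bsub>AutoGroup (free_grp n)\<^esub> \<in> auto (free_grp n)" using au.one_closed[of n] by (simp add: carrier_AutoGroup)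
    then show "map delta K \<in> G" unfolding G_def using K frame_one[OF K(1), symmetric] by blast
  qed (use len in auto)
  then obtain w where w: "w \<in> qvs.span (decomposable n ` G)"
    and tw: "\<And>K. K \<in> ?I \<Longrightarrow> t (take (2 * i) K, drop (2 * i) K) = w K" by blast
  have "\<tau> = \<Theta> w"
    using t unfolding \<tau> \<Theta>_def by (subst tensors_to_ext_eq) (auto simp: traceless_tensors_def tw)
  also have "\<Theta> w \<in> albanese_IA n i"
    using w
  proof (induction rule: qvs.span_induct_alt)
    case base
    have "\<Theta> 0 = 0" unfolding \<Theta>_def by (intro sum.neutral ballI) (simp add: qscale_def fun_eq_iff)
    then show ?case using qvs.subspace_0[OF subspace_albanese_IA] by (simp only:)
  next
    case (step r x y)
    then obtain vs where vs: "vs \<in> G" "x = decomposable n vs" by blast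
    then obtain g K where gK: "vs = frame n (2 * i) g K" "g \<in> auto (free_grp n)" "K \<in> ?I"
      "distinct (drop (2 * i) K)" "set (take (2 * i) K) \<inter> set (drop (2 * i) K) = {}"
      by (auto simp: G_def)
    \<comment> \<open>The coefficients of a decomposable tensor are those in the multilinear
      expansion of \<open>wedge_tensor\<close> at its factors, so \<open>\<Theta>\<close> returns
      the value at the frame itself.\<close>
    have "wedge_tensor i vs = \<Theta> x"
      unfolding \<Theta>_def vs(2)
      by (rule multilinear_expansion[OF wedge_tensor_add wedge_tensor_scale len[OF vs(1)]])
        (use frame_support[OF gK(2,3)] gK(1) in auto)
    then have "\<Theta> x \<in> albanese_IA n i" using wedge_tensor_frame[OF gK(2-5)] gK(1) by simp
    moreover have "\<Theta> (qscale r x + y) = qscale r (\<Theta> x) + \<Theta> y"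
      unfolding \<Theta>_def qvs.scale_sum_right sum.distrib[symmetric]
      by (intro sum.cong refl) (simp add: qscale_def fun_eq_iff algebra_simps)
    ultimately show ?case
      using step.IH subspace_albanese_IA[of n i] by (simp only: qvs.subspace_add qvs.subspace_scale)
  qed
  finally show "\<tau> \<in> albanese_IA n i" .
qed

end
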